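(* Let $\Sigma\in\mathbb R^{m\times m}$ be symmetric positive definite and let $\mathbf A\sim\mathbf W_m(n,\Sigma)$ be a quaternion Wishart matrix. (i) For every $\mathbf M\in\mathbb Q^{k\times m}$ with $\mathrm{rank}(\mathbf M)=k$, $$\mathbf M\mathbf A\mathbf M^*\sim\mathbf W_k(n,\mathbf M\Sigma\mathbf M^* ).$$ (ii) Suppose $m\le n$ and $1\le k<m$. Partition $$\mathbf A=\begin{bmatrix}\mathbf A_{11}&\mathbf A_{12}\\ \mathbf A_{12}^*&\mathbf A_{22}\end{bmatrix},\qquad \Sigma=\begin{bmatrix}\Sigma_{11}&\Sigma_{12}\\ \Sigma_{21}&\Sigma_{22}\end{bmatrix},$$ with $\mathbf A_{11}\in\mathbb Q^{k\times k}$ and $\Sigma_{11}\in\mathbb R^{k\times k}$. Let $\mathbf A_{11,2}=\mathbf A_{11}-\mathbf A_{12}\mathbf A_{22}^{-1}\mathbf A_{12}^*$ and $\Sigma_{11,2}=\Sigma_{11}-\Sigma_{12}\Sigma_{22}^{-1}\Sigma_{21}$. Then $$\mathbf A_{11,2}\sim\mathbf W_k(n-m+k,\Sigma_{11,2}).$$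
   Context: $\mathbb Q$ denotes the real quaternions, $\mathbb Q^{m\times n}$ the $m\times n$ quaternion matrices, and $^*$ the conjugate transpose. Quaternion normal distribution: a random quaternion vector $\mathbf z=z_0+z_1\mathbf i+z_2\mathbf j+z_3\mathbf k\in\mathbb Q^m$ follows $\mathbf N(0,4I_m)$ if $z_0,z_1,z_2,z_3$ are independent real random vectors each distributed as $N(0,I_m)$. The second parameter is the quaternion covariance $\mathsf E(\mathbf z\mathbf z^* )$. For nonsingular $\mathbf B\in\mathbb Q^{m\times m}$ and $\mathbf z\sim\mathbf N(0,4I_m)$, $\mathbf B\mathbf z\sim\mathbf N(0,4\mathbf B\mathbf B^* )$; this defines $\mathbf N(0,\mathbf\Sigma)$ for every Hermitian positive definite $\mathbf\Sigma\in\mathbb Q^{m\times m}$. Quaternion Wishart distribution: if $\mathbf Z=[\mathbf z_1\ \cdots\ \mathbf z_n]$ with $\mathbf z_1,\dots,\mathbf z_n$ independent random $m\times 1$ quaternion vectors, each $\mathbf z_i\sim\mathbf N(0,\mathbf\Sigma)$, then $\mathbf A=\mathbf Z\mathbf Z^*\in\mathbb Q^{m\times m}$ is said to have the quaternion Wishart distribution with $n$ degrees of freedom and covariance matrix $\mathbf\Sigma$, written $\mathbf A\sim\mathbf W_m(n,\mathbf\Sigma)$. The covariance parameter may be a real or a quaternion matrix. For $m\le n$ the blocks $\mathbf A_{22}$ are invertible almost surely. *)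

theory Defs
  imports "HOL-Probability.Probability" "Jordan_Normal_Form.Matrix"
begin

unbundle no vec_syntax

section \<open>The real quaternions\<close>

datatype quat = Quat (qre: real) (qi: real) (qj: real) (qk: real)

lemma quat_eq_iff: "x = y \<longleftrightarrow> qre x = qre y \<and> qi x = qi y \<and> qj x = qj y \<and> qk x = qk y"
  by (cases x; cases y) simp

instantiation quat :: ab_group_add
begin

definition "0 = Quat 0 0 0 0"
definition "x + y = Quat (qre x + qre y) (qi x + qi y) (qj x + qj y) (qk x + qk y)"
definition "- x = Quat (- qre x) (- qi x) (- qj x) (- qk x)"
definition "x - y = Quat (qre x - qre y) (qi x - qi y) (qj x - qj y) (qk x - qk y)"

instance
  by standard
    (simp_all add: zero_quat_def plus_quat_def uminus_quat_def minus_quat_def quat_eq_iff)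

end

lemma quat_group_sel [simp]:
  "qre 0 = 0" "qi 0 = 0" "qj 0 = 0" "qk 0 = 0"
  "qre (x + y) = qre x + qre y" "qi (x + y) = qi x + qi y"
  "qj (x + y) = qj x + qj y" "qk (x + y) = qk x + qk y"
  "qre (- x) = - qre x" "qi (- x) = - qi x" "qj (- x) = - qj x" "qk (- x) = - qk x"
  "qre (x - y) = qre x - qre y" "qi (x - y) = qi x - qi y"
  "qj (x - y) = qj x - qj y" "qk (x - y) = qk x - qk y"
  by (simp_all add: zero_quat_def plus_quat_def uminus_quat_def minus_quat_def)

instantiation quat :: real_vector
begin

definition "scaleR r x = Quat (r * qre x) (r * qi x) (r * qj x) (r * qk x)"

instance
  by standard (simp_all add: scaleR_quat_def quat_eq_iff algebra_simps)

end

lemma quat_scaleR_sel [simp]: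
  "qre (scaleR r x) = r * qre x" "qi (scaleR r x) = r * qi x"
  "qj (scaleR r x) = r * qj x" "qk (scaleR r x) = r * qk x"
  by (simp_all add: scaleR_quat_def)

instantiation quat :: real_algebra_1
begin

definition "1 = Quat 1 0 0 0"

definition "x * y = Quat
  (qre x * qre y - qi x * qi y - qj x * qj y - qk x * qk y)
  (qre x * qi y + qi x * qre y + qj x * qk y - qk x * qj y)
  (qre x * qj y - qi x * qk y + qj x * qre y + qk x * qi y)
  (qre x * qk y + qi x * qj y - qj x * qi y + qk x * qre y)"

instance
  by standard (simp_all add: one_quat_def times_quat_def quat_eq_iff algebra_simps)

end

lemma quat_ring_sel [simp]:
  "qre 1 = 1" "qi 1 = 0" "qj 1 = 0" "qk 1 = 0"
  "qre (x * y) = qre x * qre y - qi x * qi y - qj x * qj y - qk x * qk y"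
  "qi (x * y) = qre x * qi y + qi x * qre y + qj x * qk y - qk x * qj y"
  "qj (x * y) = qre x * qj y - qi x * qk y + qj x * qre y + qk x * qi y"
  "qk (x * y) = qre x * qk y + qi x * qj y - qj x * qi y + qk x * qre y"
  by (simp_all add: one_quat_def times_quat_def)

definition qcnj :: "quat \<Rightarrow> quat"
  where "qcnj x = Quat (qre x) (- qi x) (- qj x) (- qk x)"

lemma qcnj_sel [simp]:
  "qre (qcnj x) = qre x" "qi (qcnj x) = - qi x" "qj (qcnj x) = - qj x" "qk (qcnj x) = - qk x"
  by (simp_all add: qcnj_def)

definition qnormsq :: "quat \<Rightarrow> real"
  where "qnormsq x = (qre x)\<^sup>2 + (qi x)\<^sup>2 + (qj x)\<^sup>2 + (qk x)\<^sup>2"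

lemma qnormsq_nonneg: "0 \<le> qnormsq x"
  by (simp add: qnormsq_def)

lemma qnormsq_eq_0_iff: "qnormsq x = 0 \<longleftrightarrow> x = 0"
  by (simp add: qnormsq_def quat_eq_iff add_nonneg_eq_0_iff)

instantiation quat :: division_ring
begin

definition "inverse x = scaleR (1 / qnormsq x) (qcnj x)"
definition "x div y = x * inverse y" for x y :: quat

instance
proof
  fix x :: quat
  assume "x \<noteq> 0"
  then have nz: "qnormsq x \<noteq> 0"
    by (simp add: qnormsq_eq_0_iff)
  have l: "qcnj x * x = scaleR (qnormsq x) 1" and r: "x * qcnj x = scaleR (qnormsq x) 1"
    by (simp_all add: quat_eq_iff qnormsq_def power2_eq_square)
  show "inverse x * x = 1" and "x * inverse x = 1"
    using nz by (simp_all only: inverse_quat_def mult_scaleR_left mult_scaleR_right l r) simp_all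
qed (simp_all add: divide_quat_def inverse_quat_def quat_eq_iff)

end

instantiation quat :: real_inner
begin

definition "inner x y = qre x * qre y + qi x * qi y + qj x * qj y + qk x * qk y"
definition "norm x = sqrt (inner x x)" for x :: quat
definition "sgn x = x /\<^sub>R norm x" for x :: quat
definition "dist x y = norm (x - y)" for x y :: quat
definition "(uniformity :: (quat \<times> quat) filter) = (INF e\<in>{0<..}. principal {(x, y). dist x y < e})"
definition "open (U :: quat set) \<longleftrightarrow> (\<forall>x\<in>U. eventually (\<lambda>(x', y). x' = x \<longrightarrow> y \<in> U) uniformity)"

instance
proof
  fix x y z :: quat and r :: real
  show "inner x y = inner y x" "inner (x + y) z = inner x z + inner y z"
    "inner (scaleR r x) y = r * inner x y" "0 \<le> inner x x"
    by (simp_all add: inner_quat_def algebra_simps)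
  have "inner x x = qnormsq x"
    by (simp add: inner_quat_def qnormsq_def power2_eq_square)
  then show "inner x x = 0 \<longleftrightarrow> x = 0"
    by (simp add: qnormsq_eq_0_iff)
qed (simp_all only: norm_quat_def sgn_quat_def dist_quat_def uniformity_quat_def open_quat_def)

end

instantiation quat :: euclidean_space
begin

definition "Basis = {Quat 1 0 0 0, Quat 0 1 0 0, Quat 0 0 1 0, Quat 0 0 0 1}"

instance
proof
  fix x u v :: quat
  show "(Basis :: quat set) \<noteq> {}" "finite (Basis :: quat set)"
    by (simp_all add: Basis_quat_def)
  show "inner u v = (if u = v then 1 else 0)" if "u \<in> Basis" "v \<in> Basis"
    using that unfolding Basis_quat_def by (elim insertE emptyE) (simp_all add: inner_quat_def)
  show "(\<forall>u\<in>Basis. inner x u = 0) \<longleftrightarrow> x = 0"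
    unfolding Basis_quat_def Set.ball_simps by (auto simp: inner_quat_def quat_eq_iff)
qed

end


section \<open>Matrices\<close>

definition ctranspose :: "quat mat \<Rightarrow> quat mat"
  where "ctranspose A = mat (dim_col A) (dim_row A) (\<lambda>(i, j). qcnj (A $$ (j, i)))"

abbreviation quat_of_real_mat :: "real mat \<Rightarrow> quat mat"
  where "quat_of_real_mat \<equiv> map_mat of_real"

text \<open>
  The scalars act from the right on the columns: this is the dimension of the right vector space
  spanned by the columns, i.e. the largest number of right linearly independent columns.
\<close>

definition quat_rank :: "quat mat \<Rightarrow> nat"
  where "quat_rank A = Max {card J | J. J \<subseteq> {..<dim_col A} \<and>
    (\<forall>c. (\<forall>i<dim_row A. (\<Sum>j\<in>J. A $$ (i, j) * c j) = 0) \<longrightarrow> (\<forall>j\<in>J. c j = 0))}"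

text \<open>The inverse of a noninvertible matrix is set to zero.\<close>

definition inv_mat :: "'a::semiring_1 mat \<Rightarrow> 'a mat"
  where "inv_mat A = (if invertible_mat A then SOME B. inverts_mat A B \<and> inverts_mat B A
    else 0\<^sub>m (dim_row A) (dim_row A))"

definition sym_pos_def :: "nat \<Rightarrow> real mat \<Rightarrow> bool"
  where "sym_pos_def m S \<longleftrightarrow> S \<in> carrier_mat m m \<and> transpose_mat S = S \<and>
    (\<forall>v\<in>carrier_vec m. v \<noteq> 0\<^sub>v m \<longrightarrow> 0 < scalar_prod v (S *\<^sub>v v))"


section \<open>Quaternion normal and Wishart distributions\<close>

text \<open>The Borel structures on vectors and matrices of fixed size, generated by the entries.\<close>

definition vec_borel :: "nat \<Rightarrow> 'a::topological_space Matrix.vec measure"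
  where "vec_borel m =
    vimage_algebra (carrier_vec m) (\<lambda>v. \<lambda>i\<in>{..<m}. v $ i) (\<Pi>\<^sub>M i\<in>{..<m}. borel)"

definition mat_borel :: "nat \<Rightarrow> nat \<Rightarrow> 'a::topological_space mat measure"
  where "mat_borel m n =
    vimage_algebra (carrier_mat m n) (\<lambda>A. \<lambda>ij\<in>{..<m} \<times> {..<n}. A $$ ij)
      (\<Pi>\<^sub>M ij\<in>{..<m} \<times> {..<n}. borel)"

text \<open>The law $N(0, I_m)$ on real vectors, represented as functions on \<open>{..<m}\<close>.\<close>

definition std_normal_law :: "nat \<Rightarrow> (nat \<Rightarrow> real) measure"
  where "std_normal_law m = (\<Pi>\<^sub>M i\<in>{..<m}. density lborel (\<lambda>x. ennreal (std_normal_density x)))"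

definition qcoord :: "nat \<Rightarrow> quat \<Rightarrow> real"
  where "qcoord c x = [qre x, qi x, qj x, qk x] ! c"

text \<open>
  \<open>z \<sim> N(0, 4 I\<^sub>m)\<close>: the four real component vectors are independent with law $N(0, I_m)$.
\<close>

definition std_quat_normal :: "'w measure \<Rightarrow> nat \<Rightarrow> ('w \<Rightarrow> quat Matrix.vec) \<Rightarrow> bool"
  where "std_quat_normal P m z \<longleftrightarrow>
    prob_space P \<and> z \<in> measurable P (vec_borel m) \<and>
    prob_space.indep_vars P (\<lambda>_. \<Pi>\<^sub>M i\<in>{..<m}. borel)
      (\<lambda>c \<omega>. \<lambda>i\<in>{..<m}. qcoord c (z \<omega> $ i)) {..<4} \<and>
    (\<forall>c<4. distr P (\<Pi>\<^sub>M i\<in>{..<m}. borel) (\<lambda>\<omega>. \<lambda>i\<in>{..<m}. qcoord c (z \<omega> $ i)) = std_normal_law m)"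

text \<open>
  \<open>z \<sim> N(0, S)\<close>, where \<open>S = 4 B B\<^sup>*\<close> with \<open>B\<close> nonsingular. Since \<open>B\<close> is nonsingular, the standard
  normal vector \<open>w\<close> can be taken on the same probability space as \<open>z\<close> without loss of generality.
\<close>

definition quat_normal :: "'w measure \<Rightarrow> nat \<Rightarrow> quat mat \<Rightarrow> ('w \<Rightarrow> quat Matrix.vec) \<Rightarrow> bool"
  where "quat_normal P m S z \<longleftrightarrow>
    (\<exists>B\<in>carrier_mat m m. invertible_mat B \<and> S = 4 \<cdot>\<^sub>m (B * ctranspose B) \<and>
      (\<exists>w. std_quat_normal P m w \<and> (\<forall>\<omega>\<in>space P. z \<omega> = B *\<^sub>v w \<omega>)))"

text \<open>The columns of the \<open>m \<times> n\<close> random matrix \<open>Z\<close> are independent, each distributed as \<open>N(0, S)\<close>.\<close>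

definition quat_normal_sample ::
    "'w measure \<Rightarrow> nat \<Rightarrow> nat \<Rightarrow> quat mat \<Rightarrow> ('w \<Rightarrow> quat mat) \<Rightarrow> bool"
  where "quat_normal_sample P m n S Z \<longleftrightarrow>
    prob_space P \<and> Z \<in> measurable P (mat_borel m n) \<and>
    prob_space.indep_vars P (\<lambda>_. vec_borel m) (\<lambda>j \<omega>. col (Z \<omega>) j) {..<n} \<and>
    (\<forall>j<n. quat_normal P m S (\<lambda>\<omega>. col (Z \<omega>) j))"

text \<open>
  \<open>A\<close> has the law of \<open>Z Z\<^sup>*\<close>. The auxiliary probability space carrying \<open>Z\<close> consists of quaternion
  matrices; this is no restriction, as it may be taken to be the law of \<open>Z\<close>.
\<close>

definition quat_wishart ::
    "'w measure \<Rightarrow> nat \<Rightarrow> nat \<Rightarrow> quat mat \<Rightarrow> ('w \<Rightarrow> quat mat) \<Rightarrow> bool"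
  where "quat_wishart P m n S A \<longleftrightarrow>
    prob_space P \<and> A \<in> measurable P (mat_borel m m) \<and>
    (\<exists>(Q :: quat mat measure) Z. quat_normal_sample Q m n S Z \<and>
      distr P (mat_borel m m) A = distr Q (mat_borel m m) (\<lambda>\<omega>. Z \<omega> * ctranspose (Z \<omega>)))"

end

theory Submission
  imports Defs "Jordan_Normal_Form.Char_Poly"
begin

text \<open>
  Part (i): if \<open>\<Sigma> = 4 B B\<^sup>*\<close>, Gram--Schmidt gives \<open>M B = L V\<close> with \<open>L\<close> invertible and \<open>V V\<^sup>* = 1\<close>,
  and \<open>V w\<close> is standard normal whenever \<open>w\<close> is.

  Part (ii): choose \<open>B\<close> block upper triangular with diagonal blocks \<open>C\<close>, \<open>D\<close>, and write the sample as
  \<open>Z = B W\<close>, where \<open>W\<close> is standard with row blocks \<open>W\<^sub>1\<close>, \<open>W\<^sub>2\<close>. If the rows of \<open>W\<^sub>2\<close> are independent, the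
  Schur complement of \<open>Z Z\<^sup>*\<close> equals \<open>C (W\<^sub>1 Q) (W\<^sub>1 Q)\<^sup>* C\<^sup>*\<close>, where the orthonormal columns of \<open>Q\<close> span
  the orthogonal complement of the row space of \<open>W\<^sub>2\<close>. By Fubini, \<open>Q\<close> may be taken fixed, and then
  \<open>W\<^sub>1 Q\<close> is standard normal.

  The invariance of the standard normal law under maps with orthonormal rows is proved by eliminating
  the entries of one row after another with plane rotations.
\<close>

section \<open>Invariance of the standard normal law\<close>

text \<open>Three obstacles shape the details. Quaternions do not commute, so no ordinary
  determinant decides invertibility. A quaternion matrix \<open>X\<close> is therefore replaced by
  the real matrix of the map \<open>v\<close> to \<open>X v\<close>; its determinant and adjugate
  give a Borel formula for the inverse, and its characteristic polynomial shows that singular blocks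
  are negligible. Next, \<open>Q\<close> depends on the lower rows, and no measurable choice of it
  is attempted: the lower rows are frozen in the outer integral before \<open>Q\<close> is picked,
  and the inner integral has the same value for all independent lower rows. Finally, the definition
  of a normal sample lets every column carry its own factor \<open>B\<close>. Only
  \<open>B B*\<close> is common to the columns, so two factors differ by some \<open>U\<close> with
  \<open>U U* = 1\<close>, which the invariance of the standard law absorbs. The degrees of freedom
  \<open>n - m + k\<close> count the columns of \<open>Q\<close>: the \<open>m - k\<close>
  independent lower rows use up that many of the \<open>n\<close> dimensions. The 4 in the
  covariance is the expected squared norm of a quaternion with four unit-variance coordinates and is
  carried along as a central scalar.\<close>

abbreviation normal_measure :: "real measure"
  where "normal_measure \<equiv> density lborel (\<lambda>x. ennreal (std_normal_density x))"

abbreviation normal_PiM :: "'i set \<Rightarrow> ('i \<Rightarrow> real) measure"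
  where "normal_PiM I \<equiv> PiM I (\<lambda>_. normal_measure)"

abbreviation borel_PiM :: "'i set \<Rightarrow> ('i \<Rightarrow> real) measure"
  where "borel_PiM I \<equiv> PiM I (\<lambda>_. borel)"

lemma prob_space_normal_measure: "prob_space normal_measure"
  using prob_space_normal_density[of 1 0] by simp

interpretation normal_measure: prob_space normal_measure
  by (rule prob_space_normal_measure)

interpretation normal_product: product_prob_space "\<lambda>_::'i. normal_measure" UNIV
  by unfold_locales

lemma sets_PiM_normal_measure: "sets (normal_PiM I) = sets (borel_PiM I)"
  by (intro sets_PiM_cong) auto

lemma measurable_PiM_normal_measure:
  "measurable (normal_PiM I) M = measurable (borel_PiM I) M"
  "measurable M (normal_PiM I) = measurable M (borel_PiM I)"
  by (intro measurable_cong_sets sets_PiM_normal_measure refl)+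

lemma space_PiM_normal_measure: "space (normal_PiM I) = extensional I"
  by (simp add: space_PiM PiE_def)

lemma prob_space_PiM_normal_measure: "prob_space (normal_PiM I)"
  by (intro prob_space_PiM prob_space_normal_measure)

text \<open>The density is even. Once plane rotations have reduced a unit row to a single entry,
  that entry is 1 or -1, and this lemma absorbs the sign.\<close>

lemma nn_integral_normal_measure_reflect:
  assumes [measurable]: "f \<in> borel_measurable borel" and e: "e = 1 \<or> e = (-1::real)"
  shows "(\<integral>\<^sup>+x. f (e * x) \<partial>normal_measure) = (\<integral>\<^sup>+x. f x \<partial>normal_measure)"
proof -
  have "(\<integral>\<^sup>+x. f x \<partial>normal_measure) = (\<integral>\<^sup>+x. ennreal (std_normal_density x) * f x \<partial>lborel)"
    by (simp add: nn_integral_density)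
  also have "\<dots> = \<bar>e\<bar> * (\<integral>\<^sup>+x. ennreal (std_normal_density (0 + e * x)) * f (0 + e * x) \<partial>lborel)"
    by (intro nn_integral_real_affine) (use e in auto)
  also have "\<dots> = (\<integral>\<^sup>+x. ennreal (std_normal_density x) * f (e * x) \<partial>lborel)"
    using e by (auto simp: std_normal_density_def)
  also have "\<dots> = (\<integral>\<^sup>+x. f (e * x) \<partial>normal_measure)"
    by (simp add: nn_integral_density)
  finally show ?thesis by simp
qed

text \<open>With \<open>c\<close> nonzero a rotation splits into two affine substitutions in one
  variable each: \<open>y\<close> becomes \<open>s / c * x + 1 / c * y\<close> for fixed
  \<open>x\<close>, then \<open>x\<close> becomes \<open>c * x - s * y\<close> for fixed
  \<open>y\<close>. Their Jacobian factors are reciprocal, and Fubini exchanges the order of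
  integration in between.\<close>

lemma nn_integral_lborel_rotate:
  fixes h :: "real \<Rightarrow> real \<Rightarrow> ennreal"
  assumes [measurable]: "case_prod h \<in> borel_measurable (borel \<Otimes>\<^sub>M borel)"
    and cs: "c\<^sup>2 + s\<^sup>2 = 1" "c \<noteq> 0"
  shows "(\<integral>\<^sup>+y. \<integral>\<^sup>+x. h (c * x - s * y) (s * x + c * y) \<partial>lborel \<partial>lborel) = (\<integral>\<^sup>+y. \<integral>\<^sup>+x. h x y \<partial>lborel \<partial>lborel)"
proof -
  have "(\<integral>\<^sup>+y. \<integral>\<^sup>+x. h x y \<partial>lborel \<partial>lborel) = (\<integral>\<^sup>+x. \<integral>\<^sup>+y. h x y \<partial>lborel \<partial>lborel)"
    by (rule lborel_pair.Fubini') (simp add: measurable_split_conv)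
  also have "\<dots> = (\<integral>\<^sup>+x. \<bar>1/c\<bar> * (\<integral>\<^sup>+y. h x (s / c * x + 1/c * y) \<partial>lborel) \<partial>lborel)"
    by (intro nn_integral_cong nn_integral_real_affine) (use cs in auto)
  also have "\<dots> = \<bar>1/c\<bar> * (\<integral>\<^sup>+x. \<integral>\<^sup>+y. h x (s / c * x + 1/c * y) \<partial>lborel \<partial>lborel)"
    by (intro nn_integral_cmult) measurable
  also have "\<dots> = \<bar>1/c\<bar> * (\<integral>\<^sup>+y. \<integral>\<^sup>+x. h x (s / c * x + 1/c * y) \<partial>lborel \<partial>lborel)"
    by (intro arg_cong2[where f="(*)"] refl lborel_pair.Fubini'[symmetric]) measurable
  also have "\<dots> = \<bar>1/c\<bar> * (\<integral>\<^sup>+y. \<bar>c\<bar> * (\<integral>\<^sup>+x. h (- s * y + c * x) (s / c * (- s * y + c * x) + 1/c * y) \<partial>lborel) \<partial>lborel)"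
    by (intro arg_cong2[where f="(*)"] refl nn_integral_cong nn_integral_real_affine) (use cs in auto)
  also have "\<dots> = \<bar>1/c\<bar> * (\<bar>c\<bar> * (\<integral>\<^sup>+y. \<integral>\<^sup>+x. h (- s * y + c * x) (s / c * (- s * y + c * x) + 1/c * y) \<partial>lborel \<partial>lborel))"
    by (intro arg_cong2[where f="(*)"] refl nn_integral_cmult) measurable
  also have "\<dots> = (\<integral>\<^sup>+y. \<integral>\<^sup>+x. h (- s * y + c * x) (s / c * (- s * y + c * x) + 1/c * y) \<partial>lborel \<partial>lborel)"
    unfolding mult.assoc[symmetric] using cs by (simp add: ennreal_mult[symmetric])
  also have "\<dots> = (\<integral>\<^sup>+y. \<integral>\<^sup>+x. h (c * x - s * y) (s * x + c * y) \<partial>lborel \<partial>lborel)"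
  proof -
    have "s / c * (- s * y + c * x) + 1/c * y = s * x + (1 - s\<^sup>2) / c * y" for x y
      using cs(2) by (simp add: field_simps power2_eq_square)
    moreover have "(1 - s\<^sup>2) / c = c" using cs by (simp add: power2_eq_square field_simps)
    ultimately have "s / c * (- s * y + c * x) + 1/c * y = s * x + c * y" for x y by simp
    then show ?thesis by (simp add: algebra_simps)
  qed
  finally show ?thesis by simp
qed

text \<open>The product density depends on \<open>x\<close> and \<open>y\<close> only through the
  sum of their squares, so it can be made part of the integrand (\<open>k\<close>) before Lebesgue
  measure is rotated.\<close>

lemma nn_integral_normal_measure_rotate:
  fixes h :: "real \<Rightarrow> real \<Rightarrow> ennreal"
  assumes [measurable]: "case_prod h \<in> borel_measurable (borel \<Otimes>\<^sub>M borel)"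
    and cs: "c\<^sup>2 + s\<^sup>2 = 1" "c \<noteq> 0"
  shows "(\<integral>\<^sup>+y. \<integral>\<^sup>+x. h (c * x - s * y) (s * x + c * y) \<partial>normal_measure \<partial>normal_measure) =
    (\<integral>\<^sup>+y. \<integral>\<^sup>+x. h x y \<partial>normal_measure \<partial>normal_measure)"
proof -
  have dens: "(\<integral>\<^sup>+y. \<integral>\<^sup>+x. k x y \<partial>normal_measure \<partial>normal_measure) =
      (\<integral>\<^sup>+y. \<integral>\<^sup>+x. ennreal (std_normal_density x * std_normal_density y) * k x y \<partial>lborel \<partial>lborel)"
    if [measurable]: "case_prod k \<in> borel_measurable (borel \<Otimes>\<^sub>M borel)" for k
  proof -
    have "(\<integral>\<^sup>+y. \<integral>\<^sup>+x. k x y \<partial>normal_measure \<partial>normal_measure) =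
      (\<integral>\<^sup>+y. ennreal (std_normal_density y) * (\<integral>\<^sup>+x. ennreal (std_normal_density x) * k x y \<partial>lborel) \<partial>lborel)"
      by (simp add: nn_integral_density)
    also have "\<dots> = (\<integral>\<^sup>+y. \<integral>\<^sup>+x. ennreal (std_normal_density y) * (ennreal (std_normal_density x) * k x y) \<partial>lborel \<partial>lborel)"
      by (intro nn_integral_cong nn_integral_cmult[symmetric]) measurable
    finally show ?thesis
      by (simp add: ennreal_mult ac_simps)
  qed
  define k where "k x y = ennreal (std_normal_density x * std_normal_density y) * h x y" for x y
  have [measurable]: "case_prod k \<in> borel_measurable (borel \<Otimes>\<^sub>M borel)"
    unfolding k_def by measurable
  have sq: "(c * x - s * y)\<^sup>2 + (s * x + c * y)\<^sup>2 = x\<^sup>2 + y\<^sup>2" for x y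
  proof -
    have "(c * x - s * y)\<^sup>2 + (s * x + c * y)\<^sup>2 = (c\<^sup>2 + s\<^sup>2) * (x\<^sup>2 + y\<^sup>2)"
      by (simp add: power2_eq_square algebra_simps)
    then show ?thesis using cs by simp
  qed
  have "std_normal_density x * std_normal_density y = exp (- (x\<^sup>2 + y\<^sup>2) / 2) / (sqrt (2 * pi))\<^sup>2" for x y
    by (simp add: std_normal_density_def exp_add[symmetric] power2_eq_square field_simps)
  then have rot: "std_normal_density (c * x - s * y) * std_normal_density (s * x + c * y) =
      std_normal_density x * std_normal_density y" for x y
    by (simp only: sq)
  show ?thesis
    using nn_integral_lborel_rotate[of k, OF _ cs] by (simp add: dens k_def rot)
qed

definition givens :: "real \<Rightarrow> real \<Rightarrow> 'j \<Rightarrow> 'j \<Rightarrow> ('j \<Rightarrow> real) \<Rightarrow> 'j \<Rightarrow> real"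
  where "givens c s a b x = x(a := c * x a - s * x b, b := s * x a + c * x b)"

text \<open>Fubini makes the coordinates \<open>a\<close> and \<open>b\<close> the two innermost
  integrals and turns all others into a parameter \<open>z\<close>; the planar rotation lemma then
  applies for each \<open>z\<close>.\<close>

lemma nn_integral_PiM_givens:
  assumes J: "finite J" "a \<in> J" "b \<in> J" "a \<noteq> b" and cs: "c\<^sup>2 + s\<^sup>2 = 1" "c \<noteq> 0"
    and f: "f \<in> borel_measurable (borel_PiM J)"
  shows "(\<integral>\<^sup>+x. f (givens c s a b x) \<partial>normal_PiM J) = (\<integral>\<^sup>+x. f x \<partial>normal_PiM J)"
proof -
  define K where "K = J - {a, b}"
  have K: "finite K" "b \<notin> K" "a \<notin> insert b K" "J = insert a (insert b K)" "finite (insert b K)"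
    using J by (auto simp: K_def)
  have [measurable]: "f \<in> borel_measurable (borel_PiM (insert a (insert b K)))"
    using f K by simp
  have fN [measurable]: "f \<in> borel_measurable (normal_PiM (insert a (insert b K)))"
    by (simp add: measurable_PiM_normal_measure)
  have split: "(\<integral>\<^sup>+x. g x \<partial>normal_PiM J) =
    (\<integral>\<^sup>+z. \<integral>\<^sup>+y. \<integral>\<^sup>+x. g (z(b := y, a := x)) \<partial>normal_measure \<partial>normal_measure \<partial>normal_PiM K)"
    if "g \<in> borel_measurable (borel_PiM (insert a (insert b K)))" for g
  proof -
    have [measurable]: "g \<in> borel_measurable (normal_PiM (insert a (insert b K)))"
      using that by (simp add: measurable_PiM_normal_measure)
    show ?thesis
      unfolding K(4)
      by (subst normal_product.product_nn_integral_insert[OF K(5) K(3)], simp)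
        (subst normal_product.product_nn_integral_insert[OF K(1) K(2)], measurable)
  qed
  have upd: "(\<lambda>(x,y). z(b := y, a := x)) \<in> measurable (borel \<Otimes>\<^sub>M borel) (borel_PiM (insert a (insert b K)))"
    if "z \<in> space (normal_PiM K)" for z
  proof (rule measurable_PiM_single')
    fix i assume "i \<in> insert a (insert b K)"
    then show "(\<lambda>\<omega>. (case \<omega> of (x, y) \<Rightarrow> z(b := y, a := x)) i) \<in> borel \<Otimes>\<^sub>M borel \<rightarrow>\<^sub>M borel"
      by (cases "i = a"; cases "i = b") (auto simp: split_beta')
  qed (use that in \<open>auto simp: space_PiM PiE_def extensional_def\<close>)
  have g: "(\<lambda>x. givens c s a b x) \<in> measurable (borel_PiM J) (borel_PiM J)"
  proof (rule measurable_PiM_single')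
    fix i assume i: "i \<in> J"
    show "(\<lambda>\<omega>. givens c s a b \<omega> i) \<in> Pi\<^sub>M J (\<lambda>_. borel) \<rightarrow>\<^sub>M borel"
    proof -
      have [measurable]: "(\<lambda>\<omega>. \<omega> j) \<in> Pi\<^sub>M J (\<lambda>_. borel) \<rightarrow>\<^sub>M (borel :: real measure)" if "j \<in> J" for j
        using that by measurable
      show ?thesis
        using J i by (cases "i = a"; cases "i = b") (simp_all add: givens_def)
    qed
  qed (use J in \<open>auto simp: space_PiM givens_def PiE_def extensional_def\<close>)
  have "(\<integral>\<^sup>+x. f (givens c s a b x) \<partial>normal_PiM J) =
     (\<integral>\<^sup>+z. \<integral>\<^sup>+y. \<integral>\<^sup>+x. f (givens c s a b (z(b := y, a := x))) \<partial>normal_measure \<partial>normal_measure \<partial>normal_PiM K)"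
    by (rule split) (use g f K(4) in \<open>simp add: measurable_compose\<close>)
  also have "\<dots> = (\<integral>\<^sup>+z. \<integral>\<^sup>+y. \<integral>\<^sup>+x. f (z(b := s * x + c * y, a := c * x - s * y)) \<partial>normal_measure \<partial>normal_measure \<partial>normal_PiM K)"
  proof -
    have "givens c s a b (z(b := y, a := x)) = z(b := s * x + c * y, a := c * x - s * y)" for z x y
      using J(4) by (auto simp: givens_def fun_eq_iff)
    then show ?thesis by simp
  qed
  also have "\<dots> = (\<integral>\<^sup>+z. \<integral>\<^sup>+y. \<integral>\<^sup>+x. f (z(b := y, a := x)) \<partial>normal_measure \<partial>normal_measure \<partial>normal_PiM K)"
  proof (rule nn_integral_cong)
    fix z assume z: "z \<in> space (normal_PiM K)"
    have "case_prod (\<lambda>x y. f (z(b := y, a := x))) \<in> borel_measurable (borel \<Otimes>\<^sub>M borel)"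
      using measurable_compose[OF upd[OF z], of f borel] by (simp add: split_beta')
    from nn_integral_normal_measure_rotate[OF this cs]
    show "(\<integral>\<^sup>+y. \<integral>\<^sup>+x. f (z(b := s * x + c * y, a := c * x - s * y)) \<partial>normal_measure \<partial>normal_measure) =
      (\<integral>\<^sup>+y. \<integral>\<^sup>+x. f (z(b := y, a := x)) \<partial>normal_measure \<partial>normal_measure)" by simp
  qed
  also have "\<dots> = (\<integral>\<^sup>+x. f x \<partial>normal_PiM J)"
    by (rule split[symmetric]) simp
  finally show ?thesis .
qed

text \<open>Rotating both the coefficient row and the variable leaves a linear form unchanged, so a
  rotation can be traded between them. With two rows in place of row and variable, the same identity
  preserves orthonormality.\<close>

lemma sum_givens_mult:
  assumes J: "finite J" "a \<in> J" "b \<in> J" "a \<noteq> b" and cs: "c\<^sup>2 + s\<^sup>2 = 1"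
  shows "(\<Sum>j\<in>J. givens c s a b g j * givens c s a b h j) = (\<Sum>j\<in>J. g j * h j)"
proof -
  define K where "K = J - {a, b}"
  have K: "finite K" "b \<notin> K" "a \<notin> insert b K" "J = insert a (insert b K)"
    using J by (auto simp: K_def)
  have "(c * g a - s * g b) * (c * h a - s * h b) + (s * g a + c * g b) * (s * h a + c * h b) =
      (c\<^sup>2 + s\<^sup>2) * (g a * h a + g b * h b)"
    by (simp add: power2_eq_square algebra_simps)
  moreover have "(\<Sum>j\<in>K. givens c s a b g j * givens c s a b h j) = (\<Sum>j\<in>K. g j * h j)"
    using K(2,3) by (intro sum.cong) (auto simp: givens_def)
  ultimately show ?thesis
    using K J(4) cs by (simp add: givens_def)
qed

lemma measurable_linear_map_PiM:
  fixes G :: "'i \<Rightarrow> 'j \<Rightarrow> real"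
  shows "(\<lambda>x. \<lambda>i\<in>I. \<Sum>j\<in>J. G i j * x j) \<in> borel_PiM J \<rightarrow>\<^sub>M borel_PiM I"
  by measurable

text \<open>Outer induction on the set of rows, inner induction on the number of nonzero entries of
  the new row \<open>k\<close> outside a pivot column \<open>a\<close>. Each rotation clears one
  such entry. In the end row \<open>k\<close> reads a single coordinate, which no other row
  involves, so that coordinate can be integrated out.\<close>

lemma nn_integral_PiM_orthonormal:
  fixes G :: "'i \<Rightarrow> 'j \<Rightarrow> real"
  assumes "finite I" "finite J"
    and "\<And>i i'. i \<in> I \<Longrightarrow> i' \<in> I \<Longrightarrow> (\<Sum>j\<in>J. G i j * G i' j) = (if i = i' then 1 else 0)"
    and "f \<in> borel_measurable (borel_PiM I)"
  shows "(\<integral>\<^sup>+x. f (\<lambda>i\<in>I. \<Sum>j\<in>J. G i j * x j) \<partial>normal_PiM J) =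
    (\<integral>\<^sup>+x. f x \<partial>normal_PiM I)"
  using assms
proof (induction I arbitrary: J G f)
  case empty
  have "(\<integral>\<^sup>+x. f (\<lambda>_. undefined) \<partial>normal_PiM J) = f (\<lambda>_. undefined)"
    by (simp add: prob_space.emeasure_space_1[OF prob_space_PiM_normal_measure])
  then show ?case
    by (simp add: PiM_empty nn_integral_count_space_finite)
next
  case (insert k I)
  note J = \<open>finite J\<close>
  have "\<exists>j0\<in>J. G k j0 \<noteq> 0"
  proof (rule ccontr)
    assume "\<not> (\<exists>j0\<in>J. G k j0 \<noteq> 0)"
    then have "(\<Sum>j\<in>J. G k j * G k j) = 0" by (intro sum.neutral) auto
    with insert.prems(2)[of k k] show False by simp
  qed
  then obtain a where a: "a \<in> J" "G k a \<noteq> 0" by blast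
  show ?case
    using insert.prems(2) a(2)
  proof (induction "card {j\<in>J - {a}. G k j \<noteq> 0}" arbitrary: G)
    case 0
    define K where "K = J - {a}"
    have K: "finite K" "a \<notin> K" "J = insert a K"
      using J a by (auto simp: K_def)
    have Gk: "G k j = 0" if "j \<in> K" for j
      using 0(1) that J by (auto simp: K_def)
    have "(\<Sum>j\<in>J. G k j * G k j) = G k a * G k a"
      using K Gk by simp
    with 0(2)[of k k] have sq: "G k a * G k a = 1" by simp
    then have e: "G k a = 1 \<or> G k a = -1"
      by (simp add: square_eq_1_iff)
    \<comment> \<open>Row \<open>k\<close> is now plus or minus the unit row at \<open>a\<close>, so
      orthogonality to it empties column \<open>a\<close> of every other row.\<close>
    have Ga: "G i a = 0" if "i \<in> I" for i
    proof -
      have "i \<noteq> k" using that insert by auto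
      then have "(\<Sum>j\<in>J. G k j * G i j) = 0" using 0(2)[of k i] that by simp
      moreover have "(\<Sum>j\<in>J. G k j * G i j) = G k a * G i a"
        using K Gk by simp
      ultimately show ?thesis using e by auto
    qed
    note [measurable] = insert.prems(3)
    have fN [measurable]: "f \<in> borel_measurable (normal_PiM (insert k I))"
      using insert.prems(3) by (simp add: measurable_PiM_normal_measure)
    \<comment> \<open>\<open>F\<close> is \<open>f\<close> with its coordinate \<open>k\<close>
      integrated out; the outer induction hypothesis is applied to \<open>F\<close> and the
      remaining columns \<open>K\<close>.\<close>
    define F where "F z = (\<integral>\<^sup>+y. f (z(k := y)) \<partial>normal_measure)" for z
    have FN: "F \<in> borel_measurable (normal_PiM I)"
      unfolding F_def by measurable
    then have F: "F \<in> borel_measurable (borel_PiM I)"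
      by (simp add: measurable_PiM_normal_measure)
    have ortho: "(\<Sum>j\<in>K. G i j * G i' j) = (if i = i' then 1 else 0)" if "i \<in> I" "i' \<in> I" for i i'
      using 0(2)[of i i'] that K Ga by simp
    have "(\<integral>\<^sup>+x. f (\<lambda>i\<in>insert k I. \<Sum>j\<in>J. G i j * x j) \<partial>normal_PiM J) =
      (\<integral>\<^sup>+x. \<integral>\<^sup>+y. f (\<lambda>i\<in>insert k I. \<Sum>j\<in>J. G i j * (x(a := y)) j) \<partial>normal_measure \<partial>normal_PiM K)"
      unfolding K(3)
      by (rule normal_product.product_nn_integral_insert[OF K(1,2)])
        (use measurable_compose[OF measurable_linear_map_PiM insert.prems(3)] in \<open>simp add: measurable_PiM_normal_measure\<close>)
    also have "\<dots> = (\<integral>\<^sup>+x. \<integral>\<^sup>+y. f ((\<lambda>i\<in>I. \<Sum>j\<in>K. G i j * x j)(k := G k a * y)) \<partial>normal_measure \<partial>normal_PiM K)"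
    proof -
      have "(\<lambda>i\<in>insert k I. \<Sum>j\<in>J. G i j * (x(a := y)) j) = (\<lambda>i\<in>I. \<Sum>j\<in>K. G i j * x j)(k := G k a * y)" for x y
      proof -
        have *: "(\<Sum>j\<in>K. G i j * (x(a := y)) j) = (\<Sum>j\<in>K. G i j * x j)" for i
          using K(2) by (intro sum.cong) auto
        show ?thesis
          using K Ga Gk insert.hyps
          by (auto simp: fun_eq_iff restrict_def *[unfolded fun_upd_apply])
      qed
      then show ?thesis by simp
    qed
    also have "\<dots> = (\<integral>\<^sup>+x. F (\<lambda>i\<in>I. \<Sum>j\<in>K. G i j * x j) \<partial>normal_PiM K)"
      unfolding F_def
    proof (rule nn_integral_cong)
      fix x
      have "(\<lambda>i\<in>I. \<Sum>j\<in>K. G i j * x j) \<in> space (normal_PiM I)"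
        by (simp add: space_PiM)
      from measurable_compose[OF measurable_component_update[OF this] fN]
      have "(\<lambda>y. f ((\<lambda>i\<in>I. \<Sum>j\<in>K. G i j * x j)(k := y))) \<in> borel_measurable borel"
        using insert.hyps by simp
      from nn_integral_normal_measure_reflect[OF this e]
      show "(\<integral>\<^sup>+y. f ((\<lambda>i\<in>I. \<Sum>j\<in>K. G i j * x j)(k := G k a * y)) \<partial>normal_measure) =
        (\<integral>\<^sup>+y. f ((\<lambda>i\<in>I. \<Sum>j\<in>K. G i j * x j)(k := y)) \<partial>normal_measure)" .
    qed
    also have "\<dots> = (\<integral>\<^sup>+x. F x \<partial>normal_PiM I)"
      by (rule insert.IH[OF K(1) ortho F])
    also have "\<dots> = (\<integral>\<^sup>+x. f x \<partial>normal_PiM (insert k I))"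
      unfolding F_def
      by (rule normal_product.product_nn_integral_insert[symmetric]) (use insert.hyps fN in auto)
    finally show ?case .
  next
    case (Suc n)
    from Suc.hyps(2) have "{j\<in>J - {a}. G k j \<noteq> 0} \<noteq> {}" by (metis card.empty nat.distinct(1))
    then obtain b where b: "b \<in> J" "b \<noteq> a" "G k b \<noteq> 0" by blast
    \<comment> \<open>The rotation turns the entries at \<open>a\<close> and \<open>b\<close> into
      \<open>r\<close> and 0. The pivot \<open>G k a\<close> is nonzero, hence so are
      \<open>r\<close> and \<open>c\<close>: nonzero \<open>c\<close> is what the planar lemma
      demands, and \<open>r\<close> is the new pivot.\<close>
    define r where "r = sqrt ((G k a)\<^sup>2 + (G k b)\<^sup>2)"
    have r2: "r\<^sup>2 = (G k a)\<^sup>2 + (G k b)\<^sup>2" by (simp add: r_def)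
    have r0: "r \<noteq> 0" using Suc.prems(2) by (auto simp: r_def add_nonneg_eq_0_iff)
    define c s where "c = G k a / r" and "s = - G k b / r"
    have cs: "c\<^sup>2 + s\<^sup>2 = 1" "c \<noteq> 0"
      using r0 Suc.prems(2) by (simp_all add: c_def s_def power_divide add_divide_distrib[symmetric] r2[symmetric])
    define G' where "G' i = givens c s a b (G i)" for i
    have Gb: "G' k b = 0" using r0 by (simp add: G'_def givens_def c_def s_def)
    have Ga: "G' k a = r" using r0 b by (simp add: G'_def givens_def c_def s_def field_simps r2[unfolded power2_eq_square] power2_eq_square)
    have Go: "G' k j = G k j" if "j \<noteq> a" "j \<noteq> b" for j
      using that by (simp add: G'_def givens_def)
    have "{j\<in>J - {a}. G' k j \<noteq> 0} = {j\<in>J - {a}. G k j \<noteq> 0} - {b}"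
    proof (intro equalityI subsetI)
      fix j assume "j \<in> {j\<in>J - {a}. G' k j \<noteq> 0}"
      with Gb Go[of j] show "j \<in> {j\<in>J - {a}. G k j \<noteq> 0} - {b}" by (cases "j = b") auto
    next
      fix j assume "j \<in> {j\<in>J - {a}. G k j \<noteq> 0} - {b}"
      with Go[of j] show "j \<in> {j\<in>J - {a}. G' k j \<noteq> 0}" by auto
    qed
    then have card: "n = card {j\<in>J - {a}. G' k j \<noteq> 0}"
      using Suc.hyps(2) b J by simp
    have sums: "(\<Sum>j\<in>J. givens c s a b g j * givens c s a b h j) = (\<Sum>j\<in>J. g j * h j)" for g h
      by (rule sum_givens_mult[OF J a(1) b(1) b(2)[symmetric] cs(1)])
    have "(\<integral>\<^sup>+x. f (\<lambda>i\<in>insert k I. \<Sum>j\<in>J. G i j * x j) \<partial>normal_PiM J) =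
       (\<integral>\<^sup>+x. f (\<lambda>i\<in>insert k I. \<Sum>j\<in>J. G' i j * givens c s a b x j) \<partial>normal_PiM J)"
      by (simp add: G'_def sums)
    also have "\<dots> = (\<integral>\<^sup>+x. f (\<lambda>i\<in>insert k I. \<Sum>j\<in>J. G' i j * x j) \<partial>normal_PiM J)"
      by (rule nn_integral_PiM_givens[OF J a(1) b(1) b(2)[symmetric] cs, where f="\<lambda>x. f (\<lambda>i\<in>insert k I. \<Sum>j\<in>J. G' i j * x j)"])
        (rule measurable_compose[OF measurable_linear_map_PiM insert.prems(3)])
    also have "\<dots> = (\<integral>\<^sup>+x. f x \<partial>normal_PiM (insert k I))"
      by (rule Suc.hyps(1)) (use card Ga r0 Suc.prems(1) in \<open>auto simp: G'_def sums\<close>)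
    finally show ?case .
  qed
qed

text \<open>The invariance of standard normal vectors and matrices under multiplication from the
  left and from the right will be two special choices of \<open>G\<close>.\<close>

lemma distr_PiM_orthonormal:
  fixes G :: "'i \<Rightarrow> 'j \<Rightarrow> real"
  assumes "finite I" "finite J"
    and "\<And>i i'. i \<in> I \<Longrightarrow> i' \<in> I \<Longrightarrow> (\<Sum>j\<in>J. G i j * G i' j) = (if i = i' then 1 else 0)"
  shows "distr (normal_PiM J) (borel_PiM I) (\<lambda>x. \<lambda>i\<in>I. \<Sum>j\<in>J. G i j * x j) =
    normal_PiM I"
proof (rule measure_eqI)
  let ?T = "\<lambda>x. \<lambda>i\<in>I. \<Sum>j\<in>J. G i j * x j"
  have T: "?T \<in> normal_PiM J \<rightarrow>\<^sub>M borel_PiM I"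
    using measurable_linear_map_PiM by (simp add: measurable_PiM_normal_measure)
  fix A assume "A \<in> sets (distr (normal_PiM J) (borel_PiM I) ?T)"
  then have A: "A \<in> sets (borel_PiM I)" by simp
  have "emeasure (distr (normal_PiM J) (borel_PiM I) ?T) A =
     (\<integral>\<^sup>+x. indicator A x \<partial>distr (normal_PiM J) (borel_PiM I) ?T)"
    using A by simp
  also have "\<dots> = (\<integral>\<^sup>+x. indicator A (?T x) \<partial>normal_PiM J)"
    using A by (intro nn_integral_distr T) simp
  also have "\<dots> = (\<integral>\<^sup>+x. indicator A x \<partial>normal_PiM I)"
    by (rule nn_integral_PiM_orthonormal) (use assms A in auto)
  also have "\<dots> = emeasure (normal_PiM I) A"
    using A by (simp add: sets_PiM_normal_measure)
  finally show "emeasure (distr (normal_PiM J) (borel_PiM I) ?T) A =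
    emeasure (normal_PiM I) A" .
qed (simp add: sets_PiM_normal_measure)

section \<open>Joint normal law versus independent normal blocks\<close>

lemma normal_joint_imp_blocks:
  fixes X :: "'k \<Rightarrow> 'c \<Rightarrow> 'w \<Rightarrow> real"
  assumes P: "prob_space P"
    and meas: "\<And>k c. k \<in> K \<Longrightarrow> c \<in> I \<Longrightarrow> X k c \<in> borel_measurable P"
    and joint: "distr P (borel_PiM (K \<times> I)) (\<lambda>\<omega>. \<lambda>a\<in>K \<times> I. X (fst a) (snd a) \<omega>) =
      normal_PiM (K \<times> I)"
  shows "prob_space.indep_vars P (\<lambda>_. borel_PiM K) (\<lambda>c \<omega>. \<lambda>k\<in>K. X k c \<omega>) I"
    and "\<And>c. c \<in> I \<Longrightarrow> distr P (borel_PiM K) (\<lambda>\<omega>. \<lambda>k\<in>K. X k c \<omega>) = normal_PiM K"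
proof -
  interpret prob_space P by fact
  let ?Y = "\<lambda>a. X (fst a) (snd a)"
  let ?T = "\<lambda>\<omega>. \<lambda>a\<in>K \<times> I. ?Y a \<omega>"
  have T: "?T \<in> P \<rightarrow>\<^sub>M borel_PiM (K \<times> I)"
    using meas by (intro measurable_restrict) auto
  have reindex: "distr P (borel_PiM L) (\<lambda>\<omega>. \<lambda>l\<in>L. ?Y (g l) \<omega>) = normal_PiM L"
    if g: "inj_on g L" "g \<in> L \<rightarrow> K \<times> I" for g :: "'l \<Rightarrow> 'k \<times> 'c" and L
  proof -
    have m: "(\<lambda>x. \<lambda>l\<in>L. x (g l)) \<in> borel_PiM (K \<times> I) \<rightarrow>\<^sub>M borel_PiM L"
      using g(2) by (intro measurable_restrict measurable_component_singleton) auto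
    have "distr P (borel_PiM L) (\<lambda>\<omega>. \<lambda>l\<in>L. ?Y (g l) \<omega>) =
      distr P (borel_PiM L) ((\<lambda>x. \<lambda>l\<in>L. x (g l)) \<circ> ?T)"
      using g(2) by (intro distr_cong) (auto simp: fun_eq_iff restrict_def)
    also have "\<dots> = distr (distr P (borel_PiM (K \<times> I)) ?T) (borel_PiM L) (\<lambda>x. \<lambda>l\<in>L. x (g l))"
      by (rule distr_distr[OF m T, symmetric])
    also have "\<dots> = distr (normal_PiM (K \<times> I)) (normal_PiM L) (\<lambda>x. \<lambda>l\<in>L. x (g l))"
      unfolding joint by (intro distr_cong) (simp_all add: sets_PiM_normal_measure)
    also have "\<dots> = normal_PiM L"
      by (rule distr_PiM_reindex[OF prob_space_normal_measure g])
    finally show ?thesis .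
  qed
  show "distr P (borel_PiM K) (\<lambda>\<omega>. \<lambda>k\<in>K. X k c \<omega>) = normal_PiM K" if "c \<in> I" for c
    using reindex[of "\<lambda>k. (k, c)" K] that by (auto simp: inj_on_def)
  \<comment> \<open>Every coordinate has law \<open>normal_measure\<close>, so the joint law is the
    product of its marginals, which characterises independence over a nonempty index set. Grouping
    the coordinates by \<open>c\<close> then yields independent blocks.\<close>
  have indep: "indep_vars (\<lambda>_. borel) ?Y (K \<times> I)"
  proof (cases "K \<times> I = {}")
    case True
    then show ?thesis unfolding indep_vars_def indep_sets_def by auto
  next
    case False
    have "distr P borel (?Y a) = normal_measure" if a: "a \<in> K \<times> I" for a
    proof -
      have "distr P borel (?Y a) = distr P borel ((\<lambda>x. x a) \<circ> ?T)"
        using a by (intro distr_cong) auto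
      also have "\<dots> = distr (distr P (borel_PiM (K \<times> I)) ?T) borel (\<lambda>x. x a)"
        by (rule distr_distr[symmetric]) (use T a in auto)
      also have "\<dots> = distr (normal_PiM (K \<times> I)) normal_measure (\<lambda>x. x a)"
        unfolding joint by (intro distr_cong) simp_all
      also have "\<dots> = normal_measure"
        by (rule distr_PiM_component[OF prob_space_normal_measure a])
      finally show ?thesis .
    qed
    then have "PiM (K \<times> I) (\<lambda>a. distr P borel (?Y a)) = normal_PiM (K \<times> I)"
      by (intro PiM_cong) auto
    then show ?thesis
      using joint meas by (subst indep_vars_iff_distr_eq_PiM'[OF False]) auto
  qed
  have "indep_vars (\<lambda>c. borel_PiM (K \<times> {c})) (\<lambda>c \<omega>. restrict (\<lambda>a. ?Y a \<omega>) (K \<times> {c})) I"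
    by (rule indep_vars_restrict[OF indep]) (auto simp: disjoint_family_on_def)
  then have "indep_vars (\<lambda>_. borel_PiM K)
      (\<lambda>c \<omega>. (\<lambda>c x. \<lambda>k\<in>K. x (k, c)) c (restrict (\<lambda>a. ?Y a \<omega>) (K \<times> {c}))) I"
    by (rule indep_vars_compose2) (intro measurable_restrict measurable_component_singleton, auto)
  also have "?this \<longleftrightarrow> indep_vars (\<lambda>_. borel_PiM K) (\<lambda>c \<omega>. \<lambda>k\<in>K. X k c \<omega>) I"
    by (intro indep_vars_cong refl) (auto simp: fun_eq_iff restrict_def)
  finally show "indep_vars (\<lambda>_. borel_PiM K) (\<lambda>c \<omega>. \<lambda>k\<in>K. X k c \<omega>) I" .
qed

text \<open>Over a finite index set the product measure is determined by boxes. Independence splits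
  the probability of a box over the blocks \<open>c\<close>, and the law of each block splits it
  further over \<open>k\<close>.\<close>

lemma normal_blocks_imp_joint:
  fixes X :: "'k \<Rightarrow> 'c \<Rightarrow> 'w \<Rightarrow> real"
  assumes P: "prob_space P" and fin: "finite K" "finite I"
    and indep: "prob_space.indep_vars P (\<lambda>_. borel_PiM K) (\<lambda>c \<omega>. \<lambda>k\<in>K. X k c \<omega>) I"
    and law: "\<And>c. c \<in> I \<Longrightarrow> distr P (borel_PiM K) (\<lambda>\<omega>. \<lambda>k\<in>K. X k c \<omega>) = normal_PiM K"
  shows "distr P (borel_PiM (K \<times> I)) (\<lambda>\<omega>. \<lambda>a\<in>K \<times> I. X (fst a) (snd a) \<omega>) =
      normal_PiM (K \<times> I)"
proof (rule normal_product.PiM_eqI)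
  interpret prob_space P by fact
  let ?T = "\<lambda>\<omega>. \<lambda>a\<in>K \<times> I. X (fst a) (snd a) \<omega>"
  have meas_block: "(\<lambda>\<omega>. \<lambda>k\<in>K. X k c \<omega>) \<in> P \<rightarrow>\<^sub>M borel_PiM K" if "c \<in> I" for c
    using indep that by (auto simp: indep_vars_def)
  have meas: "X k c \<in> borel_measurable P" if "k \<in> K" "c \<in> I" for k c
    using measurable_compose[OF meas_block[OF that(2)] measurable_component_singleton[OF that(1)]] that by simp
  have T: "?T \<in> P \<rightarrow>\<^sub>M borel_PiM (K \<times> I)"
    using meas by (intro measurable_restrict) auto
  show "finite (K \<times> I)" using fin by simp
  show "sets (distr P (borel_PiM (K \<times> I)) ?T) = sets (normal_PiM (K \<times> I))"
    by (simp add: sets_PiM_normal_measure)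
  fix A assume A: "\<And>a. a \<in> K \<times> I \<Longrightarrow> A a \<in> sets normal_measure"
  let ?B = "\<lambda>c. PiE K (\<lambda>k. A (k, c))"
  have B: "?B c \<in> sets (borel_PiM K)" if "c \<in> I" for c
    using fin A that by (intro sets_PiM_I_finite) auto
  have block: "prob ((\<lambda>\<omega>. \<lambda>k\<in>K. X k c \<omega>) -` ?B c \<inter> space P) = (\<Prod>k\<in>K. measure normal_measure (A (k, c)))"
    if c: "c \<in> I" for c
  proof -
    have "emeasure P ((\<lambda>\<omega>. \<lambda>k\<in>K. X k c \<omega>) -` ?B c \<inter> space P) = emeasure (normal_PiM K) (?B c)"
      unfolding law[OF c, symmetric] by (rule emeasure_distr[symmetric, OF meas_block[OF c] B[OF c]])
    also have "\<dots> = (\<Prod>k\<in>K. emeasure normal_measure (A (k, c)))"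
      by (rule normal_product.emeasure_PiM) (use fin A c in auto)
    finally show ?thesis
      by (simp add: emeasure_eq_measure normal_measure.emeasure_eq_measure prod_ennreal prod_nonneg)
  qed
  have "emeasure (distr P (borel_PiM (K \<times> I)) ?T) (PiE (K \<times> I) A) = emeasure P (?T -` PiE (K \<times> I) A \<inter> space P)"
    using T A fin by (intro emeasure_distr sets_PiM_I_finite) auto
  also have "\<dots> = ennreal (\<Prod>c\<in>I. \<Prod>k\<in>K. measure normal_measure (A (k, c)))"
  proof (cases "I = {}")
    \<comment> \<open>The product formula for independent variables wants a nonempty family. Here
      the only function on the empty index set lies in the box, so both sides are 1.\<close>
    case True
    then show ?thesis by (simp add: restrict_def PiE_def emeasure_space_1 vimage_def)
  next
    case False
    have "?T -` PiE (K \<times> I) A \<inter> space P = (\<Inter>c\<in>I. (\<lambda>\<omega>. \<lambda>k\<in>K. X k c \<omega>) -` ?B c \<inter> space P)"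
      using False by (auto simp: PiE_def Pi_def)
    also have "prob \<dots> = (\<Prod>c\<in>I. prob ((\<lambda>\<omega>. \<lambda>k\<in>K. X k c \<omega>) -` ?B c \<inter> space P))"
      by (rule indep_varsD_finite[OF indep False fin(2) B])
    also have "\<dots> = (\<Prod>c\<in>I. \<Prod>k\<in>K. measure normal_measure (A (k, c)))"
      by (intro prod.cong refl block)
    finally show ?thesis
      unfolding emeasure_eq_measure by (rule arg_cong)
  qed
  also have "(\<Prod>c\<in>I. \<Prod>k\<in>K. measure normal_measure (A (k, c))) = (\<Prod>k\<in>K. \<Prod>c\<in>I. measure normal_measure (A (k, c)))"
    by (rule prod.swap)
  also have "\<dots> = (\<Prod>a\<in>K \<times> I. measure normal_measure (A a))"
    by (simp add: prod.cartesian_product)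
  also have "ennreal \<dots> = (\<Prod>a\<in>K \<times> I. emeasure normal_measure (A a))"
    by (simp add: normal_measure.emeasure_eq_measure prod_ennreal)
  finally show "emeasure (distr P (borel_PiM (K \<times> I)) ?T) (PiE (K \<times> I) A) =
     (\<Prod>a\<in>K \<times> I. emeasure normal_measure (A a))" .
qed

section \<open>Borel structures\<close>

lemma qnormsq_mult: "qnormsq (x * y) = qnormsq x * qnormsq y"
  by (simp add: qnormsq_def power2_eq_square algebra_simps)

lemma norm_quat_eq: "norm x = sqrt (qnormsq x)"
  by (simp add: norm_quat_def inner_quat_def qnormsq_def power2_eq_square)

text \<open>The multiplicative norm makes quaternion multiplication continuous, and so makes
  products of Borel functions Borel.\<close>

instance quat :: real_normed_div_algebra
  by standard (simp add: norm_quat_eq qnormsq_mult real_sqrt_mult)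

lemma qcoord_simps [simp]:
  "qcoord 0 x = qre x" "qcoord 1 x = qi x" "qcoord (Suc 0) x = qi x" "qcoord 2 x = qj x" "qcoord 3 x = qk x"
  by (simp_all add: qcoord_def numeral_2_eq_2 numeral_3_eq_3)

lemma lessThan_4: "{..<4::nat} = {0, 1, 2, 3}"
  by auto

lemma less_4_cases: "c < 4 \<longleftrightarrow> c = 0 \<or> c = 1 \<or> c = 2 \<or> c = (3::nat)"
  by auto

lemma quat_eqI_qcoord: "(\<And>c. c < 4 \<Longrightarrow> qcoord c x = qcoord c y) \<Longrightarrow> x = y"
  using qcoord_simps by (metis less_4_cases quat_eq_iff)

definition quat_of_coords :: "(nat \<Rightarrow> real) \<Rightarrow> quat"
  where "quat_of_coords f = Quat (f 0) (f 1) (f 2) (f 3)"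

lemma qcoord_quat_of_coords [simp]: "c < 4 \<Longrightarrow> qcoord c (quat_of_coords f) = f c"
  by (auto simp: less_4_cases quat_of_coords_def)

lemma qcoord_eq_inner:
  "c < 4 \<Longrightarrow> qcoord c x = inner x (quat_of_coords (\<lambda>d. if d = c then 1 else 0))"
  by (auto simp: less_4_cases quat_of_coords_def inner_quat_def)

lemma measurable_qcoord [measurable (raw)]:
  "f \<in> borel_measurable M \<Longrightarrow> c < 4 \<Longrightarrow> (\<lambda>x. qcoord c (f x)) \<in> borel_measurable M"
  by (simp add: qcoord_eq_inner)

lemma quat_of_coords_eq_sum:
  "quat_of_coords f = (\<Sum>c<4. f c *\<^sub>R quat_of_coords (\<lambda>d. if d = c then 1 else 0))"
  by (simp add: lessThan_4 quat_eq_iff quat_of_coords_def)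

lemma measurable_quat_of_coords [measurable (raw)]:
  "(\<And>c. c < 4 \<Longrightarrow> (\<lambda>x. f x c) \<in> borel_measurable M) \<Longrightarrow> (\<lambda>x. quat_of_coords (f x)) \<in> borel_measurable M"
  by (subst quat_of_coords_eq_sum) (intro borel_measurable_sum borel_measurable_scaleR, auto)

lemma measurable_qcnj [measurable (raw)]:
  assumes [measurable]: "f \<in> borel_measurable M"
  shows "(\<lambda>x. qcnj (f x)) \<in> borel_measurable M"
proof -
  have "qcnj y = quat_of_coords (\<lambda>c. (if c = 0 then 1 else -1) * qcoord c y)" for y
    by (simp add: quat_of_coords_def quat_eq_iff)
  then show ?thesis by simp
qed

lemma space_mat_borel [simp]: "space (mat_borel m n) = carrier_mat m n"
  by (simp add: mat_borel_def)

lemma space_vec_borel [simp]: "space (vec_borel m) = carrier_vec m"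
  by (simp add: vec_borel_def)

section \<open>Measurability of matrix operations\<close>

lemma measurable_mat_borelI:
  assumes "\<And>x. x \<in> space M \<Longrightarrow> A x \<in> carrier_mat m n"
    and "\<And>i j. i < m \<Longrightarrow> j < n \<Longrightarrow> (\<lambda>x. A x $$ (i, j)) \<in> borel_measurable M"
  shows "A \<in> M \<rightarrow>\<^sub>M mat_borel m n"
  unfolding mat_borel_def
  by (rule measurable_vimage_algebra2) (use assms in \<open>auto intro!: measurable_restrict simp: space_PiM\<close>)

lemma measurable_vec_borelI:
  assumes "\<And>x. x \<in> space M \<Longrightarrow> A x \<in> carrier_vec m"
    and "\<And>i. i < m \<Longrightarrow> (\<lambda>x. A x $ i) \<in> borel_measurable M"
  shows "A \<in> M \<rightarrow>\<^sub>M vec_borel m"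
  unfolding vec_borel_def
  by (rule measurable_vimage_algebra2) (use assms in \<open>auto intro!: measurable_restrict simp: space_PiM\<close>)

lemma measurable_mat_entry:
  assumes "A \<in> M \<rightarrow>\<^sub>M mat_borel m n" "i < m" "j < n"
  shows "(\<lambda>x. A x $$ (i, j)) \<in> borel_measurable M"
proof -
  have "(\<lambda>A. \<lambda>ij\<in>{..<m} \<times> {..<n}. A $$ ij) \<in> mat_borel m n \<rightarrow>\<^sub>M (\<Pi>\<^sub>M ij\<in>{..<m} \<times> {..<n}. borel)"
    unfolding mat_borel_def by (rule measurable_vimage_algebra1) (auto simp: space_PiM)
  from measurable_compose[OF assms(1) measurable_compose[OF this measurable_component_singleton[of "(i, j)"]]]
  show ?thesis using assms by simp
qed

lemma measurable_vec_entry: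
  assumes "A \<in> M \<rightarrow>\<^sub>M vec_borel m" "i < m"
  shows "(\<lambda>x. A x $ i) \<in> borel_measurable M"
proof -
  have "(\<lambda>v. \<lambda>i\<in>{..<m}. v $ i) \<in> vec_borel m \<rightarrow>\<^sub>M (\<Pi>\<^sub>M i\<in>{..<m}. borel)"
    unfolding vec_borel_def by (rule measurable_vimage_algebra1) (auto simp: space_PiM)
  from measurable_compose[OF assms(1) measurable_compose[OF this measurable_component_singleton[of i]]]
  show ?thesis using assms by simp
qed

lemma measurable_mat_carrier: "A \<in> M \<rightarrow>\<^sub>M mat_borel m n \<Longrightarrow> x \<in> space M \<Longrightarrow> A x \<in> carrier_mat m n"
  by (drule measurable_space) auto

lemma measurable_vec_carrier: "A \<in> M \<rightarrow>\<^sub>M vec_borel m \<Longrightarrow> x \<in> space M \<Longrightarrow> A x \<in> carrier_vec m"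
  by (drule measurable_space) auto

lemma measurable_mat_dim:
  assumes "A \<in> M \<rightarrow>\<^sub>M mat_borel m n" "x \<in> space M"
  shows "dim_row (A x) = m" "dim_col (A x) = n"
  using measurable_mat_carrier[OF assms] by auto

lemma measurable_vec_dim:
  assumes "A \<in> M \<rightarrow>\<^sub>M vec_borel m" "x \<in> space M"
  shows "dim_vec (A x) = m"
  using measurable_vec_carrier[OF assms] by auto

lemma measurable_mat_const: "B \<in> carrier_mat m n \<Longrightarrow> (\<lambda>_. B) \<in> M \<rightarrow>\<^sub>M mat_borel m n"
  by (rule measurable_mat_borelI) auto

lemma measurable_mat_mult:
  fixes A B :: "'w \<Rightarrow> quat mat"
  assumes A: "A \<in> M \<rightarrow>\<^sub>M mat_borel m n" and B: "B \<in> M \<rightarrow>\<^sub>M mat_borel n p"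
  shows "(\<lambda>x. A x * B x) \<in> M \<rightarrow>\<^sub>M mat_borel m p"
proof (rule measurable_mat_borelI)
  note [measurable] = measurable_mat_entry[OF A] measurable_mat_entry[OF B]
  fix i j assume ij: "i < m" "j < p"
  have "(\<lambda>x. \<Sum>l<n. A x $$ (i, l) * B x $$ (l, j)) \<in> borel_measurable M"
    using ij by measurable
  also have "?this \<longleftrightarrow> (\<lambda>x. (A x * B x) $$ (i, j)) \<in> borel_measurable M"
    using ij by (intro measurable_cong)
      (simp add: scalar_prod_def lessThan_atLeast0 measurable_mat_dim[OF A] measurable_mat_dim[OF B])
  finally show "(\<lambda>x. (A x * B x) $$ (i, j)) \<in> borel_measurable M" .
qed (intro carrier_matI, simp_all add: measurable_mat_dim[OF A] measurable_mat_dim[OF B])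

lemma measurable_mat_diff:
  fixes A B :: "'w \<Rightarrow> quat mat"
  assumes A: "A \<in> M \<rightarrow>\<^sub>M mat_borel m n" and B: "B \<in> M \<rightarrow>\<^sub>M mat_borel m n"
  shows "(\<lambda>x. A x - B x) \<in> M \<rightarrow>\<^sub>M mat_borel m n"
proof (rule measurable_mat_borelI)
  note [measurable] = measurable_mat_entry[OF A] measurable_mat_entry[OF B]
  fix i j assume ij: "i < m" "j < n"
  have "(\<lambda>x. A x $$ (i, j) - B x $$ (i, j)) \<in> borel_measurable M"
    using ij by measurable
  also have "?this \<longleftrightarrow> (\<lambda>x. (A x - B x) $$ (i, j)) \<in> borel_measurable M"
    using ij by (intro measurable_cong) (simp add: measurable_mat_dim[OF A] measurable_mat_dim[OF B])
  finally show "(\<lambda>x. (A x - B x) $$ (i, j)) \<in> borel_measurable M" .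
qed (intro carrier_matI, simp_all add: measurable_mat_dim[OF A] measurable_mat_dim[OF B])

lemma ctranspose_carrier [simp]: "A \<in> carrier_mat m n \<Longrightarrow> ctranspose A \<in> carrier_mat n m"
  by (simp add: ctranspose_def)

lemma measurable_ctranspose:
  assumes A: "A \<in> M \<rightarrow>\<^sub>M mat_borel m n"
  shows "(\<lambda>x. ctranspose (A x)) \<in> M \<rightarrow>\<^sub>M mat_borel n m"
proof (rule measurable_mat_borelI)
  note [measurable] = measurable_mat_entry[OF A]
  fix i j assume ij: "i < n" "j < m"
  have "(\<lambda>x. qcnj (A x $$ (j, i))) \<in> borel_measurable M"
    using ij by measurable
  also have "?this \<longleftrightarrow> (\<lambda>x. ctranspose (A x) $$ (i, j)) \<in> borel_measurable M"
    using ij by (intro measurable_cong) (simp add: ctranspose_def measurable_mat_dim[OF A])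
  finally show "(\<lambda>x. ctranspose (A x) $$ (i, j)) \<in> borel_measurable M" .
qed (use measurable_mat_carrier[OF A] in auto)

lemma measurable_mat_col:
  assumes A: "A \<in> M \<rightarrow>\<^sub>M mat_borel m n" and j: "j < n"
  shows "(\<lambda>x. col (A x) j) \<in> M \<rightarrow>\<^sub>M vec_borel m"
proof (rule measurable_vec_borelI)
  fix i assume i: "i < m"
  have "(\<lambda>x. A x $$ (i, j)) \<in> borel_measurable M"
    by (rule measurable_mat_entry[OF A i j])
  also have "?this \<longleftrightarrow> (\<lambda>x. col (A x) j $ i) \<in> borel_measurable M"
    using i j by (intro measurable_cong) (simp add: measurable_mat_dim[OF A])
  finally show "(\<lambda>x. col (A x) j $ i) \<in> borel_measurable M" .
qed (intro carrier_vecI, simp add: measurable_mat_dim[OF A])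

lemma measurable_mult_mat_vec:
  fixes B :: "quat mat"
  assumes B: "B \<in> carrier_mat k m" and v: "v \<in> M \<rightarrow>\<^sub>M vec_borel m"
  shows "(\<lambda>x. B *\<^sub>v v x) \<in> M \<rightarrow>\<^sub>M vec_borel k"
proof (rule measurable_vec_borelI)
  note [measurable] = measurable_vec_entry[OF v]
  fix i assume i: "i < k"
  have "(\<lambda>x. \<Sum>l<m. B $$ (i, l) * v x $ l) \<in> borel_measurable M"
    by measurable
  also have "?this \<longleftrightarrow> (\<lambda>x. (B *\<^sub>v v x) $ i) \<in> borel_measurable M"
    using i B by (intro measurable_cong) (simp add: scalar_prod_def lessThan_atLeast0 measurable_vec_dim[OF v])
  finally show "(\<lambda>x. (B *\<^sub>v v x) $ i) \<in> borel_measurable M" .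
qed (intro carrier_vecI, use B in simp)

section \<open>Standard quaternion normal vectors and matrices in real coordinates\<close>

definition vec_coords :: "nat \<Rightarrow> quat Matrix.vec \<Rightarrow> nat \<times> nat \<Rightarrow> real"
  where "vec_coords m v = (\<lambda>a\<in>{..<m} \<times> {..<4}. qcoord (snd a) (v $ fst a))"

text \<open>Nested as row and quaternion coordinate first, column last, so that the column number
  stands alone in the second component: the lemmas on joint laws and blocks then apply with columns
  as blocks.\<close>

abbreviation mat_index :: "nat \<Rightarrow> nat \<Rightarrow> ((nat \<times> nat) \<times> nat) set"
  where "mat_index m n \<equiv> ({..<m} \<times> {..<4}) \<times> {..<n}"

definition mat_coords :: "nat \<Rightarrow> nat \<Rightarrow> quat mat \<Rightarrow> (nat \<times> nat) \<times> nat \<Rightarrow> real"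
  where "mat_coords m n A = (\<lambda>a\<in>mat_index m n. qcoord (snd (fst a)) (A $$ (fst (fst a), snd a)))"

text \<open>One joint law of all real coordinates instead of independent columns: the form on which
  Fubini and multiplication from the right can act.\<close>

definition std_quat_normal_mat :: "'w measure \<Rightarrow> nat \<Rightarrow> nat \<Rightarrow> ('w \<Rightarrow> quat mat) \<Rightarrow> bool"
  where "std_quat_normal_mat P m n W \<longleftrightarrow> prob_space P \<and> W \<in> P \<rightarrow>\<^sub>M mat_borel m n \<and>
    distr P (borel_PiM (mat_index m n)) (\<lambda>\<omega>. mat_coords m n (W \<omega>)) =
    normal_PiM (mat_index m n)"

lemma measurable_vec_coords: "vec_coords m \<in> vec_borel m \<rightarrow>\<^sub>M borel_PiM ({..<m} \<times> {..<4})"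
proof -
  have "(\<lambda>v. qcoord c (v $ i)) \<in> borel_measurable (vec_borel m)" if "i < m" "c < 4" for i c
    by (rule measurable_qcoord[OF measurable_vec_entry[OF measurable_ident_sets[OF refl] that(1)] that(2)])
  then show ?thesis
    unfolding vec_coords_def by (intro measurable_restrict) auto
qed

lemma measurable_mat_coords:
  "mat_coords m n \<in> mat_borel m n \<rightarrow>\<^sub>M borel_PiM (mat_index m n)"
proof -
  have "(\<lambda>A. qcoord c (A $$ (i, j))) \<in> borel_measurable (mat_borel m n)" if "i < m" "j < n" "c < 4" for i j c
    by (rule measurable_qcoord[OF measurable_mat_entry[OF measurable_ident_sets[OF refl] that(1,2)] that(3)])
  then show ?thesis
    unfolding mat_coords_def by (intro measurable_restrict) auto
qed

text \<open>The definition asks for four independent component vectors, which is the block form with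
  the coordinate number \<open>c\<close> as block index. The joint form is the one to which real
  linear maps apply.\<close>

lemma std_quat_normal_iff:
  assumes "prob_space P"
  shows "std_quat_normal P m z \<longleftrightarrow> z \<in> P \<rightarrow>\<^sub>M vec_borel m \<and>
    distr P (borel_PiM ({..<m} \<times> {..<4})) (\<lambda>\<omega>. vec_coords m (z \<omega>)) =
    normal_PiM ({..<m} \<times> {..<4})"
proof -
  let ?X = "\<lambda>i c \<omega>. qcoord c (z \<omega> $ i)"
  have X: "?X i c \<in> borel_measurable P" if "z \<in> P \<rightarrow>\<^sub>M vec_borel m" "i \<in> {..<m}" "c \<in> {..<4}" for i c
    using that by (intro measurable_qcoord measurable_vec_entry[OF that(1)]) auto
  show ?thesis (is "?l \<longleftrightarrow> ?r")
  proof
    assume ?l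
    then show ?r
      unfolding std_quat_normal_def std_normal_law_def vec_coords_def
      by (intro conjI normal_blocks_imp_joint[of P "{..<m}" "{..<4}" ?X, OF assms]) simp_all
  next
    assume r: ?r
    then have "z \<in> P \<rightarrow>\<^sub>M vec_borel m" ..
    note blocks = normal_joint_imp_blocks[of P "{..<m}" "{..<4}" ?X, OF assms X[OF this] r[unfolded vec_coords_def, THEN conjunct2]]
    show ?l
      unfolding std_quat_normal_def std_normal_law_def
      using r assms blocks by simp
  qed
qed

definition vec_of_coords :: "nat \<Rightarrow> (nat \<times> nat \<Rightarrow> real) \<Rightarrow> quat Matrix.vec"
  where "vec_of_coords m x = Matrix.vec m (\<lambda>i. quat_of_coords (\<lambda>c. x (i, c)))"

lemma measurable_vec_of_coords: "vec_of_coords m \<in> borel_PiM ({..<m} \<times> {..<4}) \<rightarrow>\<^sub>M vec_borel m"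
proof (rule measurable_vec_borelI)
  fix i assume i: "i < m"
  show "(\<lambda>x. vec_of_coords m x $ i) \<in> borel_measurable (borel_PiM ({..<m} \<times> {..<4}))"
    using i by (auto simp: vec_of_coords_def intro!: measurable_quat_of_coords measurable_component_singleton)
qed (simp add: vec_of_coords_def)

lemma vec_of_coords_vec_coords: "v \<in> carrier_vec m \<Longrightarrow> vec_of_coords m (vec_coords m v) = v"
  by (rule eq_vecI) (auto simp: vec_of_coords_def vec_coords_def intro!: quat_eqI_qcoord)

lemma mat_coords_eq_vec_coords:
  assumes "A \<in> carrier_mat m n"
  shows "mat_coords m n A = (\<lambda>a\<in>mat_index m n. vec_coords m (col A (snd a)) (fst a))"
  using assms by (auto simp: mat_coords_def vec_coords_def fun_eq_iff restrict_def)

text \<open>Identities between random vectors and matrices hold only where the dimensions are right,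
  that is, on the sample space; this version of congruence asks for no more.\<close>

lemma (in prob_space) indep_vars_cong_space:
  assumes "indep_vars M' X I" "\<And>i \<omega>. i \<in> I \<Longrightarrow> \<omega> \<in> space M \<Longrightarrow> X i \<omega> = Y i \<omega>"
  shows "indep_vars M' Y I"
proof -
  have "X i -` A \<inter> space M = Y i -` A \<inter> space M" if "i \<in> I" for i A
    using assms(2)[OF that] by auto
  then have "indep_sets (\<lambda>i. {Y i -` A \<inter> space M | A. A \<in> sets (M' i)}) I"
    using assms(1) by (auto simp: indep_vars_def2 cong: indep_sets_cong)
  moreover have "Y i \<in> M \<rightarrow>\<^sub>M M' i" if "i \<in> I" for i
    using assms that measurable_cong[of M "X i" "Y i" "M' i"] by (auto simp: indep_vars_def2)
  ultimately show ?thesis by (auto simp: indep_vars_def2)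
qed

text \<open>The blocks are now the columns. Since \<open>vec_coords\<close> has the measurable left
  inverse \<open>vec_of_coords\<close>, columns are independent precisely when their coordinate
  vectors are.\<close>

lemma std_quat_normal_mat_iff:
  assumes "prob_space P" and W: "W \<in> P \<rightarrow>\<^sub>M mat_borel m n"
  shows "std_quat_normal_mat P m n W \<longleftrightarrow>
    prob_space.indep_vars P (\<lambda>_. vec_borel m) (\<lambda>j \<omega>. col (W \<omega>) j) {..<n} \<and>
    (\<forall>j<n. std_quat_normal P m (\<lambda>\<omega>. col (W \<omega>) j))"
proof -
  interpret prob_space P by fact
  let ?K = "{..<m} \<times> {..<4::nat}"
  let ?X = "\<lambda>a j \<omega>. vec_coords m (col (W \<omega>) j) a"
  have ext: "(\<lambda>a\<in>?K. vec_coords m v a) = vec_coords m v" for v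
    by (simp add: vec_coords_def fun_eq_iff)
  have X: "?X a j \<in> borel_measurable P" if "a \<in> ?K" "j \<in> {..<n}" for a j
  proof -
    have "(\<lambda>\<omega>. vec_coords m (col (W \<omega>) j)) \<in> P \<rightarrow>\<^sub>M borel_PiM ?K"
      using measurable_mat_col[OF W, of j] that by (intro measurable_compose[OF _ measurable_vec_coords]) auto
    then show ?thesis
      by (rule measurable_compose) (rule measurable_component_singleton[OF that(1)])
  qed
  have joint: "distr P (borel_PiM (?K \<times> {..<n})) (\<lambda>\<omega>. mat_coords m n (W \<omega>)) =
    distr P (borel_PiM (?K \<times> {..<n})) (\<lambda>\<omega>. \<lambda>a\<in>?K \<times> {..<n}. ?X (fst a) (snd a) \<omega>)"
    using measurable_mat_carrier[OF W] by (intro distr_cong) (auto simp: mat_coords_eq_vec_coords)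
  have indep: "indep_vars (\<lambda>_. vec_borel m) (\<lambda>j \<omega>. col (W \<omega>) j) {..<n} \<longleftrightarrow>
      indep_vars (\<lambda>_. borel_PiM ?K) (\<lambda>j \<omega>. vec_coords m (col (W \<omega>) j)) {..<n}" (is "?l \<longleftrightarrow> ?r")
  proof
    show "?l \<Longrightarrow> ?r"
      by (erule indep_vars_compose2) (rule measurable_vec_coords)
    assume ?r
    then have "indep_vars (\<lambda>_. vec_borel m) (\<lambda>j \<omega>. vec_of_coords m (vec_coords m (col (W \<omega>) j))) {..<n}"
      by (rule indep_vars_compose2) (rule measurable_vec_of_coords)
    moreover have "vec_of_coords m (vec_coords m (col (W \<omega>) j)) = col (W \<omega>) j" if "\<omega> \<in> space P" for \<omega> j
      using measurable_mat_carrier[OF W that] by (intro vec_of_coords_vec_coords) auto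
    ultimately show ?l
      using indep_vars_cong_space by fastforce
  qed
  have "std_quat_normal P m (\<lambda>\<omega>. col (W \<omega>) j) \<longleftrightarrow>
      distr P (borel_PiM ?K) (\<lambda>\<omega>. vec_coords m (col (W \<omega>) j)) = normal_PiM ?K" if "j < n" for j
    using measurable_mat_col[OF W that] by (simp add: std_quat_normal_iff[OF assms(1)])
  note cols = this
  show ?thesis (is "?l \<longleftrightarrow> ?r")
  proof
    assume ?l
    then have j: "distr P (borel_PiM (?K \<times> {..<n})) (\<lambda>\<omega>. \<lambda>a\<in>?K \<times> {..<n}. ?X (fst a) (snd a) \<omega>) =
        normal_PiM (?K \<times> {..<n})"
      unfolding std_quat_normal_mat_def joint by simp
    note blocks = normal_joint_imp_blocks[of P ?K "{..<n}" ?X, OF assms(1) X j, unfolded ext]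
    show ?r
      unfolding indep using cols blocks by simp
  next
    assume ?r
    then show ?l
      unfolding std_quat_normal_mat_def joint indep
      by (intro conjI assms normal_blocks_imp_joint[of P ?K "{..<n}" ?X, OF assms(1)]) (simp_all add: ext cols)
  qed
qed

section \<open>Linear algebra over the quaternions\<close>

lemma qcnj_simps [simp]:
  "qcnj 0 = 0" "qcnj 1 = 1" "qcnj (x + y) = qcnj x + qcnj y" "qcnj (x - y) = qcnj x - qcnj y"
  "qcnj (x * y) = qcnj y * qcnj x" "qcnj (qcnj x) = x"
  by (simp_all add: quat_eq_iff algebra_simps)

lemma of_real_quat: "of_real r = Quat r 0 0 0"
  by (simp add: of_real_def quat_eq_iff)

lemma qcnj_of_real [simp]: "qcnj (of_real r) = of_real r"
  by (simp add: of_real_quat quat_eq_iff)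

lemma qcnj_sum: "qcnj (sum f S) = (\<Sum>i\<in>S. qcnj (f i))"
  by (induction S rule: infinite_finite_induct) auto

lemma mult_qcnj: "x * qcnj x = of_real (qnormsq x)"
  by (simp add: of_real_quat quat_eq_iff qnormsq_def power2_eq_square)

lemma of_real_mult_commute: "of_real r * x = x * of_real r" for x :: "'a::real_algebra_1"
  by (simp add: of_real_def)

lemma numeral_mult_commute: "numeral w * x = x * numeral w" for x :: "'a::real_algebra_1"
  using of_real_mult_commute[of "numeral w" x] by simp

lemma qcoord_add: "qcoord c (x + y) = qcoord c x + qcoord c y" if "c < 4"
  using that by (auto simp: less_4_cases)

lemma qcoord_0: "qcoord c 0 = 0" if "c < 4"
  using that by (auto simp: less_4_cases)

lemma qcoord_sum: "qcoord c (sum f S) = (\<Sum>i\<in>S. qcoord c (f i))" if "c < 4"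
  by (induction S rule: infinite_finite_induct) (auto simp: qcoord_add[OF that] qcoord_0[OF that])

definition quat_unit :: "nat \<Rightarrow> quat"
  where "quat_unit c = quat_of_coords (\<lambda>d. if d = c then 1 else 0)"

text \<open>The numbers \<open>qcoord c (x * quat_unit d)\<close> form the real 4 x 4 matrix of left
  multiplication by \<open>x\<close> in the basis 1, i, j, k.\<close>

lemma qcoord_mult_units: "(\<Sum>d<4. qcoord c (x * quat_unit d) * qcoord d y) = qcoord c (x * y)" if "c < 4"
  using that by (auto simp: less_4_cases lessThan_4 quat_unit_def quat_of_coords_def)

text \<open>In matrix terms this is left multiplication by \<open>x\<close> times the transpose of
  left multiplication by \<open>y\<close>, and transposing means conjugating \<open>y\<close>. It
  turns \<open>V V* = 1\<close> into orthonormality of real rows.\<close>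

lemma sum_qcoord_mult_right_units:
  assumes "c < 4" "c' < 4"
  shows "(\<Sum>d<4. qcoord c (x * quat_unit d) * qcoord c' (y * quat_unit d)) = qcoord c (x * qcnj y * quat_unit c')"
  using assms by (auto simp: less_4_cases lessThan_4 quat_unit_def quat_of_coords_def algebra_simps)

text \<open>The analogue for right multiplication, where composition reverses the order of the
  factors. It serves matrices multiplied from the right.\<close>

lemma sum_qcoord_mult_left_units:
  assumes "c < 4" "c' < 4"
  shows "(\<Sum>d<4. qcoord c (quat_unit d * x) * qcoord c' (quat_unit d * y)) = qcoord c (quat_unit c' * qcnj y * x)"
  using assms by (auto simp: less_4_cases lessThan_4 quat_unit_def quat_of_coords_def algebra_simps)

lemma qcoord_units_mult: "(\<Sum>d<4. qcoord c (quat_unit d * x) * qcoord d y) = qcoord c (y * x)" if "c < 4"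
  using that by (auto simp: less_4_cases lessThan_4 quat_unit_def quat_of_coords_def algebra_simps)

lemma qcoord_quat_unit: "qcoord c (quat_unit d) = (if c = d then 1 else 0)" if "c < 4"
  using that by (simp add: quat_unit_def)

lemma mat_mult_index_sum:
  "A \<in> carrier_mat m n \<Longrightarrow> B \<in> carrier_mat n p \<Longrightarrow> i < m \<Longrightarrow> j < p \<Longrightarrow>
    (A * B) $$ (i, j) = (\<Sum>l<n. A $$ (i, l) * B $$ (l, j))"
  by (simp add: scalar_prod_def lessThan_atLeast0)

lemma mat_mult_vec_index_sum:
  "A \<in> carrier_mat m n \<Longrightarrow> v \<in> carrier_vec n \<Longrightarrow> i < m \<Longrightarrow> (A *\<^sub>v v) $ i = (\<Sum>l<n. A $$ (i, l) * v $ l)"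
  by (simp add: scalar_prod_def lessThan_atLeast0)

lemma dim_ctranspose [simp]: "dim_row (ctranspose A) = dim_col A" "dim_col (ctranspose A) = dim_row A"
  by (simp_all add: ctranspose_def)

lemma index_ctranspose [simp]:
  "i < dim_col A \<Longrightarrow> j < dim_row A \<Longrightarrow> ctranspose A $$ (i, j) = qcnj (A $$ (j, i))"
  by (simp add: ctranspose_def)

lemma ctranspose_mult:
  assumes "A \<in> carrier_mat m n" "B \<in> carrier_mat n p"
  shows "ctranspose (A * B) = ctranspose B * ctranspose A"
proof (rule eq_matI)
  fix i j assume "i < dim_row (ctranspose B * ctranspose A)" "j < dim_col (ctranspose B * ctranspose A)"
  with assms have ij: "i < p" "j < m" by auto
  have "ctranspose (A * B) $$ (i, j) = (\<Sum>l<n. qcnj (B $$ (l, i)) * qcnj (A $$ (j, l)))"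
    using assms ij by (simp add: mat_mult_index_sum[OF assms] qcnj_sum del: index_mult_mat(1))
  also have "\<dots> = (ctranspose B * ctranspose A) $$ (i, j)"
    using assms ij by (simp add: mat_mult_index_sum[of _ p n _ m] del: index_mult_mat(1))
  finally show "ctranspose (A * B) $$ (i, j) = (ctranspose B * ctranspose A) $$ (i, j)" .
qed (use assms in auto)

lemma ctranspose_ctranspose [simp]: "ctranspose (ctranspose A) = A"
  by (rule eq_matI) auto

lemma ctranspose_one [simp]: "ctranspose (1\<^sub>m n) = 1\<^sub>m n"
  by (rule eq_matI) auto

lemma ctranspose_zero [simp]: "ctranspose (0\<^sub>m m n) = 0\<^sub>m n m"
  by (rule eq_matI) auto

lemma ctranspose_of_real: "ctranspose (quat_of_real_mat A) = quat_of_real_mat (transpose_mat A)"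
  by (rule eq_matI) auto

lemma quat_of_real_mat_mult:
  assumes "A \<in> carrier_mat m n" "B \<in> carrier_mat n p"
  shows "quat_of_real_mat (A * B) = quat_of_real_mat A * quat_of_real_mat B"
  by (rule of_real_hom.mat_hom_mult[OF assms])

lemma quat_of_real_mat_minus:
  "A \<in> carrier_mat m n \<Longrightarrow> B \<in> carrier_mat m n \<Longrightarrow>
    quat_of_real_mat (A - B) = quat_of_real_mat A - quat_of_real_mat B"
  by (intro eq_matI) auto

text \<open>The 4 is a quaternion scalar here; it can pass the left matrix because it is real and
  hence central.\<close>

lemma four_smult_mult:
  fixes A B :: "quat mat"
  assumes "A \<in> carrier_mat m n" "B \<in> carrier_mat n p"
  shows "A * (4 \<cdot>\<^sub>m B) = 4 \<cdot>\<^sub>m (A * B)" "(4 \<cdot>\<^sub>m A) * B = 4 \<cdot>\<^sub>m (A * B)"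
proof -
  have "A $$ (i, l) * (4 * B $$ (l, j)) = 4 * (A $$ (i, l) * B $$ (l, j))" for i j l
    using numeral_mult_commute[of "num.Bit0 (num.Bit0 num.One)" "A $$ (i, l)"]
    by (simp only: mult.assoc[symmetric])
  then show "A * (4 \<cdot>\<^sub>m B) = 4 \<cdot>\<^sub>m (A * B)"
    using assms by (intro eq_matI) (auto simp: mat_mult_index_sum[of _ m n _ p] sum_distrib_left simp del: index_mult_mat(1))
  show "(4 \<cdot>\<^sub>m A) * B = 4 \<cdot>\<^sub>m (A * B)"
    using assms by (intro eq_matI) (auto simp: mat_mult_index_sum[of _ m n _ p] sum_distrib_left mult.assoc simp del: index_mult_mat(1))
qed

subsection \<open>The real representation and inverses\<close>

text \<open>The real matrix of the map \<open>v\<close> to \<open>X v\<close>, with coordinate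
  \<open>c\<close> of entry \<open>i\<close> stored at position \<open>4 * i + c\<close>. Its
  determinant stands in for a determinant over a noncommutative ring.\<close>

definition real_rep :: "quat mat \<Rightarrow> real mat"
  where "real_rep X = Matrix.mat (4 * dim_row X) (4 * dim_col X)
    (\<lambda>(r, s). qcoord (r mod 4) (X $$ (r div 4, s div 4) * quat_unit (s mod 4)))"

definition real_vec :: "quat Matrix.vec \<Rightarrow> real Matrix.vec"
  where "real_vec v = Matrix.vec (4 * dim_vec v) (\<lambda>r. qcoord (r mod 4) (v $ (r div 4)))"

definition quat_vec :: "real Matrix.vec \<Rightarrow> quat Matrix.vec"
  where "quat_vec u = Matrix.vec (dim_vec u div 4) (\<lambda>i. quat_of_coords (\<lambda>c. u $ (4 * i + c)))"

abbreviation real_rep_det :: "quat mat \<Rightarrow> real"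
  where "real_rep_det X \<equiv> Determinant.det (real_rep X)"

lemma real_rep_carrier [simp]: "X \<in> carrier_mat m n \<Longrightarrow> real_rep X \<in> carrier_mat (4 * m) (4 * n)"
  by (simp add: real_rep_def)

lemma real_vec_carrier [simp]: "v \<in> carrier_vec n \<Longrightarrow> real_vec v \<in> carrier_vec (4 * n)"
  by (rule carrier_vecI) (simp add: real_vec_def)

lemma quat_vec_carrier [simp]: "u \<in> carrier_vec (4 * n) \<Longrightarrow> quat_vec u \<in> carrier_vec n"
  by (rule carrier_vecI) (simp add: quat_vec_def)

lemma sum_lessThan_4_mult: "(\<Sum>s<4 * p. f (s div 4) (s mod 4)) = (\<Sum>j<p. \<Sum>c<4. f j c)"
  for f :: "nat \<Rightarrow> nat \<Rightarrow> 'a::comm_monoid_add"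
proof -
  have "(\<Sum>s<4 * p. f (s div 4) (s mod 4)) = (\<Sum>j<p. \<Sum>s=j * 4..<j * 4 + 4. f (s div 4) (s mod 4))"
    by (simp add: sum.nat_group mult.commute)
  moreover have "(\<Sum>s=j * 4..<j * 4 + 4. f (s div 4) (s mod 4)) = (\<Sum>c<4. f j c)" for j
    using sum.shift_bounds_nat_ivl[of "\<lambda>s. f (s div 4) (s mod 4)" 0 "j * 4" 4]
    by (simp add: add.commute lessThan_atLeast0)
  ultimately show ?thesis by simp
qed

lemma real_rep_mult_vec:
  assumes "X \<in> carrier_mat m n" "v \<in> carrier_vec n"
  shows "real_rep X *\<^sub>v real_vec v = real_vec (X *\<^sub>v v)"
proof (rule eq_vecI)
  show "dim_vec (real_rep X *\<^sub>v real_vec v) = dim_vec (real_vec (X *\<^sub>v v))"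
    using assms by (simp add: real_rep_def real_vec_def)
  fix r assume "r < dim_vec (real_vec (X *\<^sub>v v))"
  with assms have r: "r < 4 * m" by (simp add: real_vec_def)
  then have r': "r div 4 < m" "r mod 4 < 4" by auto
  have "(real_rep X *\<^sub>v real_vec v) $ r = (\<Sum>s<4 * n. qcoord (r mod 4) (X $$ (r div 4, s div 4) * quat_unit (s mod 4)) *
      qcoord (s mod 4) (v $ (s div 4)))"
    using assms r by (subst mat_mult_vec_index_sum[OF real_rep_carrier real_vec_carrier])
      (auto simp: real_rep_def real_vec_def intro!: sum.cong)
  also have "\<dots> = (\<Sum>j<n. \<Sum>d<4. qcoord (r mod 4) (X $$ (r div 4, j) * quat_unit d) * qcoord d (v $ j))"
    by (rule sum_lessThan_4_mult)
  also have "\<dots> = qcoord (r mod 4) ((X *\<^sub>v v) $ (r div 4))"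
    using r' by (simp add: qcoord_mult_units mat_mult_vec_index_sum[OF assms] qcoord_sum)
  finally show "(real_rep X *\<^sub>v real_vec v) $ r = real_vec (X *\<^sub>v v) $ r"
    using assms r by (simp add: real_vec_def)
qed

lemma real_vec_quat_vec:
  assumes "u \<in> carrier_vec (4 * n)"
  shows "real_vec (quat_vec u) = u"
  using assms by (intro eq_vecI) (auto simp: real_vec_def quat_vec_def less_mult_imp_div_less mult.commute)

lemma quat_vec_real_vec: "quat_vec (real_vec v) = v"
proof (rule eq_vecI)
  fix i assume i: "i < dim_vec v"
  then have "real_vec v $ (4 * i + c) = qcoord c (v $ i)" if "c < 4" for c
    using that by (simp add: real_vec_def)
  then show "quat_vec (real_vec v) $ i = v $ i"
    using i by (auto simp: quat_vec_def real_vec_def intro!: quat_eqI_qcoord)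
qed (simp add: quat_vec_def real_vec_def)

lemma real_vec_zero [simp]: "real_vec (0\<^sub>v n) = 0\<^sub>v (4 * n)"
  by (rule eq_vecI) (auto simp: real_vec_def qcoord_0 less_mult_imp_div_less mult.commute)

lemma quat_vec_zero [simp]: "quat_vec (0\<^sub>v (4 * n)) = 0\<^sub>v n"
  using quat_vec_real_vec[of "0\<^sub>v n"] by simp

text \<open>\<open>real_vec\<close> and \<open>quat_vec\<close> carry nonzero kernel vectors back
  and forth between \<open>X\<close> and \<open>real_rep X\<close>.\<close>

lemma det_real_rep_eq_0_iff:
  assumes X: "X \<in> carrier_mat p p"
  shows "real_rep_det X = 0 \<longleftrightarrow> (\<exists>v\<in>carrier_vec p. v \<noteq> 0\<^sub>v p \<and> X *\<^sub>v v = 0\<^sub>v p)"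
proof -
  have "real_rep_det X = 0 \<longleftrightarrow>
      (\<exists>u. u \<in> carrier_vec (4 * p) \<and> u \<noteq> 0\<^sub>v (4 * p) \<and> real_rep X *\<^sub>v u = 0\<^sub>v (4 * p))"
    using X by (intro det_0_iff_vec_prod_zero_field) simp
  also have "\<dots> \<longleftrightarrow> (\<exists>v\<in>carrier_vec p. v \<noteq> 0\<^sub>v p \<and> X *\<^sub>v v = 0\<^sub>v p)"
  proof
    assume "\<exists>u. u \<in> carrier_vec (4 * p) \<and> u \<noteq> 0\<^sub>v (4 * p) \<and> real_rep X *\<^sub>v u = 0\<^sub>v (4 * p)"
    then obtain u where u: "u \<in> carrier_vec (4 * p)" "u \<noteq> 0\<^sub>v (4 * p)" "real_rep X *\<^sub>v u = 0\<^sub>v (4 * p)" by blast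
    have q: "quat_vec u \<in> carrier_vec p" using u by simp
    have "real_vec (X *\<^sub>v quat_vec u) = 0\<^sub>v (4 * p)"
      using real_rep_mult_vec[OF X q] u by (simp add: real_vec_quat_vec)
    then have "X *\<^sub>v quat_vec u = 0\<^sub>v p"
      using quat_vec_real_vec[of "X *\<^sub>v quat_vec u"] by simp
    moreover have "quat_vec u \<noteq> 0\<^sub>v p"
      using real_vec_quat_vec[OF u(1)] u(2) by auto
    ultimately show "\<exists>v\<in>carrier_vec p. v \<noteq> 0\<^sub>v p \<and> X *\<^sub>v v = 0\<^sub>v p" using q by blast
  next
    assume "\<exists>v\<in>carrier_vec p. v \<noteq> 0\<^sub>v p \<and> X *\<^sub>v v = 0\<^sub>v p"
    then obtain v where v: "v \<in> carrier_vec p" "v \<noteq> 0\<^sub>v p" "X *\<^sub>v v = 0\<^sub>v p" by blast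
    have "real_vec v \<noteq> 0\<^sub>v (4 * p)"
      using quat_vec_real_vec[of v] v(2) by auto
    then show "\<exists>u. u \<in> carrier_vec (4 * p) \<and> u \<noteq> 0\<^sub>v (4 * p) \<and> real_rep X *\<^sub>v u = 0\<^sub>v (4 * p)"
      using v real_rep_mult_vec[OF X v(1)] by (intro exI[of _ "real_vec v"]) auto
  qed
  finally show ?thesis .
qed

text \<open>By Cramer's rule the quotient is an entry of the real inverse. Only the columns
  \<open>4 * j\<close> are read: such a column is the image of the real unit 1 in place
  \<open>j\<close>, so its coordinates are those of column \<open>j\<close> of the quaternion
  inverse. Being explicit, the formula is also measurable in \<open>X\<close>.\<close>

definition rep_inverse :: "quat mat \<Rightarrow> quat mat"
  where "rep_inverse X = Matrix.mat (dim_row X) (dim_row X)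
    (\<lambda>(i, j). quat_of_coords (\<lambda>c. adj_mat (real_rep X) $$ (4 * i + c, 4 * j) / real_rep_det X))"

lemma mult_rep_inverse:
  assumes X: "X \<in> carrier_mat p p" and det: "real_rep_det X \<noteq> 0"
  shows "X * rep_inverse X = 1\<^sub>m p"
proof (rule eq_matI)
  let ?R = "real_rep X" and ?Y = "rep_inverse X"
  have R: "?R \<in> carrier_mat (4 * p) (4 * p)" using X by simp
  have Y: "?Y \<in> carrier_mat p p" using X by (simp add: rep_inverse_def)
  note adj = adj_mat[OF R]
  fix i j assume "i < dim_row (1\<^sub>m p)" "j < dim_col (1\<^sub>m p)"
  then have ij: "i < p" "j < p" by auto
  let ?v = "Matrix.vec (4 * p) (\<lambda>r. adj_mat ?R $$ (r, 4 * j) / Determinant.det ?R)"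
  have v: "?v = real_vec (col ?Y j)"
    using X ij by (intro eq_vecI) (auto simp: real_vec_def rep_inverse_def less_mult_imp_div_less mult.commute)
  have "?R *\<^sub>v ?v = real_vec (X *\<^sub>v col ?Y j)"
    unfolding v using X Y ij by (intro real_rep_mult_vec) auto
  also have "?R *\<^sub>v ?v = unit_vec (4 * p) (4 * j)"
  proof (rule eq_vecI)
    fix r assume "r < dim_vec (unit_vec (4 * p) (4 * j) :: real Matrix.vec)"
    then have r: "r < 4 * p" by simp
    have "(?R *\<^sub>v ?v) $ r = (\<Sum>s<4 * p. ?R $$ (r, s) * adj_mat ?R $$ (s, 4 * j)) / Determinant.det ?R"
      using R r by (subst mat_mult_vec_index_sum[OF R]) (auto simp: sum_divide_distrib)
    also have "(\<Sum>s<4 * p. ?R $$ (r, s) * adj_mat ?R $$ (s, 4 * j)) = (?R * adj_mat ?R) $$ (r, 4 * j)"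
      using r ij by (subst mat_mult_index_sum[OF R adj(1)]) auto
    finally show "(?R *\<^sub>v ?v) $ r = unit_vec (4 * p) (4 * j) $ r"
      using r ij det by (auto simp: adj(2))
  qed (use X in \<open>simp add: real_rep_def\<close>)
  finally have "X *\<^sub>v col ?Y j = quat_vec (unit_vec (4 * p) (4 * j))"
    using quat_vec_real_vec[of "X *\<^sub>v col ?Y j"] by simp
  moreover have "quat_vec (unit_vec (4 * p) (4 * j)) $ i = (if i = j then 1 else 0)"
    using ij by (auto simp: quat_vec_def quat_of_coords_def quat_eq_iff)
  moreover have "(X * ?Y) $$ (i, j) = (X *\<^sub>v col ?Y j) $ i"
    using X Y ij by simp
  ultimately show "(X * ?Y) $$ (i, j) = 1\<^sub>m p $$ (i, j)"
    using ij by simp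
qed (use X in \<open>auto simp: rep_inverse_def\<close>)

lemma mult_mat_cancel_kernel:
  fixes X :: "'a::ring_1 mat"
  assumes X: "X \<in> carrier_mat p q" and Z: "Z \<in> carrier_mat q r" "X * Z = 0\<^sub>m p r"
    and ker: "\<And>v. v \<in> carrier_vec q \<Longrightarrow> X *\<^sub>v v = 0\<^sub>v p \<Longrightarrow> v = 0\<^sub>v q"
  shows "Z = 0\<^sub>m q r"
proof (rule mat_col_eqI)
  fix j assume "j < dim_col (0\<^sub>m q r)"
  then have j: "j < r" by simp
  have "X *\<^sub>v col Z j = col (X * Z) j"
    using X Z(1) j by (subst col_mult2) auto
  also have "\<dots> = 0\<^sub>v p" using Z j by auto
  finally have "col Z j = 0\<^sub>v q" using Z(1) ker by auto
  then show "col Z j = col (0\<^sub>m q r) j" using j by simp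
qed (use Z in auto)

lemma right_inverse_of_trivial_kernel:
  fixes X :: "quat mat"
  assumes X: "X \<in> carrier_mat p p"
    and ker: "\<And>v. v \<in> carrier_vec p \<Longrightarrow> X *\<^sub>v v = 0\<^sub>v p \<Longrightarrow> v = 0\<^sub>v p"
  shows "real_rep_det X \<noteq> 0" "X * rep_inverse X = 1\<^sub>m p" "rep_inverse X * X = 1\<^sub>m p"
    "rep_inverse X \<in> carrier_mat p p"
proof -
  show det: "real_rep_det X \<noteq> 0"
    using det_real_rep_eq_0_iff[OF X] ker by auto
  show XY: "X * rep_inverse X = 1\<^sub>m p"
    by (rule mult_rep_inverse[OF X det])
  show Y: "rep_inverse X \<in> carrier_mat p p" using X by (simp add: rep_inverse_def)
  have YX: "rep_inverse X * X \<in> carrier_mat p p" using X Y by simp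
  \<comment> \<open>For the right inverse \<open>Y\<close> one has \<open>X (Y X - 1) = 0\<close>,
    and the trivial kernel of \<open>X\<close> cancels the left factor; so \<open>Y\<close> is a
    left inverse too.\<close>
  have "X * (rep_inverse X * X - 1\<^sub>m p) = X * (rep_inverse X * X) - X * 1\<^sub>m p"
    using X YX by (intro mult_minus_distrib_mat) auto
  also have "X * (rep_inverse X * X) = X * rep_inverse X * X"
    using X Y by (intro assoc_mult_mat[symmetric]) auto
  also have "\<dots> - X * 1\<^sub>m p = 0\<^sub>m p p"
    using X by (simp add: XY)
  finally have "X * (rep_inverse X * X - 1\<^sub>m p) = 0\<^sub>m p p" .
  then have "rep_inverse X * X - 1\<^sub>m p = 0\<^sub>m p p"
    by (rule mult_mat_cancel_kernel[OF X _ _ ker, rotated]) (use YX in auto)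
  then have "(rep_inverse X * X - 1\<^sub>m p) + 1\<^sub>m p = 1\<^sub>m p" by simp
  moreover have "(W - 1\<^sub>m p) + 1\<^sub>m p = W" if "W \<in> carrier_mat p p" for W :: "quat mat"
    using that by (intro eq_matI) auto
  note this[OF YX]
  ultimately show "rep_inverse X * X = 1\<^sub>m p" by simp
qed

lemma trivial_kernel_of_left_inverse:
  fixes X :: "'a::ring_1 mat"
  assumes "X \<in> carrier_mat p q" "Y \<in> carrier_mat q p" "Y * X = 1\<^sub>m q" "v \<in> carrier_vec q" "X *\<^sub>v v = 0\<^sub>v p"
  shows "v = 0\<^sub>v q"
proof -
  have "v = (Y * X) *\<^sub>v v" using assms by simp
  also have "\<dots> = Y *\<^sub>v (X *\<^sub>v v)" using assms by (intro assoc_mult_mat_vec) auto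
  also have "\<dots> = 0\<^sub>v q" using assms by (auto intro!: eq_vecI)
  finally show ?thesis .
qed

text \<open>\<open>X Y = 1\<close> makes the kernel of \<open>Y\<close> trivial, so \<open>Y\<close>
  has a two-sided inverse, and this inverse must be \<open>X\<close>.\<close>

lemma quat_mat_left_right_inverse:
  fixes X Y :: "quat mat"
  assumes X: "X \<in> carrier_mat p p" and Y: "Y \<in> carrier_mat p p" and XY: "X * Y = 1\<^sub>m p"
  shows "Y * X = 1\<^sub>m p"
proof -
  note inv = right_inverse_of_trivial_kernel[OF Y trivial_kernel_of_left_inverse[OF Y X XY]]
  let ?Z = "rep_inverse Y"
  have "X = X * (Y * ?Z)" using X by (simp add: inv)
  also have "\<dots> = X * Y * ?Z" by (rule assoc_mult_mat[symmetric, OF X Y inv(4)])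
  also have "\<dots> = ?Z" using inv(4) by (simp add: XY)
  finally show ?thesis using inv(2) by simp
qed

lemma invertible_matI:
  fixes X :: "'a::semiring_1 mat"
  assumes "X \<in> carrier_mat p p" "Y \<in> carrier_mat p p" "X * Y = 1\<^sub>m p" "Y * X = 1\<^sub>m p"
  shows "invertible_mat X"
  using assms unfolding invertible_mat_def inverts_mat_def by auto

lemma invertible_matE:
  fixes X :: "'a::semiring_1 mat"
  assumes "invertible_mat X" "X \<in> carrier_mat p p"
  obtains Y where "Y \<in> carrier_mat p p" "X * Y = 1\<^sub>m p" "Y * X = 1\<^sub>m p"
proof -
  obtain Y where Y: "X * Y = 1\<^sub>m p" "Y * X = 1\<^sub>m (dim_row Y)"
    using assms unfolding invertible_mat_def inverts_mat_def by auto
  \<comment> \<open>Invertibility by definition does not fix the shape of \<open>Y\<close>; its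
    dimensions are read off from the two products.\<close>
  have "dim_col (Y * X) = dim_row Y" unfolding Y(2) by simp
  then have "dim_row Y = p" using assms(2) by simp
  moreover have "dim_col (X * Y) = p" unfolding Y(1) by simp
  moreover from this have "dim_col Y = p" by simp
  ultimately show ?thesis using Y by (intro that[of Y] carrier_matI) auto
qed

lemma inv_mat_eqI:
  fixes X :: "'a::ring_1 mat"
  assumes X: "X \<in> carrier_mat p p" and Y: "Y \<in> carrier_mat p p" and XY: "X * Y = 1\<^sub>m p" "Y * X = 1\<^sub>m p"
  shows "inv_mat X = Y"
proof -
  have inv: "invertible_mat X" by (rule invertible_matI[OF assms])
  have eq: "Z = Y" if Z: "inverts_mat X Z \<and> inverts_mat Z X" for Z
  proof -
    have "X * Z = 1\<^sub>m p" "Z * X = 1\<^sub>m (dim_row Z)" using Z X by (auto simp: inverts_mat_def)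
    moreover from this(2) have "dim_row Z = p" using X by (metis carrier_matD(2) index_mult_mat(3) index_one_mat(3))
    moreover from \<open>X * Z = 1\<^sub>m p\<close> have "dim_col Z = p" by (metis index_mult_mat(3) index_one_mat(3))
    ultimately have Z: "Z \<in> carrier_mat p p" "X * Z = 1\<^sub>m p" by auto
    have "Z = Y * X * Z" using Z by (simp add: XY)
    also have "\<dots> = Y * (X * Z)" by (rule assoc_mult_mat[OF Y X Z(1)])
    also have "\<dots> = Y" using Y by (simp add: Z)
    finally show ?thesis .
  qed
  have "inverts_mat X Y \<and> inverts_mat Y X" using assms by (simp add: inverts_mat_def)
  then have "(SOME B. inverts_mat X B \<and> inverts_mat B X) = Y"
    using eq by (rule some_equality)
  then show ?thesis using inv by (simp add: inv_mat_def)
qed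

text \<open>Replaces the choice operator by cofactors, with the default zero where the real
  determinant vanishes. In this form the inverse depends measurably on the entries.\<close>

lemma inv_mat_quat:
  assumes X: "X \<in> carrier_mat p p"
  shows "inv_mat X = (if real_rep_det X = 0 then 0\<^sub>m p p else rep_inverse X)"
proof (cases "real_rep_det X = 0")
  case True
  have "\<not> invertible_mat X"
  proof
    assume "invertible_mat X"
    then obtain Y where Y: "Y \<in> carrier_mat p p" "Y * X = 1\<^sub>m p"
      using X by (rule invertible_matE)
    with True show False
      using det_real_rep_eq_0_iff[OF X] trivial_kernel_of_left_inverse[OF X Y] by blast
  qed
  then show ?thesis using True X by (simp add: inv_mat_def)
next
  case False
  then have "v = 0\<^sub>v p" if "v \<in> carrier_vec p" "X *\<^sub>v v = 0\<^sub>v p" for v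
    unfolding det_real_rep_eq_0_iff[OF X] using that by metis
  then have "X * rep_inverse X = 1\<^sub>m p" "rep_inverse X * X = 1\<^sub>m p" "rep_inverse X \<in> carrier_mat p p"
    by (blast intro: right_inverse_of_trivial_kernel[OF X])+
  then have "inv_mat X = rep_inverse X"
    by (intro inv_mat_eqI[OF X])
  then show ?thesis using False by (simp only: if_False)
qed

section \<open>Measurability of determinant, adjugate and inverse\<close>

lemma measurable_det:
  fixes A :: "'w \<Rightarrow> real mat"
  assumes dim: "\<And>x. x \<in> space M \<Longrightarrow> A x \<in> carrier_mat n n"
    and A: "\<And>i j. i < n \<Longrightarrow> j < n \<Longrightarrow> (\<lambda>x. A x $$ (i, j)) \<in> borel_measurable M"
  shows "(\<lambda>x. Determinant.det (A x)) \<in> borel_measurable M"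
proof -
  have "(\<lambda>x. \<Sum>p | p permutes {0..<n}. signof p * (\<Prod>i = 0..<n. A x $$ (i, p i))) \<in> borel_measurable M"
    by (intro borel_measurable_sum borel_measurable_times borel_measurable_prod A borel_measurable_const)
      (auto dest: permutes_in_image)
  also have "?this \<longleftrightarrow> (\<lambda>x. Determinant.det (A x)) \<in> borel_measurable M"
    by (intro measurable_cong) (use dim in \<open>auto simp: Determinant.det_def\<close>)
  finally show ?thesis .
qed

lemma measurable_adj_mat:
  fixes A :: "'w \<Rightarrow> real mat"
  assumes dim: "\<And>x. x \<in> space M \<Longrightarrow> A x \<in> carrier_mat n n"
    and A: "\<And>i j. i < n \<Longrightarrow> j < n \<Longrightarrow> (\<lambda>x. A x $$ (i, j)) \<in> borel_measurable M"
    and ij: "i < n" "j < n"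
  shows "(\<lambda>x. adj_mat (A x) $$ (i, j)) \<in> borel_measurable M"
proof -
  have "(\<lambda>x. mat_delete (A x) j i $$ (k, l)) \<in> borel_measurable M" if "k < n - 1" "l < n - 1" for k l
  proof -
    have "(\<lambda>x. A x $$ (if k < j then k else Suc k, if l < i then l else Suc l)) \<in> borel_measurable M"
      using that by (intro A) auto
    also have "?this \<longleftrightarrow> (\<lambda>x. mat_delete (A x) j i $$ (k, l)) \<in> borel_measurable M"
      by (intro measurable_cong) (use dim that in \<open>fastforce simp: mat_delete_def\<close>)
    finally show ?thesis .
  qed
  then have "(\<lambda>x. Determinant.det (mat_delete (A x) j i)) \<in> borel_measurable M"
    by (intro measurable_det[where n="n - 1"]) (use dim in \<open>fastforce intro: mat_delete_carrier\<close>)+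
  then have "(\<lambda>x. (-1) ^ (j + i) * Determinant.det (mat_delete (A x) j i)) \<in> borel_measurable M"
    by simp
  also have "?this \<longleftrightarrow> (\<lambda>x. adj_mat (A x) $$ (i, j)) \<in> borel_measurable M"
    by (intro measurable_cong) (use dim ij in \<open>fastforce simp: adj_mat_def cofactor_def\<close>)
  finally show ?thesis .
qed

lemma measurable_real_rep:
  fixes A :: "'w \<Rightarrow> quat mat"
  assumes A: "A \<in> M \<rightarrow>\<^sub>M mat_borel p p" and rs: "r < 4 * p" "s < 4 * p"
  shows "(\<lambda>x. real_rep (A x) $$ (r, s)) \<in> borel_measurable M"
proof -
  have "(\<lambda>x. A x $$ (r div 4, s div 4) * quat_unit (s mod 4)) \<in> borel_measurable M"
    by (rule borel_measurable_times[OF measurable_mat_entry[OF A] borel_measurable_const]) (use rs in auto)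
  then have "(\<lambda>x. qcoord (r mod 4) (A x $$ (r div 4, s div 4) * quat_unit (s mod 4))) \<in> borel_measurable M"
    by (rule measurable_qcoord) simp
  also have "?this \<longleftrightarrow> (\<lambda>x. real_rep (A x) $$ (r, s)) \<in> borel_measurable M"
    using rs by (intro measurable_cong) (simp add: real_rep_def measurable_mat_dim[OF A])
  finally show ?thesis .
qed

lemma measurable_det_real_rep:
  fixes A :: "'w \<Rightarrow> quat mat"
  assumes A: "A \<in> M \<rightarrow>\<^sub>M mat_borel p p"
  shows "(\<lambda>x. real_rep_det (A x)) \<in> borel_measurable M"
  by (rule measurable_det[OF real_rep_carrier[OF measurable_mat_carrier[OF A]] measurable_real_rep[OF A]])

lemma measurable_inv_mat:
  fixes A :: "'w \<Rightarrow> quat mat"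
  assumes A: "A \<in> M \<rightarrow>\<^sub>M mat_borel p p"
  shows "(\<lambda>x. inv_mat (A x)) \<in> M \<rightarrow>\<^sub>M mat_borel p p"
proof (rule measurable_mat_borelI)
  have carrier: "A x \<in> carrier_mat p p" if "x \<in> space M" for x
    by (rule measurable_mat_carrier[OF A that])
  show "inv_mat (A x) \<in> carrier_mat p p" if "x \<in> space M" for x
    using carrier_matD[OF carrier[OF that]]
    by (subst inv_mat_quat[OF carrier[OF that]]) (auto simp: rep_inverse_def)
  note RC = real_rep_carrier[OF carrier] and R = measurable_real_rep[OF A]
  note det [measurable] = measurable_det_real_rep[OF A]
  fix i j assume ij: "i < p" "j < p"
  have "(\<lambda>x. if real_rep_det (A x) = 0 then 0 else
      quat_of_coords (\<lambda>c. adj_mat (real_rep (A x)) $$ (4 * i + c, 4 * j) / real_rep_det (A x))) \<in> borel_measurable M"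
  proof (rule measurable_If)
    show "(\<lambda>x. quat_of_coords (\<lambda>c. adj_mat (real_rep (A x)) $$ (4 * i + c, 4 * j) /
        real_rep_det (A x))) \<in> borel_measurable M"
      by (rule measurable_quat_of_coords, rule borel_measurable_divide[OF measurable_adj_mat[OF RC R] det])
        (use ij in auto)
  qed measurable
  also have "?this \<longleftrightarrow> (\<lambda>x. inv_mat (A x) $$ (i, j)) \<in> borel_measurable M"
    using ij by (intro measurable_cong) (simp add: inv_mat_quat[OF carrier] rep_inverse_def measurable_mat_dim[OF A])
  finally show "(\<lambda>x. inv_mat (A x) $$ (i, j)) \<in> borel_measurable M" .
qed

subsection \<open>Orthonormal rows\<close>

text \<open>The conjugate sits on the right factor, so the form is linear in its first argument for
  scalars from the left, the side from which rows are combined.\<close>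

definition row_inner :: "nat \<Rightarrow> (nat \<Rightarrow> quat) \<Rightarrow> (nat \<Rightarrow> quat) \<Rightarrow> quat"
  where "row_inner n a b = (\<Sum>l<n. a l * qcnj (b l))"

definition orthonormal_rows :: "nat \<Rightarrow> nat \<Rightarrow> (nat \<Rightarrow> nat \<Rightarrow> quat) \<Rightarrow> bool"
  where "orthonormal_rows n p v \<longleftrightarrow> (\<forall>i<p. \<forall>j<p. row_inner n (v i) (v j) = (if i = j then 1 else 0))"

lemma qre_sum: "qre (sum f S) = (\<Sum>i\<in>S. qre (f i))"
  using qcoord_sum[of 0] by simp

lemma row_inner_diff_left: "row_inner n (\<lambda>l. a l - b l) c = row_inner n a c - row_inner n b c"
  by (simp add: row_inner_def left_diff_distrib sum_subtractf)

lemma row_inner_sum_left: "row_inner n (\<lambda>l. \<Sum>i\<in>S. a i * f i l) c = (\<Sum>i\<in>S. a i * row_inner n (f i) c)"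
  by (simp add: row_inner_def sum_distrib_left sum_distrib_right mult.assoc) (rule sum.swap)

lemma row_inner_commute: "row_inner n b a = qcnj (row_inner n a b)"
  by (simp add: row_inner_def qcnj_sum)

lemma row_inner_scale_left: "row_inner n (\<lambda>l. r * a l) b = r * row_inner n a b"
  by (simp add: row_inner_def sum_distrib_left mult.assoc)

lemma row_inner_self: "row_inner n a a = of_real (\<Sum>l<n. qnormsq (a l))"
  by (simp add: row_inner_def mult_qcnj)

definition row_residual :: "nat \<Rightarrow> nat \<Rightarrow> (nat \<Rightarrow> nat \<Rightarrow> quat) \<Rightarrow> (nat \<Rightarrow> quat) \<Rightarrow> nat \<Rightarrow> quat"
  where "row_residual n p v g l = g l - (\<Sum>i<p. row_inner n g (v i) * v i l)"

lemma row_inner_residual: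
  assumes "orthonormal_rows n p v" "j < p"
  shows "row_inner n (row_residual n p v g) (v j) = 0"
proof -
  have "(\<Sum>i<p. row_inner n g (v i) * row_inner n (v i) (v j)) =
      (\<Sum>i<p. if i = j then row_inner n g (v i) else 0)"
    using assms by (intro sum.cong) (auto simp: orthonormal_rows_def)
  then show ?thesis
    using assms(2) unfolding row_residual_def by (simp add: row_inner_diff_left row_inner_sum_left)
qed

text \<open>The normalising factor is real, hence central, and scales the squared norm
  \<open>N\<close> by \<open>r * r\<close>. Orthogonality in the opposite order follows by
  conjugation.\<close>

lemma orthonormal_rows_extend:
  assumes v: "orthonormal_rows n p v" and h: "\<And>i. i < p \<Longrightarrow> row_inner n h (v i) = 0" "l0 < n" "h l0 \<noteq> 0"
  obtains r :: real where "orthonormal_rows n (Suc p) (v(p := \<lambda>l. of_real r * h l))" "r \<noteq> 0"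
proof -
  define N where "N = (\<Sum>l<n. qnormsq (h l))"
  have "0 < qnormsq (h l0)" using h(3) qnormsq_nonneg[of "h l0"] qnormsq_eq_0_iff[of "h l0"] by linarith
  also have "\<dots> \<le> N" unfolding N_def using h(2) by (intro member_le_sum) (auto simp: qnormsq_nonneg)
  finally have N: "N > 0" .
  define r where "r = 1 / sqrt N"
  let ?w = "\<lambda>l. of_real r * h l"
  have "row_inner n ?w ?w = of_real r * qcnj (of_real r * row_inner n h h)"
    using row_inner_commute[of n h ?w] by (simp only: row_inner_scale_left)
  also have "\<dots> = of_real (r * r * N)"
    by (simp add: row_inner_self N_def[symmetric] of_real_mult_commute[of N "of_real r"] mult.assoc del: of_real_sum)
  also have "r * r * N = 1" using N by (simp add: r_def)
  finally have w: "row_inner n ?w ?w = 1" by simp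
  have w0: "row_inner n ?w (v i) = 0" if "i < p" for i
    using h(1)[OF that] by (simp add: row_inner_scale_left)
  then have w1: "row_inner n (v i) ?w = 0" if "i < p" for i
    using row_inner_commute[of n "v i" ?w] that by simp
  have "orthonormal_rows n (Suc p) (v(p := ?w))"
    using v w w0 w1 unfolding orthonormal_rows_def by (auto simp: less_Suc_eq)
  then show ?thesis using N by (intro that[of r]) (auto simp: r_def)
qed

text \<open>Gram-Schmidt with its coefficients recorded: the matrix \<open>K\<close> expressing the
  new rows through the old ones later serves as the inverse of the left factor in the LQ
  decomposition.\<close>

lemma gram_schmidt_rows:
  fixes g :: "nat \<Rightarrow> nat \<Rightarrow> quat"
  assumes "\<And>c. (\<forall>l<n. (\<Sum>i<p. c i * g i l) = 0) \<Longrightarrow> \<forall>i<p. c i = 0"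
  shows "\<exists>v K. orthonormal_rows n p v \<and> (\<forall>i<p. \<forall>l. v i l = (\<Sum>j<p. K i j * g j l))"
  using assms
proof (induction p)
  case 0
  then show ?case by (simp add: orthonormal_rows_def)
next
  case (Suc p)
  have "\<forall>i<p. c i = 0" if "\<forall>l<n. (\<Sum>i<p. c i * g i l) = 0" for c
  proof -
    \<comment> \<open>Padding with a zero coefficient shows that the first \<open>p\<close> rows
      inherit independence.\<close>
    have "\<forall>l<n. (\<Sum>i<Suc p. (c(p := 0)) i * g i l) = 0" using that by simp
    then have "\<forall>i<Suc p. (c(p := 0)) i = 0" by (rule Suc.prems)
    then show ?thesis by (auto simp: less_Suc_eq split: if_splits)
  qed
  from Suc.IH[OF this] obtain v K where v: "orthonormal_rows n p v"
    and K: "\<And>i l. i < p \<Longrightarrow> v i l = (\<Sum>j<p. K i j * g j l)" by blast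
  \<comment> \<open>The coefficients of the residual of row \<open>p\<close> in the original rows.
    Row \<open>p\<close> itself has coefficient 1, so independence forbids the residual to
    vanish.\<close>
  define c where "c j = (if j = p then 1 else - (\<Sum>i<p. row_inner n (g p) (v i) * K i j))" for j
  have res: "row_residual n p v (g p) l = (\<Sum>j<Suc p. c j * g j l)" for l
  proof -
    have "(\<Sum>i<p. row_inner n (g p) (v i) * v i l) = (\<Sum>j<p. (\<Sum>i<p. row_inner n (g p) (v i) * K i j) * g j l)"
      by (simp add: K sum_distrib_left sum_distrib_right mult.assoc) (rule sum.swap)
    then show ?thesis by (simp add: row_residual_def c_def sum_negf)
  qed
  have "\<not> (\<forall>l<n. (\<Sum>j<Suc p. c j * g j l) = 0)"
  proof
    assume "\<forall>l<n. (\<Sum>j<Suc p. c j * g j l) = 0"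
    then have "\<forall>i<Suc p. c i = 0" by (rule Suc.prems)
    then have "c p = 0" by blast
    then show False by (simp add: c_def)
  qed
  then obtain l0 where l0: "l0 < n" "row_residual n p v (g p) l0 \<noteq> 0" by (auto simp: res)
  obtain r where r: "orthonormal_rows n (Suc p) (v(p := \<lambda>l. of_real r * row_residual n p v (g p) l))"
    by (rule orthonormal_rows_extend[OF v row_inner_residual[OF v] l0])
  define K' where "K' i j = (if i = p then of_real r * c j else if j = p then 0 else K i j)" for i j
  have "(v(p := \<lambda>l. of_real r * row_residual n p v (g p) l)) i l = (\<Sum>j<Suc p. K' i j * g j l)" if "i < Suc p" for i l
  proof (cases "i = p")
    case True
    have "of_real r * (\<Sum>j<Suc p. c j * g j l) = (\<Sum>j<Suc p. K' p j * g j l)"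
      by (simp only: K'_def if_True sum_distrib_left mult.assoc simp_thms refl)
    then show ?thesis using True by (simp only: fun_upd_same res)
  next
    case False
    then show ?thesis using that K[of i l] by (simp add: K'_def)
  qed
  with r show ?case by blast
qed

text \<open>The induction runs downwards from \<open>p = n\<close>, and a further row is found among
  the residuals of the unit rows. If all of these vanished, the trace of the projection onto the
  given rows would be both \<open>p\<close> and \<open>n\<close>.\<close>

lemma orthonormal_rows_complete:
  assumes "orthonormal_rows n p v" "p \<le> n"
  shows "\<exists>v'. orthonormal_rows n n v' \<and> (\<forall>i<p. v' i = v i)"
  using assms(2,1)
proof (induction p arbitrary: v rule: inc_induct)
  case base
  then show ?case by blast
next
  case (step p)
  define e where "e j l = (if l = j then 1 else 0 :: quat)" for j l :: nat
  have inner: "row_inner n (e j) a = qcnj (a j)" if "j < n" for a j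
  proof -
    have "row_inner n (e j) a = (\<Sum>l<n. if l = j then qcnj (a l) else 0)"
      unfolding row_inner_def e_def by (intro sum.cong) auto
    then show ?thesis using that by simp
  qed
  have "\<exists>j<n. \<exists>l<n. row_residual n p v (e j) l \<noteq> 0"
  proof (rule ccontr)
    assume "\<not> ?thesis"
    then have "row_residual n p v (e j) j = 0" if "j < n" for j using that by blast
    then have "(\<Sum>i<p. qcnj (v i j) * v i j) = 1" if "j < n" for j
      using that by (simp add: row_residual_def inner e_def)
    then have "qre (\<Sum>i<p. qcnj (v i j) * v i j) = 1" if "j < n" for j
      using that by simp
    \<comment> \<open>Double counting of the trace: each of the \<open>n\<close> positions
      contributes 1, and after swapping the sums each of the \<open>p\<close> unit rows contributes
      1.\<close>
    then have "(\<Sum>j<n. \<Sum>i<p. qre (qcnj (v i j) * v i j)) = (\<Sum>j<n. 1)"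
      unfolding qre_sum by (intro sum.cong refl) auto
    moreover have "(\<Sum>j<n. qre (qcnj (v i j) * v i j)) = 1" if "i < p" for i
    proof -
      have "(\<Sum>j<n. qre (qcnj (v i j) * v i j)) = qre (row_inner n (v i) (v i))"
        unfolding row_inner_def qre_sum by (intro sum.cong) simp_all
      then show ?thesis using step.prems that by (simp add: orthonormal_rows_def)
    qed
    ultimately have "real p = real n"
      by (subst (asm) sum.swap) simp
    then show False using step.hyps by simp
  qed
  then obtain j l where jl: "l < n" "row_residual n p v (e j) l \<noteq> 0" by blast
  obtain r where "orthonormal_rows n (Suc p) (v(p := \<lambda>l. of_real r * row_residual n p v (e j) l))"
    by (rule orthonormal_rows_extend[OF step.prems row_inner_residual[OF step.prems] jl])
  from step.IH[OF this] obtain v' where v': "orthonormal_rows n n v'"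
    "\<And>i. i < Suc p \<Longrightarrow> v' i = (v(p := \<lambda>l. of_real r * row_residual n p v (e j) l)) i" by blast
  then have "\<forall>i<p. v' i = v i" by simp
  with v'(1) show ?case by blast
qed

lemma orthonormal_rows_mat_iff:
  assumes V: "V \<in> carrier_mat p n"
  shows "orthonormal_rows n p (\<lambda>i l. V $$ (i, l)) \<longleftrightarrow> V * ctranspose V = 1\<^sub>m p"
proof -
  have "(V * ctranspose V) $$ (i, j) = row_inner n (\<lambda>l. V $$ (i, l)) (\<lambda>l. V $$ (j, l))" if "i < p" "j < p" for i j
    using V that mat_mult_index_sum[OF V ctranspose_carrier[OF V] that] by (simp add: row_inner_def)
  then show ?thesis
    using V unfolding orthonormal_rows_def mat_eq_iff by auto
qed

text \<open>Independence of the rows under scalars from the left, phrased with row matrices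
  \<open>x\<close> so that matrix algebra applies directly. Gram-Schmidt on rows needs this side,
  whereas \<open>quat_rank\<close> counts columns with scalars from the right.\<close>

definition left_independent :: "quat mat \<Rightarrow> bool"
  where "left_independent G \<longleftrightarrow> (\<forall>x\<in>carrier_mat 1 (dim_row G). x * G = 0\<^sub>m 1 (dim_col G) \<longrightarrow> x = 0\<^sub>m 1 (dim_row G))"

lemma left_independentI:
  assumes "G \<in> carrier_mat p n"
    and "\<And>x. x \<in> carrier_mat 1 p \<Longrightarrow> x * G = 0\<^sub>m 1 n \<Longrightarrow> x = 0\<^sub>m 1 p"
  shows "left_independent G"
  using assms by (auto simp: left_independent_def)

lemma left_independentD:
  assumes "left_independent G" "G \<in> carrier_mat p n" "x \<in> carrier_mat 1 p" "x * G = 0\<^sub>m 1 n"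
  shows "x = 0\<^sub>m 1 p"
  using assms by (auto simp: left_independent_def)

lemma left_independent_mult:
  assumes G: "left_independent G" "G \<in> carrier_mat p n"
    and N: "N \<in> carrier_mat n q" "N' \<in> carrier_mat q n" "N * N' = 1\<^sub>m n"
  shows "left_independent (G * N)"
proof (rule left_independentI)
  fix x assume x: "x \<in> carrier_mat 1 p" "x * (G * N) = 0\<^sub>m 1 q"
  have xG: "x * G \<in> carrier_mat 1 n" using x G by simp
  have "x * G = x * G * (N * N')" unfolding N(3) by (rule right_mult_one_mat[OF xG, symmetric])
  also have "\<dots> = x * G * N * N'" by (rule assoc_mult_mat[symmetric, OF xG N(1,2)])
  also have "x * G * N = x * (G * N)" by (rule assoc_mult_mat[OF x(1) G(2) N(1)])
  also have "\<dots> * N' = 0\<^sub>m 1 n" using x N by simp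
  finally show "x = 0\<^sub>m 1 p" by (rule left_independentD[OF G x(1)])
qed (use G N in auto)

lemma left_independent_mult_left:
  assumes G: "left_independent G" "G \<in> carrier_mat p n"
    and N: "N \<in> carrier_mat p p" "N' \<in> carrier_mat p p" "N * N' = 1\<^sub>m p"
  shows "left_independent (N * G)"
proof (rule left_independentI)
  fix x assume x: "x \<in> carrier_mat 1 p" "x * (N * G) = 0\<^sub>m 1 n"
  then have "x * N * G = 0\<^sub>m 1 n" using assoc_mult_mat[OF x(1) N(1) G(2)] by simp
  then have "x * N = 0\<^sub>m 1 p" using x N by (intro left_independentD[OF G]) auto
  then have "x * N * N' = 0\<^sub>m 1 p" using N by simp
  then show "x = 0\<^sub>m 1 p" using assoc_mult_mat[OF x(1) N(1,2)] x(1) by (simp add: N)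
qed (use G N in auto)

text \<open>A relation between the rows restricts to the selected columns, where invertibility kills
  it.\<close>

lemma left_independent_columns:
  assumes G: "G \<in> carrier_mat p n" and e: "\<And>j. j < p \<Longrightarrow> e j < n"
    and X: "invertible_mat (Matrix.mat p p (\<lambda>(i, j). G $$ (i, e j)))"
  shows "left_independent G"
proof (rule left_independentI[OF G])
  let ?X = "Matrix.mat p p (\<lambda>(i, j). G $$ (i, e j))"
  have XC: "?X \<in> carrier_mat p p" by simp
  obtain Y where Y: "Y \<in> carrier_mat p p" "?X * Y = 1\<^sub>m p" using X XC by (rule invertible_matE)
  fix x assume x: "x \<in> carrier_mat 1 p" "x * G = 0\<^sub>m 1 n"
  have "x * ?X = 0\<^sub>m 1 p"
  proof (rule eq_matI)
    fix i j assume "i < dim_row (0\<^sub>m 1 p :: quat mat)" "j < dim_col (0\<^sub>m 1 p :: quat mat)"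
    then have ij: "i < 1" "j < p" by auto
    have "(x * ?X) $$ (i, j) = (\<Sum>l<p. x $$ (i, l) * G $$ (l, e j))"
      using ij by (subst mat_mult_index_sum[OF x(1) XC]) auto
    also have "\<dots> = (x * G) $$ (i, e j)"
      using ij e by (subst mat_mult_index_sum[OF x(1) G]) auto
    finally show "(x * ?X) $$ (i, j) = 0\<^sub>m 1 p $$ (i, j)" using ij e x(2) by simp
  qed (use x in auto)
  then have "x * ?X * Y = 0\<^sub>m 1 p" using Y by simp
  then show "x = 0\<^sub>m 1 p" using assoc_mult_mat[OF x(1) XC Y(1)] x(1) by (simp add: Y)
qed

text \<open>Column rank against row rank over a skew field: \<open>k\<close> right independent
  columns form a square matrix with trivial kernel, hence with a two-sided inverse, and applying
  this inverse from the right removes every left relation between the rows.\<close>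

lemma left_independent_of_quat_rank:
  assumes G: "G \<in> carrier_mat k m" and rank: "quat_rank G = k"
  shows "left_independent G"
proof -
  let ?S = "{card J | J. J \<subseteq> {..<dim_col G} \<and>
    (\<forall>c. (\<forall>i<dim_row G. (\<Sum>j\<in>J. G $$ (i, j) * c j) = 0) \<longrightarrow> (\<forall>j\<in>J. c j = 0))}"
  have "?S \<subseteq> card ` Pow {..<dim_col G}" by auto
  then have "finite ?S" by (rule finite_subset) simp
  \<comment> \<open>The empty set of columns qualifies, so the maximum is attained by some
    \<open>J\<close>.\<close>
  moreover have "card {} \<in> ?S" by (intro CollectI exI[of _ "{}"]) auto
  ultimately have "Max ?S \<in> ?S" by (intro Max_in) auto
  then obtain J where J: "card J = k" "J \<subseteq> {..<m}"
    "\<And>c. (\<forall>i<k. (\<Sum>j\<in>J. G $$ (i, j) * c j) = 0) \<Longrightarrow> (\<forall>j\<in>J. c j = 0)"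
    using rank G unfolding quat_rank_def by auto
  have "finite J" using J(2) by (rule finite_subset) simp
  then obtain e where e: "bij_betw e {0..<k} J" using ex_bij_betw_nat_finite[of J] J(1) by blast
  have e': "bij_betw e {..<k} J" using e by (simp add: lessThan_atLeast0)
  let ?X = "Matrix.mat k k (\<lambda>(i, j). G $$ (i, e j))"
  have XC: "?X \<in> carrier_mat k k" by simp
  have ker: "v = 0\<^sub>v k" if v: "v \<in> carrier_vec k" "?X *\<^sub>v v = 0\<^sub>v k" for v
  proof -
    define c where "c j = v $ (the_inv_into {..<k} e j)" for j
    have ce: "c (e i) = v $ i" if "i < k" for i
      using that e' by (simp add: c_def the_inv_into_f_f bij_betw_imp_inj_on)
    have "(\<Sum>j\<in>J. G $$ (i, j) * c j) = 0" if i: "i < k" for i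
    proof -
      have "(\<Sum>j\<in>J. G $$ (i, j) * c j) = (\<Sum>l<k. G $$ (i, e l) * c (e l))"
        by (rule sum.reindex_bij_betw[OF e', symmetric])
      also have "\<dots> = (?X *\<^sub>v v) $ i"
        using i by (subst mat_mult_vec_index_sum[OF XC v(1) i]) (simp add: ce)
      finally show ?thesis using i v by simp
    qed
    then have "\<forall>j\<in>J. c j = 0" using J(3) by blast
    then have "v $ i = 0" if "i < k" for i
      using ce[OF that] that e' by (metis bij_betwE lessThan_iff)
    then show ?thesis using v(1) by (intro eq_vecI) auto
  qed
  note inv = right_inverse_of_trivial_kernel[OF XC ker]
  have "invertible_mat ?X" by (rule invertible_matI[OF XC inv(4) inv(2,3)])
  moreover have "e j < m" if "j < k" for j
    using that e' J(2) by (meson bij_betwE lessThan_iff subsetD)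
  ultimately show ?thesis by (intro left_independent_columns[OF G]) auto
qed

text \<open>Gram-Schmidt gives \<open>V = K G\<close> with orthonormal rows. Then
  \<open>L = G V*\<close> satisfies \<open>K L = V V* = 1\<close>, hence \<open>L K = 1\<close>, and
  so \<open>L V = L K G = G\<close>.\<close>

lemma lq_decomposition:
  assumes G: "G \<in> carrier_mat p n" and ind: "left_independent G"
  obtains L L' V where "L \<in> carrier_mat p p" "L' \<in> carrier_mat p p" "L * L' = 1\<^sub>m p" "L' * L = 1\<^sub>m p"
    "V \<in> carrier_mat p n" "V * ctranspose V = 1\<^sub>m p" "G = L * V"
proof -
  have "\<forall>i<p. c i = 0" if c: "\<forall>l<n. (\<Sum>i<p. c i * G $$ (i, l)) = 0" for c
  proof -
    let ?x = "Matrix.mat 1 p (\<lambda>(i, j). c j)"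
    have x: "?x \<in> carrier_mat 1 p" by simp
    have "?x * G = 0\<^sub>m 1 n"
    proof (rule eq_matI)
      fix i j assume "i < dim_row (0\<^sub>m 1 n :: quat mat)" "j < dim_col (0\<^sub>m 1 n :: quat mat)"
      then have ij: "i < 1" "j < n" by auto
      have "(?x * G) $$ (i, j) = (\<Sum>l<p. c l * G $$ (l, j))"
        using ij by (subst mat_mult_index_sum[OF x G]) auto
      then show "(?x * G) $$ (i, j) = 0\<^sub>m 1 n $$ (i, j)" using c ij by simp
    qed (use G in auto)
    from left_independentD[OF ind G x this] have "?x $$ (0, i) = 0\<^sub>m 1 p $$ (0, i)" for i by (rule arg_cong)
    note entry = this
    show ?thesis
    proof (intro allI impI)
      fix i assume "i < p"
      then show "c i = 0" using entry[of i] by simp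
    qed
  qed
  then have "\<exists>v K. orthonormal_rows n p v \<and> (\<forall>i<p. \<forall>l. v i l = (\<Sum>j<p. K i j * G $$ (j, l)))"
    by (rule gram_schmidt_rows)
  then obtain v K
    where v: "orthonormal_rows n p v" and K: "\<And>i l. i < p \<Longrightarrow> v i l = (\<Sum>j<p. K i j * G $$ (j, l))" by auto
  define KM where "KM = Matrix.mat p p (\<lambda>(i, j). K i j)"
  have KC: "KM \<in> carrier_mat p p" by (simp add: KM_def)
  define V where "V = KM * G"
  have V: "V \<in> carrier_mat p n" using KC G by (simp add: V_def)
  have "V $$ (i, l) = v i l" if "i < p" "l < n" for i l
    using that unfolding V_def by (subst mat_mult_index_sum[OF KC G]) (auto simp: K KM_def)
  then have "orthonormal_rows n p (\<lambda>i l. V $$ (i, l))"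
    using v by (simp add: orthonormal_rows_def row_inner_def)
  then have VV: "V * ctranspose V = 1\<^sub>m p" by (simp add: orthonormal_rows_mat_iff[OF V])
  have R: "G * ctranspose V \<in> carrier_mat p p" using G V by simp
  have 1: "KM * (G * ctranspose V) = 1\<^sub>m p"
    using VV assoc_mult_mat[OF KC G ctranspose_carrier[OF V]] by (simp add: V_def)
  have 2: "(G * ctranspose V) * KM = 1\<^sub>m p" by (rule quat_mat_left_right_inverse[OF KC R 1])
  have "(G * ctranspose V) * V = (G * ctranspose V) * KM * G"
    unfolding V_def by (rule assoc_mult_mat[symmetric, OF R[unfolded V_def] KC G])
  also have "\<dots> = G" using G by (simp add: 2)
  finally show ?thesis using that[OF R KC 2 1 V VV] by simp
qed

text \<open>Complete the rows of \<open>V\<close> to a square \<open>U\<close>. From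
  \<open>U U* = 1\<close> follows \<open>U* U = 1\<close>, and splitting this sum at row
  \<open>p\<close> reads \<open>V* V + Q Q* = 1\<close>, where the columns of \<open>Q\<close> are
  the conjugates of the added rows.\<close>

lemma orthonormal_mat_complement:
  assumes V: "V \<in> carrier_mat p n" "V * ctranspose V = 1\<^sub>m p" and pn: "p \<le> n"
  obtains Q where "Q \<in> carrier_mat n (n - p)" "ctranspose Q * Q = 1\<^sub>m (n - p)" "V * Q = 0\<^sub>m p (n - p)"
    "Q * ctranspose Q = 1\<^sub>m n - ctranspose V * V"
proof -
  have "orthonormal_rows n p (\<lambda>i l. V $$ (i, l))" using V by (simp add: orthonormal_rows_mat_iff)
  from orthonormal_rows_complete[OF this pn] obtain v where v: "orthonormal_rows n n v"
    "\<And>i. i < p \<Longrightarrow> v i = (\<lambda>l. V $$ (i, l))" by blast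
  define U where "U = Matrix.mat n n (\<lambda>(i, l). v i l)"
  have U: "U \<in> carrier_mat n n" by (simp add: U_def)
  have "orthonormal_rows n n (\<lambda>i l. U $$ (i, l))"
    using v(1) by (simp add: orthonormal_rows_def row_inner_def U_def)
  then have "U * ctranspose U = 1\<^sub>m n" by (simp add: orthonormal_rows_mat_iff[OF U])
  then have UU: "ctranspose U * U = 1\<^sub>m n" by (rule quat_mat_left_right_inverse[OF U ctranspose_carrier[OF U]])
  define Q where "Q = Matrix.mat n (n - p) (\<lambda>(l, i). qcnj (v (p + i) l))"
  have Q: "Q \<in> carrier_mat n (n - p)" by (simp add: Q_def)
  note QC = ctranspose_carrier[OF Q] and VC = ctranspose_carrier[OF V(1)]
  have inner: "row_inner n (v i) (v j) = (if i = j then 1 else 0)" if "i < n" "j < n" for i j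
    using v(1) that by (simp add: orthonormal_rows_def)
  have "ctranspose Q * Q = 1\<^sub>m (n - p)"
  proof (rule eq_matI)
    fix i j assume "i < dim_row (1\<^sub>m (n - p) :: quat mat)" "j < dim_col (1\<^sub>m (n - p) :: quat mat)"
    then have ij: "i < n - p" "j < n - p" by auto
    have "(ctranspose Q * Q) $$ (i, j) = row_inner n (v (p + i)) (v (p + j))"
      using ij Q by (subst mat_mult_index_sum[OF QC Q]) (auto simp: row_inner_def Q_def)
    then show "(ctranspose Q * Q) $$ (i, j) = 1\<^sub>m (n - p) $$ (i, j)" using ij by (simp add: inner)
  qed (use Q in auto)
  moreover have "V * Q = 0\<^sub>m p (n - p)"
  proof (rule eq_matI)
    fix i j assume "i < dim_row (0\<^sub>m p (n - p) :: quat mat)" "j < dim_col (0\<^sub>m p (n - p) :: quat mat)"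
    then have ij: "i < p" "j < n - p" by auto
    have "(V * Q) $$ (i, j) = row_inner n (v i) (v (p + j))"
      using ij by (subst mat_mult_index_sum[OF V(1) Q]) (auto simp: row_inner_def Q_def v(2))
    then show "(V * Q) $$ (i, j) = 0\<^sub>m p (n - p) $$ (i, j)" using ij by (simp add: inner)
  qed (use Q V in auto)
  moreover have "Q * ctranspose Q = 1\<^sub>m n - ctranspose V * V"
  proof (rule eq_matI)
    fix i j assume "i < dim_row (1\<^sub>m n - ctranspose V * V)" "j < dim_col (1\<^sub>m n - ctranspose V * V)"
    with V have ij: "i < n" "j < n" by auto
    have "(if i = j then 1 else 0) = (ctranspose U * U) $$ (i, j)" using ij by (simp add: UU)
    also have "\<dots> = (\<Sum>l<n. qcnj (v l i) * v l j)"
      using ij U by (subst mat_mult_index_sum[OF ctranspose_carrier[OF U] U]) (auto simp: U_def)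
    also have "\<dots> = (\<Sum>l<p. qcnj (v l i) * v l j) + (\<Sum>l=p..<n. qcnj (v l i) * v l j)"
      using pn by (simp add: lessThan_atLeast0 sum.atLeastLessThan_concat)
    also have "(\<Sum>l<p. qcnj (v l i) * v l j) = (ctranspose V * V) $$ (i, j)"
      using ij V by (subst mat_mult_index_sum[OF VC V(1)]) (auto simp: v(2))
    also have "(\<Sum>l=p..<n. qcnj (v l i) * v l j) = (\<Sum>l<n - p. qcnj (v (p + l) i) * v (p + l) j)"
      using sum.shift_bounds_nat_ivl[of "\<lambda>l. qcnj (v l i) * v l j" 0 p "n - p"] pn
      by (simp add: add.commute lessThan_atLeast0)
    also have "\<dots> = (Q * ctranspose Q) $$ (i, j)"
      using ij Q by (subst mat_mult_index_sum[OF Q QC]) (auto simp: Q_def)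
    finally have "(Q * ctranspose Q) $$ (i, j) = (if i = j then 1 else 0) - (ctranspose V * V) $$ (i, j)"
      by (simp add: algebra_simps)
    also have "\<dots> = (1\<^sub>m n - ctranspose V * V) $$ (i, j)"
      using V ij by (subst index_minus_mat) auto
    finally show "(Q * ctranspose Q) $$ (i, j) = (1\<^sub>m n - ctranspose V * V) $$ (i, j)" .
  qed (use Q V in auto)
  ultimately show ?thesis using Q by (intro that[of Q])
qed

section \<open>Orthogonal invariance of standard quaternion normal vectors and matrices\<close>

lemma vec_coords_mult_mat_vec:
  assumes V: "V \<in> carrier_mat k m" and v: "v \<in> carrier_vec m"
  shows "vec_coords k (V *\<^sub>v v) = (\<lambda>a\<in>{..<k} \<times> {..<4}. \<Sum>b\<in>{..<m} \<times> {..<4}.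
    qcoord (snd a) (V $$ (fst a, fst b) * quat_unit (snd b)) * vec_coords m v b)"
proof -
  have "qcoord c ((V *\<^sub>v v) $ i) = (\<Sum>b\<in>{..<m} \<times> {..<4}. qcoord c (V $$ (i, fst b) * quat_unit (snd b)) * vec_coords m v b)"
    if "i < k" "c < 4" for i c
  proof -
    have "qcoord c ((V *\<^sub>v v) $ i) = (\<Sum>l<m. qcoord c (V $$ (i, l) * v $ l))"
      using that by (simp add: mat_mult_vec_index_sum[OF V v] qcoord_sum del: index_mult_mat_vec)
    also have "\<dots> = (\<Sum>l<m. \<Sum>d<4. qcoord c (V $$ (i, l) * quat_unit d) * qcoord d (v $ l))"
      using that by (simp add: qcoord_mult_units)
    also have "\<dots> = (\<Sum>(l, d)\<in>{..<m} \<times> {..<4}. qcoord c (V $$ (i, l) * quat_unit d) * qcoord d (v $ l))"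
      by (rule sum.cartesian_product)
    finally show ?thesis by (auto simp: vec_coords_def intro!: sum.cong)
  qed
  then show ?thesis by (auto simp: vec_coords_def fun_eq_iff restrict_def)
qed

text \<open>In real coordinates \<open>V\<close> consists of 4 x 4 blocks of left multiplications;
  \<open>sum_qcoord_mult_right_units\<close> computes the inner products of its real rows from the
  entries of \<open>V V*\<close>, so the real invariance applies.\<close>

lemma std_quat_normal_mult:
  assumes w: "std_quat_normal P m w" and V: "V \<in> carrier_mat k m" "V * ctranspose V = 1\<^sub>m k"
  shows "std_quat_normal P k (\<lambda>\<omega>. V *\<^sub>v w \<omega>)"
proof -
  have P: "prob_space P" using w by (simp add: std_quat_normal_def)
  note w' = w[unfolded std_quat_normal_iff[OF P]]
  let ?J = "{..<m} \<times> {..<4::nat}" and ?I = "{..<k} \<times> {..<4::nat}"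
  let ?G = "\<lambda>a b. qcoord (snd a) (V $$ (fst a, fst b) * quat_unit (snd b))"
  let ?T = "\<lambda>x. \<lambda>a\<in>?I. \<Sum>b\<in>?J. ?G a b * x b"
  have meas: "(\<lambda>\<omega>. vec_coords m (w \<omega>)) \<in> P \<rightarrow>\<^sub>M borel_PiM ?J"
    using w' by (intro measurable_compose[OF _ measurable_vec_coords]) auto
  have ortho: "(\<Sum>b\<in>?J. ?G a b * ?G a' b) = (if a = a' then 1 else 0)" if a: "a \<in> ?I" "a' \<in> ?I" for a a'
  proof -
    obtain i c i' c' where ac: "a = (i, c)" "a' = (i', c')" "i < k" "c < 4" "i' < k" "c' < 4"
      using a by auto
    have "(\<Sum>b\<in>?J. ?G a b * ?G a' b) = (\<Sum>(l, d)\<in>?J. qcoord c (V $$ (i, l) * quat_unit d) * qcoord c' (V $$ (i', l) * quat_unit d))"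
      by (auto simp: ac intro!: sum.cong)
    also have "\<dots> = (\<Sum>l<m. \<Sum>d<4. qcoord c (V $$ (i, l) * quat_unit d) * qcoord c' (V $$ (i', l) * quat_unit d))"
      by (rule sum.cartesian_product[symmetric])
    also have "\<dots> = (\<Sum>l<m. qcoord c (V $$ (i, l) * qcnj (V $$ (i', l)) * quat_unit c'))"
      using ac by (simp add: sum_qcoord_mult_right_units)
    also have "\<dots> = qcoord c ((\<Sum>l<m. V $$ (i, l) * qcnj (V $$ (i', l))) * quat_unit c')"
      using ac by (simp add: qcoord_sum sum_distrib_right)
    also have "(\<Sum>l<m. V $$ (i, l) * qcnj (V $$ (i', l))) = (V * ctranspose V) $$ (i, i')"
      using ac V by (subst mat_mult_index_sum[OF V(1) ctranspose_carrier[OF V(1)]]) auto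
    finally show ?thesis using ac by (auto simp: V qcoord_quat_unit qcoord_0)
  qed
  have "distr P (borel_PiM ?I) (\<lambda>\<omega>. vec_coords k (V *\<^sub>v w \<omega>)) =
      distr P (borel_PiM ?I) (?T \<circ> (\<lambda>\<omega>. vec_coords m (w \<omega>)))"
    using w' by (intro distr_cong refl)
      (simp add: vec_coords_mult_mat_vec[OF V(1) measurable_vec_carrier[of w P m]])
  also have "\<dots> = distr (distr P (borel_PiM ?J) (\<lambda>\<omega>. vec_coords m (w \<omega>))) (borel_PiM ?I) ?T"
    by (rule distr_distr[OF measurable_linear_map_PiM meas, symmetric])
  also have "\<dots> = normal_PiM ?I"
    unfolding conjunct2[OF w'] by (rule distr_PiM_orthonormal) (use ortho in auto)
  finally show ?thesis
    unfolding std_quat_normal_iff[OF P] using measurable_mult_mat_vec[OF V(1)] w' by auto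
qed

lemma std_quat_normal_cong:
  assumes "std_quat_normal P m w" "\<And>\<omega>. \<omega> \<in> space P \<Longrightarrow> w \<omega> = z \<omega>"
  shows "std_quat_normal P m z"
proof -
  have P: "prob_space P" using assms by (simp add: std_quat_normal_def)
  have "distr P (borel_PiM ({..<m} \<times> {..<4})) (\<lambda>\<omega>. vec_coords m (z \<omega>)) =
     distr P (borel_PiM ({..<m} \<times> {..<4})) (\<lambda>\<omega>. vec_coords m (w \<omega>))"
    using assms(2) by (intro distr_cong) auto
  moreover have "z \<in> P \<rightarrow>\<^sub>M vec_borel m \<longleftrightarrow> w \<in> P \<rightarrow>\<^sub>M vec_borel m"
    using assms(2) by (intro measurable_cong) auto
  ultimately show ?thesis using assms(1) by (simp add: std_quat_normal_iff[OF P])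
qed

lemma indep_cols_mult:
  fixes Z :: "'w \<Rightarrow> quat mat"
  assumes P: "prob_space P" and Z: "Z \<in> P \<rightarrow>\<^sub>M mat_borel m n" and M: "M \<in> carrier_mat k m"
    and indep: "prob_space.indep_vars P (\<lambda>_. vec_borel m) (\<lambda>j \<omega>. col (Z \<omega>) j) {..<n}"
  shows "prob_space.indep_vars P (\<lambda>_. vec_borel k) (\<lambda>j \<omega>. col (M * Z \<omega>) j) {..<n}"
proof -
  interpret prob_space P by fact
  have "indep_vars (\<lambda>_. vec_borel k) (\<lambda>j \<omega>. M *\<^sub>v col (Z \<omega>) j) {..<n}"
    using indep by (rule indep_vars_compose2) (rule measurable_mult_mat_vec[OF M measurable_ident_sets[OF refl]])
  then show ?thesis
    by (rule indep_vars_cong_space) (simp add: col_mult2[OF M measurable_mat_carrier[OF Z]])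
qed

lemma smult_mult_ctranspose:
  fixes B :: "quat mat"
  assumes B: "B \<in> carrier_mat m m" and M: "M \<in> carrier_mat k m"
  shows "M * (4 \<cdot>\<^sub>m (B * ctranspose B)) * ctranspose M = 4 \<cdot>\<^sub>m ((M * B) * ctranspose (M * B))"
proof -
  note [simp] = ctranspose_carrier[OF B] ctranspose_carrier[OF M]
  have BB: "B * ctranspose B \<in> carrier_mat m m" using B by simp
  have MB: "M * B \<in> carrier_mat k m" using M B by simp
  have "M * (4 \<cdot>\<^sub>m (B * ctranspose B)) * ctranspose M = 4 \<cdot>\<^sub>m (M * (B * ctranspose B) * ctranspose M)"
    using M BB by (simp add: four_smult_mult(1)[OF M BB] four_smult_mult(2)[of _ k m _ k])
  also have "M * (B * ctranspose B) = M * B * ctranspose B"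
    by (rule assoc_mult_mat[OF M B ctranspose_carrier[OF B], symmetric])
  also have "M * B * ctranspose B * ctranspose M = M * B * (ctranspose B * ctranspose M)"
    by (rule assoc_mult_mat[OF MB ctranspose_carrier[OF B] ctranspose_carrier[OF M]])
  also have "ctranspose B * ctranspose M = ctranspose (M * B)"
    by (rule ctranspose_mult[OF M B, symmetric])
  finally show ?thesis .
qed

lemma mult_orthonormal_ctranspose:
  assumes L: "L \<in> carrier_mat k k" and V: "V \<in> carrier_mat k m" "V * ctranspose V = 1\<^sub>m k"
  shows "(L * V) * ctranspose (L * V) = L * ctranspose L"
proof -
  note VC = ctranspose_carrier[OF V(1)] and LC = ctranspose_carrier[OF L]
  have "(L * V) * ctranspose (L * V) = L * V * (ctranspose V * ctranspose L)"
    by (simp add: ctranspose_mult[OF L V(1)])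
  also have "\<dots> = L * (V * (ctranspose V * ctranspose L))"
    using L V VC LC by (intro assoc_mult_mat) auto
  also have "V * (ctranspose V * ctranspose L) = V * ctranspose V * ctranspose L"
    by (rule assoc_mult_mat[OF V(1) VC LC, symmetric])
  also have "\<dots> = ctranspose L" using left_mult_one_mat[OF LC] by (simp only: V(2))
  finally show ?thesis .
qed

section \<open>Congruence transformations of Wishart matrices\<close>

text \<open>Columns may come with different factors \<open>B\<close>, so the argument goes column by
  column: in \<open>M B = L V\<close> the factor \<open>V\<close> is absorbed into the standard
  vector, which leaves the square invertible \<open>L\<close>, and \<open>4 L L*\<close> is the
  transformed covariance whichever column is taken.\<close>

lemma quat_wishart_congruence:
  assumes W: "quat_wishart P m n S A" and M: "M \<in> carrier_mat k m" "left_independent M"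
  shows "quat_wishart P k n (M * S * ctranspose M) (\<lambda>\<omega>. M * A \<omega> * ctranspose M)"
proof -
  let ?f = "\<lambda>X. M * X * ctranspose M"
  note MC = ctranspose_carrier[OF M(1)]
  from W obtain Q :: "quat mat measure" and Z where P: "prob_space P" and A: "A \<in> P \<rightarrow>\<^sub>M mat_borel m m"
    and Z: "quat_normal_sample Q m n S Z"
    and law: "distr P (mat_borel m m) A = distr Q (mat_borel m m) (\<lambda>\<omega>. Z \<omega> * ctranspose (Z \<omega>))"
    unfolding quat_wishart_def by blast
  have Q: "prob_space Q" and Zm: "Z \<in> Q \<rightarrow>\<^sub>M mat_borel m n"
    and indep: "prob_space.indep_vars Q (\<lambda>_. vec_borel m) (\<lambda>j \<omega>. col (Z \<omega>) j) {..<n}"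
    and normal: "\<And>j. j < n \<Longrightarrow> quat_normal Q m S (\<lambda>\<omega>. col (Z \<omega>) j)"
    using Z unfolding quat_normal_sample_def by auto
  have f: "?f \<in> mat_borel m m \<rightarrow>\<^sub>M mat_borel k k"
    by (intro measurable_mat_mult[OF measurable_mat_mult[OF measurable_mat_const[OF M(1)]] measurable_mat_const[OF MC]]
        measurable_ident_sets refl)
  have MZ: "(\<lambda>\<omega>. M * Z \<omega>) \<in> Q \<rightarrow>\<^sub>M mat_borel k n"
    by (rule measurable_mat_mult[OF measurable_mat_const[OF M(1)] Zm])
  have ZZ: "(\<lambda>\<omega>. Z \<omega> * ctranspose (Z \<omega>)) \<in> Q \<rightarrow>\<^sub>M mat_borel m m"
    by (rule measurable_mat_mult[OF Zm measurable_ctranspose[OF Zm]])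
  have "quat_normal Q k (M * S * ctranspose M) (\<lambda>\<omega>. col (M * Z \<omega>) j)" if j: "j < n" for j
  proof -
    from normal[OF j] obtain B w where B: "B \<in> carrier_mat m m" "invertible_mat B"
      and S: "S = 4 \<cdot>\<^sub>m (B * ctranspose B)" and w: "std_quat_normal Q m w"
      and z: "\<And>\<omega>. \<omega> \<in> space Q \<Longrightarrow> col (Z \<omega>) j = B *\<^sub>v w \<omega>"
      unfolding quat_normal_def by blast
    obtain B' where B': "B' \<in> carrier_mat m m" "B * B' = 1\<^sub>m m" using B(2,1) by (rule invertible_matE)
    have MB: "M * B \<in> carrier_mat k m" using M B by simp
    obtain L L' V where L: "L \<in> carrier_mat k k" "L' \<in> carrier_mat k k" "L * L' = 1\<^sub>m k" "L' * L = 1\<^sub>m k"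
      and V: "V \<in> carrier_mat k m" "V * ctranspose V = 1\<^sub>m k" and MBLV: "M * B = L * V"
      by (rule lq_decomposition[OF MB left_independent_mult[OF M(2,1) B(1) B']])
    have "M * S * ctranspose M = 4 \<cdot>\<^sub>m (L * ctranspose L)"
      unfolding S smult_mult_ctranspose[OF B(1) M(1)] MBLV mult_orthonormal_ctranspose[OF L(1) V] ..
    moreover have "col (M * Z \<omega>) j = L *\<^sub>v (V *\<^sub>v w \<omega>)" if "\<omega> \<in> space Q" for \<omega>
    proof -
      have wC: "w \<omega> \<in> carrier_vec m"
        using w that measurable_vec_carrier[of w Q m] by (simp add: std_quat_normal_def)
      have "col (M * Z \<omega>) j = M *\<^sub>v (B *\<^sub>v w \<omega>)"
        using col_mult2[OF M(1) measurable_mat_carrier[OF Zm that] j] z[OF that] by simp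
      also have "\<dots> = L * V *\<^sub>v w \<omega>"
        using assoc_mult_mat_vec[OF M(1) B(1) wC] by (simp add: MBLV)
      also have "\<dots> = L *\<^sub>v (V *\<^sub>v w \<omega>)"
        by (rule assoc_mult_mat_vec[OF L(1) V(1) wC])
      finally show ?thesis .
    qed
    moreover have "invertible_mat L" by (rule invertible_matI[OF L])
    ultimately show ?thesis
      unfolding quat_normal_def using L(1) std_quat_normal_mult[OF w V] by blast
  qed
  then have "quat_normal_sample Q k n (M * S * ctranspose M) (\<lambda>\<omega>. M * Z \<omega>)"
    unfolding quat_normal_sample_def using Q MZ indep_cols_mult[OF Q Zm M(1) indep] by blast
  moreover have "distr P (mat_borel k k) (\<lambda>\<omega>. M * A \<omega> * ctranspose M) =
      distr Q (mat_borel k k) (\<lambda>\<omega>. (M * Z \<omega>) * ctranspose (M * Z \<omega>))"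
  proof -
    have "distr P (mat_borel k k) (?f \<circ> A) = distr (distr P (mat_borel m m) A) (mat_borel k k) ?f"
      by (rule distr_distr[OF f A, symmetric])
    also have "\<dots> = distr Q (mat_borel k k) (?f \<circ> (\<lambda>\<omega>. Z \<omega> * ctranspose (Z \<omega>)))"
      unfolding law by (rule distr_distr[OF f ZZ])
    also have "\<dots> = distr Q (mat_borel k k) (\<lambda>\<omega>. (M * Z \<omega>) * ctranspose (M * Z \<omega>))"
    proof (intro distr_cong refl)
      fix \<omega> assume "\<omega> \<in> space Q"
      then have ZC: "Z \<omega> \<in> carrier_mat m n" by (rule measurable_mat_carrier[OF Zm])
      note ZC' = ctranspose_carrier[OF ZC]
      have MZC: "M * Z \<omega> \<in> carrier_mat k n" using M ZC by simp
      have "M * (Z \<omega> * ctranspose (Z \<omega>)) * ctranspose M = M * Z \<omega> * ctranspose (Z \<omega>) * ctranspose M"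
        by (simp only: assoc_mult_mat[OF M(1) ZC ZC'])
      also have "\<dots> = M * Z \<omega> * (ctranspose (Z \<omega>) * ctranspose M)"
        by (rule assoc_mult_mat[OF MZC ZC' MC])
      finally show "(?f \<circ> (\<lambda>\<omega>. Z \<omega> * ctranspose (Z \<omega>))) \<omega> = (M * Z \<omega>) * ctranspose (M * Z \<omega>)"
        by (simp only: o_def ctranspose_mult[OF M(1) ZC])
    qed
    finally show ?thesis by (simp only: o_def)
  qed
  moreover have "(\<lambda>\<omega>. M * A \<omega> * ctranspose M) \<in> P \<rightarrow>\<^sub>M mat_borel k k"
    by (rule measurable_compose[OF A f])
  ultimately show ?thesis
    unfolding quat_wishart_def using P by blast
qed

section \<open>The Schur complement of a Gram matrix\<close>

definition top_rows :: "nat \<Rightarrow> 'a mat \<Rightarrow> 'a mat"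
  where "top_rows k A = Matrix.mat k (dim_col A) (\<lambda>(i, j). A $$ (i, j))"

definition bottom_rows :: "nat \<Rightarrow> 'a mat \<Rightarrow> 'a mat"
  where "bottom_rows k A = Matrix.mat (dim_row A - k) (dim_col A) (\<lambda>(i, j). A $$ (k + i, j))"

lemma top_rows_carrier [simp]: "A \<in> carrier_mat m n \<Longrightarrow> top_rows k A \<in> carrier_mat k n"
  by (simp add: top_rows_def)

lemma bottom_rows_carrier [simp]: "A \<in> carrier_mat (k + p) n \<Longrightarrow> bottom_rows k A \<in> carrier_mat p n"
  by (simp add: bottom_rows_def)

definition schur :: "nat \<Rightarrow> quat mat \<Rightarrow> quat mat"
  where "schur k A = (case split_block A k k of (A11, A12, A21, A22) \<Rightarrow> A11 - A12 * inv_mat A22 * ctranspose A12)"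

lemma sum_lessThan_add: "(\<Sum>l<k + p. f l) = (\<Sum>l<k. f l) + (\<Sum>l<p. f (k + l))"
  for f :: "nat \<Rightarrow> 'a::comm_monoid_add"
  by (induction p) (auto simp: add.assoc)

lemma four_block_upper_mult:
  fixes W :: "quat mat"
  assumes C: "C \<in> carrier_mat k k" and H: "H \<in> carrier_mat k p" and D: "D \<in> carrier_mat p p"
    and W: "W \<in> carrier_mat (k + p) n"
  shows "top_rows k (four_block_mat C H (0\<^sub>m p k) D * W) = C * top_rows k W + H * bottom_rows k W"
    and "bottom_rows k (four_block_mat C H (0\<^sub>m p k) D * W) = D * bottom_rows k W"
proof -
  let ?B = "four_block_mat C H (0\<^sub>m p k) D"
  have B: "?B \<in> carrier_mat (k + p) (k + p)" using C H D by auto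
  have BW: "?B * W \<in> carrier_mat (k + p) n" using B W by (rule mult_carrier_mat)
  note T = top_rows_carrier[OF W, of k] and Bo = bottom_rows_carrier[OF W]
  have entry: "(?B * W) $$ (i, j) = (\<Sum>l<k. ?B $$ (i, l) * W $$ (l, j)) + (\<Sum>l<p. ?B $$ (i, k + l) * W $$ (k + l, j))"
    if "i < k + p" "j < n" for i j
    using that by (simp only: mat_mult_index_sum[OF B W] sum_lessThan_add)
  show "top_rows k (?B * W) = C * top_rows k W + H * bottom_rows k W"
  proof (rule eq_matI)
    fix i j assume "i < dim_row (C * top_rows k W + H * bottom_rows k W)"
      "j < dim_col (C * top_rows k W + H * bottom_rows k W)"
    with H W have ij: "i < k" "j < n" by (auto simp: bottom_rows_def)
    have "top_rows k (?B * W) $$ (i, j) = (?B * W) $$ (i, j)"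
      using ij BW by (auto simp: top_rows_def simp del: index_mult_mat(1))
    also have "\<dots> = (\<Sum>l<k. C $$ (i, l) * top_rows k W $$ (l, j)) + (\<Sum>l<p. H $$ (i, l) * bottom_rows k W $$ (l, j))"
      using ij C H D W by (subst entry) (auto simp: top_rows_def bottom_rows_def intro!: arg_cong2[where f="(+)"] sum.cong)
    also have "\<dots> = (C * top_rows k W) $$ (i, j) + (H * bottom_rows k W) $$ (i, j)"
      using ij by (simp only: mat_mult_index_sum[OF C T] mat_mult_index_sum[OF H Bo])
    also have "\<dots> = (C * top_rows k W + H * bottom_rows k W) $$ (i, j)"
      using ij C H T Bo by (subst index_add_mat) auto
    finally show "top_rows k (?B * W) $$ (i, j) = (C * top_rows k W + H * bottom_rows k W) $$ (i, j)" .
  qed (use C H W in \<open>auto simp: top_rows_def bottom_rows_def\<close>)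
  show "bottom_rows k (?B * W) = D * bottom_rows k W"
  proof (rule eq_matI)
    fix i j assume "i < dim_row (D * bottom_rows k W)" "j < dim_col (D * bottom_rows k W)"
    with D W have ij: "i < p" "j < n" by (auto simp: bottom_rows_def)
    have "bottom_rows k (?B * W) $$ (i, j) = (?B * W) $$ (k + i, j)"
      using ij C D W by (auto simp: bottom_rows_def simp del: index_mult_mat(1))
    also have "\<dots> = (\<Sum>l<p. D $$ (i, l) * bottom_rows k W $$ (l, j))"
      using ij C H D W by (subst entry) (auto simp: bottom_rows_def intro!: sum.cong)
    also have "\<dots> = (D * bottom_rows k W) $$ (i, j)"
      using ij by (simp only: mat_mult_index_sum[OF D Bo])
    finally show "bottom_rows k (?B * W) $$ (i, j) = (D * bottom_rows k W) $$ (i, j)" .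
  qed (use C D W in \<open>auto simp: bottom_rows_def\<close>)
qed

lemma schur_gram:
  assumes Z: "Z \<in> carrier_mat (k + p) n"
  shows "schur k (Z * ctranspose Z) =
    top_rows k Z * ctranspose (top_rows k Z) -
    top_rows k Z * ctranspose (bottom_rows k Z) * inv_mat (bottom_rows k Z * ctranspose (bottom_rows k Z)) *
      ctranspose (top_rows k Z * ctranspose (bottom_rows k Z))"
proof -
  let ?T = "top_rows k Z" and ?B = "bottom_rows k Z" and ?A = "Z * ctranspose Z"
  note ZC = ctranspose_carrier[OF Z]
  have T: "?T \<in> carrier_mat k n" and B: "?B \<in> carrier_mat p n" using Z by auto
  note TC = ctranspose_carrier[OF T] and BC = ctranspose_carrier[OF B]
  have A: "?A $$ (i, j) = (\<Sum>l<n. Z $$ (i, l) * qcnj (Z $$ (j, l)))" if "i < k + p" "j < k + p" for i j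
    using that Z by (subst mat_mult_index_sum[OF Z ZC]) auto
  have dim: "dim_row ?A = k + p" "dim_col ?A = k + p" using Z by auto
  have 1: "Matrix.mat k k (\<lambda>ij. ?A $$ ij) = ?T * ctranspose ?T"
  proof (rule eq_matI)
    fix i j assume "i < dim_row (?T * ctranspose ?T)" "j < dim_col (?T * ctranspose ?T)"
    with T have ij: "i < k" "j < k" by auto
    have "(?T * ctranspose ?T) $$ (i, j) = (\<Sum>l<n. Z $$ (i, l) * qcnj (Z $$ (j, l)))"
      using ij T Z by (subst mat_mult_index_sum[OF T TC]) (auto simp: top_rows_def)
    then show "Matrix.mat k k (\<lambda>ij. ?A $$ ij) $$ (i, j) = (?T * ctranspose ?T) $$ (i, j)"
      using ij by (simp add: A del: index_mult_mat(1))
  qed (use T in auto)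
  have 2: "Matrix.mat k p (\<lambda>(i, j). ?A $$ (i, j + k)) = ?T * ctranspose ?B"
  proof (rule eq_matI)
    fix i j assume "i < dim_row (?T * ctranspose ?B)" "j < dim_col (?T * ctranspose ?B)"
    with T B have ij: "i < k" "j < p" by auto
    have "(?T * ctranspose ?B) $$ (i, j) = (\<Sum>l<n. Z $$ (i, l) * qcnj (Z $$ (j + k, l)))"
      using ij T B Z by (subst mat_mult_index_sum[OF T BC]) (auto simp: top_rows_def bottom_rows_def add.commute)
    then show "Matrix.mat k p (\<lambda>(i, j). ?A $$ (i, j + k)) $$ (i, j) = (?T * ctranspose ?B) $$ (i, j)"
      using ij by (simp add: A del: index_mult_mat(1))
  qed (use T B in auto)
  have 3: "Matrix.mat p p (\<lambda>(i, j). ?A $$ (i + k, j + k)) = ?B * ctranspose ?B"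
  proof (rule eq_matI)
    fix i j assume "i < dim_row (?B * ctranspose ?B)" "j < dim_col (?B * ctranspose ?B)"
    with B have ij: "i < p" "j < p" by auto
    have "(?B * ctranspose ?B) $$ (i, j) = (\<Sum>l<n. Z $$ (i + k, l) * qcnj (Z $$ (j + k, l)))"
      using ij B Z by (subst mat_mult_index_sum[OF B BC]) (auto simp: bottom_rows_def add.commute)
    then show "Matrix.mat p p (\<lambda>(i, j). ?A $$ (i + k, j + k)) $$ (i, j) = (?B * ctranspose ?B) $$ (i, j)"
      using ij by (simp add: A del: index_mult_mat(1))
  qed (use B in auto)
  show ?thesis
    unfolding schur_def split_block_def Let_def dim by (simp only: add_diff_cancel_left' prod.case 1 2 3)
qed

text \<open>With \<open>R V\<close> as lower rows, the inverse of \<open>R R*\<close> cancels both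
  outer factors \<open>R\<close>. What remains is \<open>Z Z* - Z V* V Z* = Z Q Q* Z*\<close>, the
  projection off the row space of the lower block.\<close>

lemma gram_projection:
  assumes Z: "Z \<in> carrier_mat k n" and R: "R \<in> carrier_mat p p" "R' \<in> carrier_mat p p" "R * R' = 1\<^sub>m p" "R' * R = 1\<^sub>m p"
    and V: "V \<in> carrier_mat p n" "V * ctranspose V = 1\<^sub>m p"
    and Q: "Q \<in> carrier_mat n q" "Q * ctranspose Q = 1\<^sub>m n - ctranspose V * V"
  shows "Z * ctranspose Z - Z * ctranspose (R * V) * inv_mat ((R * V) * ctranspose (R * V)) *
      ctranspose (Z * ctranspose (R * V)) = (Z * Q) * ctranspose (Z * Q)"
proof -
  note RC = ctranspose_carrier[OF R(1)] and RC' = ctranspose_carrier[OF R(2)]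
    and VC = ctranspose_carrier[OF V(1)] and ZC = ctranspose_carrier[OF Z] and QC = ctranspose_carrier[OF Q(1)]
  have RV: "R * V \<in> carrier_mat p n" using R V by simp
  have RR: "ctranspose R * ctranspose R' = 1\<^sub>m p"
    unfolding ctranspose_mult[OF R(2,1), symmetric] R(4) by simp
  have gram: "R * V * ctranspose (R * V) = R * ctranspose R"
    by (rule mult_orthonormal_ctranspose[OF R(1) V])
  have inv: "inv_mat (R * ctranspose R) = ctranspose R' * R'"
  proof (rule inv_mat_eqI)
    show "R * ctranspose R \<in> carrier_mat p p" "ctranspose R' * R' \<in> carrier_mat p p"
      using R RC RC' by auto
    have "R * ctranspose R * (ctranspose R' * R') = R * (ctranspose R * (ctranspose R' * R'))"
      using R RC RC' by (intro assoc_mult_mat) auto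
    also have "ctranspose R * (ctranspose R' * R') = ctranspose R * ctranspose R' * R'"
      by (rule assoc_mult_mat[OF RC RC' R(2), symmetric])
    also have "R * \<dots> = 1\<^sub>m p" using R by (simp add: RR)
    finally show "R * ctranspose R * (ctranspose R' * R') = 1\<^sub>m p" .
    then show "ctranspose R' * R' * (R * ctranspose R) = 1\<^sub>m p"
      by (rule quat_mat_left_right_inverse[rotated 2]) (use R RC RC' in auto)
  qed
  have ZVR: "Z * ctranspose (R * V) = Z * ctranspose V * ctranspose R"
    unfolding ctranspose_mult[OF R(1) V(1)] by (rule assoc_mult_mat[OF Z VC RC, symmetric])
  have ZV: "Z * ctranspose V \<in> carrier_mat k p" and VZ: "V * ctranspose Z \<in> carrier_mat p k"
    using Z VC V ZC by auto
  have RVZ: "ctranspose (Z * ctranspose V * ctranspose R) = R * (V * ctranspose Z)"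
    using ctranspose_mult[OF ZV RC] ctranspose_mult[OF Z VC] by simp
  have "Z * ctranspose V * ctranspose R * (ctranspose R' * R') * (R * (V * ctranspose Z)) =
      Z * ctranspose V * V * ctranspose Z"
  proof -
    have "Z * ctranspose V * ctranspose R * (ctranspose R' * R') = Z * ctranspose V * (ctranspose R * (ctranspose R' * R'))"
      using ZV RC RC' R by (intro assoc_mult_mat) auto
    also have "ctranspose R * (ctranspose R' * R') = ctranspose R * ctranspose R' * R'"
      by (rule assoc_mult_mat[OF RC RC' R(2), symmetric])
    also have "\<dots> = R'" using R by (simp add: RR)
    finally have "Z * ctranspose V * ctranspose R * (ctranspose R' * R') * (R * (V * ctranspose Z)) =
       Z * ctranspose V * R' * (R * (V * ctranspose Z))" by simp
    also have "\<dots> = Z * ctranspose V * (R' * (R * (V * ctranspose Z)))"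
      using ZV R VZ by (intro assoc_mult_mat) auto
    also have "R' * (R * (V * ctranspose Z)) = R' * R * (V * ctranspose Z)"
      by (rule assoc_mult_mat[OF R(2,1) VZ, symmetric])
    also have "\<dots> = V * ctranspose Z" unfolding R(4) by (rule left_mult_one_mat[OF VZ])
    also have "Z * ctranspose V * (V * ctranspose Z) = Z * ctranspose V * V * ctranspose Z"
      by (rule assoc_mult_mat[OF ZV V(1) ZC, symmetric])
    finally show ?thesis .
  qed
  then have "Z * ctranspose Z - Z * ctranspose (R * V) * inv_mat ((R * V) * ctranspose (R * V)) *
      ctranspose (Z * ctranspose (R * V)) = Z * ctranspose Z - Z * ctranspose V * V * ctranspose Z"
    unfolding gram inv ZVR RVZ by (rule arg_cong)
  also have "\<dots> = (Z - Z * ctranspose V * V) * ctranspose Z"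
    using Z ZV V ZC by (intro minus_mult_distrib_mat[symmetric]) auto
  also have "Z - Z * ctranspose V * V = Z * 1\<^sub>m n - Z * (ctranspose V * V)"
    using Z by (simp add: assoc_mult_mat[OF Z VC V(1)])
  also have "\<dots> = Z * (1\<^sub>m n - ctranspose V * V)"
    using Z VC V by (intro mult_minus_distrib_mat[symmetric]) auto
  also have "\<dots> * ctranspose Z = Z * Q * ctranspose Q * ctranspose Z"
    by (simp only: Q(2)[symmetric] assoc_mult_mat[OF Z Q(1) QC])
  also have "\<dots> = Z * Q * (ctranspose Q * ctranspose Z)"
    using Z Q QC ZC by (intro assoc_mult_mat) auto
  finally show ?thesis by (simp only: ctranspose_mult[OF Z Q(1)])
qed

text \<open>The order of quantifiers matters: \<open>Q\<close> is obtained from the lower rows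
  \<open>W2\<close> alone and then serves every \<open>W\<close> with these lower rows. This is what
  conditioning on \<open>W2\<close> requires.\<close>

lemma schur_upper_triangular:
  assumes C: "C \<in> carrier_mat k k" and H: "H \<in> carrier_mat k p"
    and D: "D \<in> carrier_mat p p" "D' \<in> carrier_mat p p" "D * D' = 1\<^sub>m p"
    and W2: "W2 \<in> carrier_mat p n" "left_independent W2" and pn: "p \<le> n"
  obtains Q where "Q \<in> carrier_mat n (n - p)" "ctranspose Q * Q = 1\<^sub>m (n - p)"
    "\<And>W. W \<in> carrier_mat (k + p) n \<Longrightarrow> bottom_rows k W = W2 \<Longrightarrow>
      schur k (four_block_mat C H (0\<^sub>m p k) D * W * ctranspose (four_block_mat C H (0\<^sub>m p k) D * W)) =
      C * (top_rows k W * Q) * ctranspose (C * (top_rows k W * Q))"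
proof -
  have D'D: "D' * D = 1\<^sub>m p" by (rule quat_mat_left_right_inverse[OF D])
  have DW: "D * W2 \<in> carrier_mat p n" using D W2 by simp
  obtain R R' V where R: "R \<in> carrier_mat p p" "R' \<in> carrier_mat p p" "R * R' = 1\<^sub>m p" "R' * R = 1\<^sub>m p"
    and V: "V \<in> carrier_mat p n" "V * ctranspose V = 1\<^sub>m p" and DWRV: "D * W2 = R * V"
    by (rule lq_decomposition[OF DW left_independent_mult_left[OF W2(2,1) D]])
  obtain Q where Q: "Q \<in> carrier_mat n (n - p)" "ctranspose Q * Q = 1\<^sub>m (n - p)" "V * Q = 0\<^sub>m p (n - p)"
    "Q * ctranspose Q = 1\<^sub>m n - ctranspose V * V"
    by (rule orthonormal_mat_complement[OF V pn])
  \<comment> \<open>\<open>W2 = D' R V\<close> has its rows in the row space of \<open>V\<close>, so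
    \<open>Q\<close> annihilates it. Hence the corner block \<open>H\<close> drops out of the Schur
    complement.\<close>
  have W2Q: "W2 * Q = 0\<^sub>m p (n - p)"
  proof -
    have "W2 = D' * D * W2" using W2 by (simp add: D'D)
    also have "\<dots> = D' * (R * V)" by (simp only: assoc_mult_mat[OF D(2,1) W2(1)] DWRV)
    also have "\<dots> = D' * R * V" by (rule assoc_mult_mat[OF D(2) R(1) V(1), symmetric])
    also have "\<dots> * Q = D' * R * (V * Q)" using D R V Q by (intro assoc_mult_mat) auto
    finally show ?thesis using D R by (simp add: Q)
  qed
  have "schur k (four_block_mat C H (0\<^sub>m p k) D * W * ctranspose (four_block_mat C H (0\<^sub>m p k) D * W)) =
      C * (top_rows k W * Q) * ctranspose (C * (top_rows k W * Q))"
    if W: "W \<in> carrier_mat (k + p) n" and bot: "bottom_rows k W = W2" for W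
  proof -
    let ?B = "four_block_mat C H (0\<^sub>m p k) D"
    have B: "?B \<in> carrier_mat (k + p) (k + p)" using C H D by auto
    have BW: "?B * W \<in> carrier_mat (k + p) n" using B W by (rule mult_carrier_mat)
    have T: "top_rows k W \<in> carrier_mat k n" using W by simp
    have top: "top_rows k (?B * W) = C * top_rows k W + H * W2"
      using four_block_upper_mult(1)[OF C H D(1) W] by (simp add: bot)
    have "schur k (?B * W * ctranspose (?B * W)) = (top_rows k (?B * W) * Q) * ctranspose (top_rows k (?B * W) * Q)"
      unfolding schur_gram[OF BW] four_block_upper_mult(2)[OF C H D(1) W] bot DWRV
      by (rule gram_projection[OF top_rows_carrier[OF BW] R V Q(1,4)])
    moreover have "top_rows k (?B * W) * Q = C * (top_rows k W * Q)"
    proof -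
      have "top_rows k (?B * W) * Q = C * top_rows k W * Q + H * W2 * Q"
        unfolding top using C T H W2 Q by (intro add_mult_distrib_mat) auto
      also have "C * top_rows k W * Q = C * (top_rows k W * Q)"
        by (rule assoc_mult_mat[OF C T Q(1)])
      also have "H * W2 * Q = H * (W2 * Q)"
        by (rule assoc_mult_mat[OF H W2(1) Q(1)])
      also have "\<dots> = 0\<^sub>m k (n - p)" using H by (simp add: W2Q)
      also have "C * (top_rows k W * Q) + 0\<^sub>m k (n - p) = C * (top_rows k W * Q)"
        using C T Q by (intro right_add_zero_mat) auto
      finally show ?thesis .
    qed
    ultimately show ?thesis by simp
  qed
  with Q show ?thesis by (intro that[of Q])
qed

section \<open>Almost sure invertibility of a square block\<close>

lemma qcoord_of_real_mult: "qcoord c (of_real r * x) = r * qcoord c x" if "c < 4"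
  using that by (auto simp: less_4_cases of_real_def)

text \<open>A singular shift by \<open>t\<close> makes \<open>- t\<close> an eigenvalue of the real
  representation, whose characteristic polynomial is monic and so has finitely many roots.\<close>

lemma finite_singular_shifts:
  assumes X: "X \<in> carrier_mat p p"
  shows "finite {t::real. real_rep_det (X + of_real t \<cdot>\<^sub>m 1\<^sub>m p) = 0}"
proof -
  have RX: "real_rep X \<in> carrier_mat (4 * p) (4 * p)" using X by simp
  have "char_poly (real_rep X) \<noteq> 0"
    using degree_monic_char_poly[OF RX] by auto
  then have "finite {s. eigenvalue (real_rep X) s}"
    unfolding eigenvalue_root_char_poly[OF RX] by (rule poly_roots_finite)
  moreover have "{t. real_rep_det (X + of_real t \<cdot>\<^sub>m 1\<^sub>m p) = 0} \<subseteq> uminus ` {s. eigenvalue (real_rep X) s}"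
  proof
    fix t :: real
    have I: "of_real t \<cdot>\<^sub>m 1\<^sub>m p \<in> carrier_mat p p" for t :: real by simp
    assume "t \<in> {t. real_rep_det (X + of_real t \<cdot>\<^sub>m 1\<^sub>m p) = 0}"
    then obtain v where v: "v \<in> carrier_vec p" "v \<noteq> 0\<^sub>v p" "(X + of_real t \<cdot>\<^sub>m 1\<^sub>m p) *\<^sub>v v = 0\<^sub>v p"
      using det_real_rep_eq_0_iff[OF add_carrier_mat[OF I, of X]] by auto
    have "(of_real t \<cdot>\<^sub>m 1\<^sub>m p) *\<^sub>v v = of_real t \<cdot>\<^sub>v v"
    proof (rule eq_vecI)
      fix i assume "i < dim_vec (of_real t \<cdot>\<^sub>v v)"
      with v(1) have i: "i < p" by simp
      have "((of_real t \<cdot>\<^sub>m 1\<^sub>m p) *\<^sub>v v) $ i = (\<Sum>l<p. if l = i then of_real t * v $ l else 0)"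
        unfolding mat_mult_vec_index_sum[OF I v(1) i] using i by (intro sum.cong) auto
      then show "((of_real t \<cdot>\<^sub>m 1\<^sub>m p) *\<^sub>v v) $ i = (of_real t \<cdot>\<^sub>v v) $ i"
        using i v(1) by simp
    qed (use v(1) in simp)
    then have "X *\<^sub>v v + of_real t \<cdot>\<^sub>v v = 0\<^sub>v p"
      using v(3) add_mult_distrib_mat_vec[OF X I v(1), of t] by simp
    then have "(X *\<^sub>v v) $ i + of_real t * v $ i = 0" if "i < p" for i
      using that X v(1) by (metis carrier_vecD index_add_vec(1) index_smult_vec(1) index_smult_vec(2) index_zero_vec(1))
    then have Xv: "(X *\<^sub>v v) $ i = of_real (- t) * v $ i" if "i < p" for i
      using that by (simp add: eq_neg_iff_add_eq_0)
    have "real_rep X *\<^sub>v real_vec v = real_vec (X *\<^sub>v v)"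
      by (rule real_rep_mult_vec[OF X v(1)])
    also have "\<dots> = (- t) \<cdot>\<^sub>v real_vec v"
    proof (rule eq_vecI)
      fix r assume "r < dim_vec ((- t) \<cdot>\<^sub>v real_vec v)"
      then have r: "r < 4 * p" using v(1) by (simp add: real_vec_def)
      then have r': "r div 4 < p" by auto
      then show "real_vec (X *\<^sub>v v) $ r = ((- t) \<cdot>\<^sub>v real_vec v) $ r"
        using r X v(1) Xv[OF r'] qcoord_of_real_mult[of "r mod 4" "- t" "v $ (r div 4)"]
        by (simp add: real_vec_def del: index_mult_mat_vec)
    qed (use X v(1) in \<open>simp add: real_vec_def\<close>)
    finally have "eigenvector (real_rep X) (real_vec v) (- t)"
      using RX v quat_vec_real_vec[of v] unfolding eigenvector_def by auto
    then show "t \<in> uminus ` {s. eigenvalue (real_rep X) s}"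
      unfolding eigenvalue_def by (intro image_eqI[of _ _ "- t"]) auto
  qed
  ultimately show ?thesis by (rule finite_subset[OF _ finite_imageI, rotated])
qed

lemma emeasure_normal_measure_finite:
  assumes "finite F"
  shows "emeasure normal_measure F = 0"
proof -
  have "F \<in> null_sets lborel" by (rule finite_imp_null_set_lborel[OF assms])
  then have "AE x in lborel. x \<notin> F" by (rule AE_not_in)
  then have "AE x in normal_measure. x \<notin> F" by (auto simp: AE_density)
  moreover have "F \<in> sets normal_measure" using assms by (simp add: finite_imp_closed borel_closed)
  ultimately show ?thesis by (subst AE_iff_measurable[symmetric]) auto
qed

text \<open>The row offset \<open>k\<close> lets the lower rows of a larger matrix keep their own
  coordinate numbers, so that the lower block lives on a subset of the coordinates of the whole
  matrix.\<close>

definition block_of_coords :: "nat \<Rightarrow> nat \<Rightarrow> nat \<Rightarrow> ((nat \<times> nat) \<times> nat \<Rightarrow> real) \<Rightarrow> quat mat"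
  where "block_of_coords k p n x = Matrix.mat p n (\<lambda>(i, j). quat_of_coords (\<lambda>c. x ((k + i, c), j)))"

lemma block_of_coords_carrier [simp]: "block_of_coords k p n x \<in> carrier_mat p n"
  by (simp add: block_of_coords_def)

lemma measurable_block_of_coords:
  assumes "\<And>i c j. i < p \<Longrightarrow> c < 4 \<Longrightarrow> j < n \<Longrightarrow> ((k + i, c), j) \<in> J"
  shows "block_of_coords k p n \<in> borel_PiM J \<rightarrow>\<^sub>M mat_borel p n"
proof (rule measurable_mat_borelI)
  fix i j assume ij: "i < p" "j < n"
  have "(\<lambda>x. quat_of_coords (\<lambda>c. x ((k + i, c), j))) \<in> borel_measurable (borel_PiM J)"
    by (rule measurable_quat_of_coords, rule measurable_component_singleton) (use assms ij in auto)
  then show "(\<lambda>x. block_of_coords k p n x $$ (i, j)) \<in> borel_measurable (borel_PiM J)"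
    using ij by (simp add: block_of_coords_def)
qed simp

text \<open>
  Replacing the component of a standard normal vector \<open>y\<close> in the direction \<open>d\<close> of the identity
  matrix by an independent normal variable \<open>t\<close> does not change its law, and for fixed \<open>y\<close> only
  finitely many \<open>t\<close> make the block singular.
\<close>

lemma AE_block_nonsingular:
  fixes k p n :: nat
  defines "J \<equiv> ({k..<k + p} \<times> {..<4::nat}) \<times> {..<n}"
  assumes p: "0 < p" "p \<le> n"
  shows "AE y in normal_PiM J. real_rep_det (block_of_coords k p p y) \<noteq> 0"
proof -
  \<comment> \<open>\<open>D\<close> lists the real parts of the diagonal entries of the block, so
    \<open>d\<close> below holds the coordinates of the identity matrix, a vector of squared length
    \<open>p\<close>.\<close>
  define D where "D = (\<lambda>i. ((k + i, 0::nat), i)) ` {..<p}"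
  have DJ: "D \<subseteq> J" using p by (auto simp: D_def J_def)
  have finJ: "finite J" by (simp add: J_def)
  have "card D = p" unfolding D_def by (subst card_image) (auto simp: inj_on_def)
  define d :: "_ \<Rightarrow> real" where "d a = (if a \<in> D then 1 else 0)" for a
  have dd: "(\<Sum>b\<in>J. d b * d b) = real p"
  proof -
    have "(\<Sum>b\<in>J. d b * d b) = (\<Sum>b\<in>J. if b \<in> D then 1 else 0)" by (intro sum.cong) (auto simp: d_def)
    also have "\<dots> = real (card D)"
      using finJ DJ by (simp add: sum.If_cases Int_absorb1)
    finally show ?thesis using \<open>card D = p\<close> by simp
  qed
  \<comment> \<open>Column \<open>None\<close> is the unit vector \<open>d / sqrt p\<close> and will
    carry the fresh variable \<open>t\<close>; the columns \<open>Some b\<close> form the projection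
    orthogonal to \<open>d\<close>. Together they have orthonormal rows, since the projections along
    \<open>d\<close> and off \<open>d\<close> add up to the identity.\<close>
  define G where "G a j = (case j of None \<Rightarrow> d a / sqrt p | Some b \<Rightarrow> (if a = b then 1 else 0) - d a * d b / p)" for a j
  define K where "K = Some ` J"
  have K: "finite K" "None \<notin> K" using finJ by (auto simp: K_def)
  have sumK: "(\<Sum>j\<in>insert None K. f j) = f None + (\<Sum>b\<in>J. f (Some b))" for f :: "_ \<Rightarrow> real"
    using K unfolding K_def by (simp add: sum.reindex)
  have ortho: "(\<Sum>j\<in>insert None K. G a j * G a' j) = (if a = a' then 1 else 0)" if "a \<in> J" "a' \<in> J" for a a'
  proof -
    have "(\<Sum>b\<in>J. G a (Some b) * G a' (Some b)) =
      (\<Sum>b\<in>J. (if a = b then (if a' = b then 1 else 0) else 0) - (if a = b then d a' * d b / p else 0)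
        - (if a' = b then d a * d b / p else 0) + d a * d a' / p\<^sup>2 * (d b * d b))"
      by (intro sum.cong) (auto simp: G_def algebra_simps power2_eq_square)
    also have "\<dots> = (if a' = a then 1 else 0) - d a' * d a / p - d a * d a' / p + d a * d a' / p\<^sup>2 * (\<Sum>b\<in>J. d b * d b)"
      using finJ that by (simp only: sum.distrib sum_subtractf sum_distrib_left[symmetric] sum.delta sum.delta' if_True)
    also have "\<dots> = (if a = a' then 1 else 0) - d a * d a' / p"
      using p by (auto simp: dd power2_eq_square field_simps)
    finally show ?thesis
      using p by (simp add: sumK, simp add: G_def)
  qed
  let ?X = "block_of_coords k p p"
  let ?S = "{y \<in> space (borel_PiM J). real_rep_det (?X y) = 0}"
  have X: "?X \<in> borel_PiM J \<rightarrow>\<^sub>M mat_borel p p"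
    by (rule measurable_block_of_coords) (use p in \<open>auto simp: J_def\<close>)
  have S [measurable]: "?S \<in> sets (borel_PiM J)"
    using measurable_det_real_rep[OF X] by measurable
  let ?T = "\<lambda>x. \<lambda>a\<in>J. \<Sum>j\<in>insert None K. G a j * x j"
  have T: "?T \<in> borel_PiM (insert None K) \<rightarrow>\<^sub>M borel_PiM J"
    by (rule measurable_linear_map_PiM)
  \<comment> \<open>For fixed \<open>z\<close> the block is a fixed matrix shifted by
    \<open>t / sqrt p\<close> times the identity, so the bad values of \<open>t\<close> form a
    finite set, which is null for the normal law.\<close>
  have inner: "(\<integral>\<^sup>+t. indicator ?S (?T (z(None := t))) \<partial>normal_measure) = 0" for z
  proof -
    define y where "y a = (\<Sum>b\<in>J. G a (Some b) * z (Some b))" for a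
    have Ty: "?T (z(None := t)) a = y a + d a * (t / sqrt p)" if "a \<in> J" for a t
      using that by (simp add: sumK y_def, simp add: G_def)
    have XT: "?X (?T (z(None := t))) = ?X y + of_real (t / sqrt p) \<cdot>\<^sub>m 1\<^sub>m p" for t
    proof (rule eq_matI)
      fix i j assume "i < dim_row (?X y + of_real (t / sqrt p) \<cdot>\<^sub>m 1\<^sub>m p)" "j < dim_col (?X y + of_real (t / sqrt p) \<cdot>\<^sub>m 1\<^sub>m p)"
      then have ij: "i < p" "j < p" by auto
      have val: "?T (z(None := t)) ((k + i, c), j) = y ((k + i, c), j) + (t / sqrt p) * (if c = 0 \<and> i = j then 1 else 0)"
        if "c < 4" for c
      proof -
        have "((k + i, c), j) \<in> J" using ij p that by (auto simp: J_def)
        moreover have "d ((k + i, c), j) = (if c = 0 \<and> i = j then 1 else 0)"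
          using ij by (auto simp: d_def D_def)
        ultimately show ?thesis using Ty[of "((k + i, c), j)" t] by simp
      qed
      have "quat_of_coords (\<lambda>c. ?T (z(None := t)) ((k + i, c), j)) =
        quat_of_coords (\<lambda>c. y ((k + i, c), j)) + of_real (t / sqrt p) * (if i = j then 1 else 0)"
      proof (rule quat_eqI_qcoord)
        fix c :: nat assume c: "c < 4"
        have "qcoord c (if i = j then 1 else 0) = (if c = 0 \<and> i = j then 1 else 0)"
          using c by (auto simp: less_4_cases)
        then show "qcoord c (quat_of_coords (\<lambda>c. ?T (z(None := t)) ((k + i, c), j))) =
          qcoord c (quat_of_coords (\<lambda>c. y ((k + i, c), j)) + of_real (t / sqrt p) * (if i = j then 1 else 0))"
          by (simp only: qcoord_add[OF c] qcoord_of_real_mult[OF c] qcoord_quat_of_coords[OF c] val[OF c])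
      qed
      then show "?X (?T (z(None := t))) $$ (i, j) = (?X y + of_real (t / sqrt p) \<cdot>\<^sub>m 1\<^sub>m p) $$ (i, j)"
        using ij by (simp add: block_of_coords_def del: restrict_apply of_real_divide)
    qed (auto simp: block_of_coords_def)
    let ?F = "{t. real_rep_det (?X y + of_real t \<cdot>\<^sub>m 1\<^sub>m p) = 0}"
    have fin: "finite ((\<lambda>s. s * sqrt p) ` ?F)"
      by (intro finite_imageI finite_singular_shifts) simp
    have "(\<integral>\<^sup>+t. indicator ?S (?T (z(None := t))) \<partial>normal_measure) \<le> (\<integral>\<^sup>+t. indicator ((\<lambda>s. s * sqrt p) ` ?F) t \<partial>normal_measure)"
    proof (rule nn_integral_mono)
      fix t
      have "t \<in> (\<lambda>s. s * sqrt p) ` ?F" if "?T (z(None := t)) \<in> ?S"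
        using that p unfolding mem_Collect_eq XT by (intro image_eqI[of _ _ "t / sqrt p"]) auto
      then show "indicator ?S (?T (z(None := t))) \<le> (indicator ((\<lambda>s. s * sqrt p) ` ?F) t :: ennreal)"
        by (auto simp: indicator_def)
    qed
    also have "\<dots> = emeasure normal_measure ((\<lambda>s. s * sqrt p) ` ?F)"
      using fin by (intro nn_integral_indicator) (simp add: finite_imp_closed borel_closed)
    finally show ?thesis using emeasure_normal_measure_finite[OF fin] by simp
  qed
  have "emeasure (normal_PiM J) ?S = (\<integral>\<^sup>+y. indicator ?S y \<partial>normal_PiM J)"
    using S by (intro nn_integral_indicator[symmetric]) (simp add: sets_PiM_normal_measure)
  also have "\<dots> = (\<integral>\<^sup>+y. indicator ?S (?T y) \<partial>normal_PiM (insert None K))"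
    by (rule nn_integral_PiM_orthonormal[symmetric]) (use finJ K ortho S in auto)
  also have "\<dots> = (\<integral>\<^sup>+z. \<integral>\<^sup>+t. indicator ?S (?T (z(None := t))) \<partial>normal_measure \<partial>normal_PiM K)"
  proof (rule normal_product.product_nn_integral_insert[OF K])
    have "(indicator ?S :: _ \<Rightarrow> ennreal) \<in> borel_measurable (borel_PiM J)"
      by (rule borel_measurable_indicator[OF S])
    from measurable_compose[OF T this]
    show "(\<lambda>y. indicator ?S (?T y) :: ennreal) \<in> borel_measurable (normal_PiM (insert None K))"
      by (simp add: measurable_PiM_normal_measure)
  qed
  also have "\<dots> = 0" by (simp only: inner) simp
  finally have "emeasure (normal_PiM J) ?S = 0" .
  then have "AE y in normal_PiM J. y \<notin> ?S"
    using S by (intro AE_not_in) (auto simp: null_sets_def sets_PiM_normal_measure)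
  then show ?thesis
    by (rule AE_mp) (intro AE_I2 impI, auto simp: space_PiM)
qed

text \<open>The leading \<open>p\<close> columns suffice: almost surely they form an invertible
  block.\<close>

lemma AE_left_independent:
  fixes k p n :: nat
  assumes p: "0 < p" "p \<le> n"
  shows "AE y in normal_PiM (({k..<k + p} \<times> {..<4::nat}) \<times> {..<n}).
    left_independent (block_of_coords k p n y)"
  using AE_block_nonsingular[OF p]
proof (rule eventually_mono)
  fix y
  let ?X = "Matrix.mat p p (\<lambda>(i, j). block_of_coords k p n y $$ (i, j))"
  have X: "?X = block_of_coords k p p y"
    using p by (intro eq_matI) (auto simp: block_of_coords_def)
  have XC: "?X \<in> carrier_mat p p" by simp
  assume "real_rep_det (block_of_coords k p p y) \<noteq> 0"
  then have det: "real_rep_det ?X \<noteq> 0" unfolding X .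
  have "rep_inverse ?X \<in> carrier_mat p p" by (simp add: rep_inverse_def)
  with mult_rep_inverse[OF XC det] quat_mat_left_right_inverse[OF XC] have "invertible_mat ?X"
    by (intro invertible_matI[OF XC]) auto
  then show "left_independent (block_of_coords k p n y)"
    using p by (intro left_independent_columns[where e="\<lambda>j. j" and n=n]) auto
qed

section \<open>The law of the Schur complement\<close>

lemma mat_coords_block_of_coords:
  assumes "x \<in> extensional (mat_index m n)"
  shows "mat_coords m n (block_of_coords 0 m n x) = x"
  using assms by (auto simp: mat_coords_def block_of_coords_def fun_eq_iff restrict_def extensional_def)

lemma block_of_coords_mat_coords:
  assumes "A \<in> carrier_mat m n"
  shows "block_of_coords 0 m n (mat_coords m n A) = A"
  using assms by (intro eq_matI) (auto simp: mat_coords_def block_of_coords_def intro!: quat_eqI_qcoord)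

text \<open>Multiplication from the right acts on each row separately, hence \<open>G\<close>
  vanishes unless the row numbers agree. Within a row, \<open>sum_qcoord_mult_left_units\<close>
  turns \<open>Q* Q = 1\<close> into real orthonormality.\<close>

lemma distr_PiM_right_mult:
  fixes k n r :: nat
  assumes Q: "Q \<in> carrier_mat n r" "ctranspose Q * Q = 1\<^sub>m r"
  shows "distr (normal_PiM (mat_index k n)) (borel_PiM (mat_index k r))
      (\<lambda>x. mat_coords k r (block_of_coords 0 k n x * Q)) = normal_PiM (mat_index k r)"
proof -
  let ?I = "mat_index k r" and ?J = "mat_index k n"
  let ?q = "\<lambda>c d l j. qcoord c (quat_unit d * Q $$ (l, j))"
  define G where "G a b = (if fst (fst a) = fst (fst b) then ?q (snd (fst a)) (snd (fst b)) (snd b) (snd a) else 0)"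
    for a b :: "(nat \<times> nat) \<times> nat"
  have sumJ: "(\<Sum>b\<in>?J. f b) = (\<Sum>i<k. \<Sum>d<4. \<Sum>l<n. f ((i, d), l))" for f :: "_ \<Rightarrow> real"
  proof -
    have "(\<Sum>i<k. \<Sum>d<4. \<Sum>l<n. f ((i, d), l)) = (\<Sum>a\<in>{..<k} \<times> {..<4}. \<Sum>l<n. f (a, l))"
      using sum.cartesian_product[of "\<lambda>i d. \<Sum>l<n. f ((i, d), l)" "{..<4}" "{..<k}"] by (simp add: split_beta')
    also have "\<dots> = (\<Sum>b\<in>?J. f b)"
      using sum.cartesian_product[of "\<lambda>a l. f (a, l)" "{..<n}" "{..<k} \<times> {..<4}"] by simp
    finally show ?thesis ..
  qed
  have coords: "mat_coords k r (block_of_coords 0 k n x * Q) = (\<lambda>a\<in>?I. \<Sum>b\<in>?J. G a b * x b)" for x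
  proof -
    have "qcoord c ((block_of_coords 0 k n x * Q) $$ (i, j)) = (\<Sum>b\<in>?J. G ((i, c), j) b * x b)"
      if "i < k" "c < 4" "j < r" for i c j
    proof -
      have "(\<Sum>b\<in>?J. G ((i, c), j) b * x b) = (\<Sum>i'<k. if i' = i then (\<Sum>d<4. \<Sum>l<n. ?q c d l j * x ((i', d), l)) else 0)"
        unfolding sumJ by (intro sum.cong refl) (auto simp: G_def)
      also have "\<dots> = (\<Sum>d<4. \<Sum>l<n. ?q c d l j * x ((i, d), l))"
        using that by simp
      also have "\<dots> = (\<Sum>l<n. \<Sum>d<4. ?q c d l j * qcoord d (quat_of_coords (\<lambda>c. x ((i, c), l))))"
        by (subst sum.swap) simp
      also have "\<dots> = (\<Sum>l<n. qcoord c (block_of_coords 0 k n x $$ (i, l) * Q $$ (l, j)))"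
        unfolding qcoord_units_mult[OF that(2)] using that
        by (intro sum.cong refl) (simp add: block_of_coords_def)
      also have "\<dots> = qcoord c ((block_of_coords 0 k n x * Q) $$ (i, j))"
        using that by (simp only: mat_mult_index_sum[OF block_of_coords_carrier Q(1)] qcoord_sum)
      finally show ?thesis by simp
    qed
    then show ?thesis by (auto simp: mat_coords_def fun_eq_iff restrict_def simp del: index_mult_mat(1))
  qed
  have ortho: "(\<Sum>b\<in>?J. G a b * G a' b) = (if a = a' then 1 else 0)" if a: "a \<in> ?I" "a' \<in> ?I" for a a'
  proof -
    obtain i c j i' c' j' where ac: "a = ((i, c), j)" "a' = ((i', c'), j')" "i < k" "c < 4" "j < r" "i' < k" "c' < 4" "j' < r"
      using a by auto
    have "(\<Sum>b\<in>?J. G a b * G a' b) = (\<Sum>i''<k. if i'' = i then (if i = i' then (\<Sum>d<4. \<Sum>l<n. ?q c d l j * ?q c' d l j') else 0) else 0)"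
      unfolding sumJ by (intro sum.cong refl) (auto simp: G_def ac)
    also have "\<dots> = (if i = i' then (\<Sum>d<4. \<Sum>l<n. ?q c d l j * ?q c' d l j') else 0)"
      using ac by simp
    also have "(\<Sum>d<4. \<Sum>l<n. ?q c d l j * ?q c' d l j') = (\<Sum>l<n. \<Sum>d<4. ?q c d l j * ?q c' d l j')"
      by (rule sum.swap)
    also have "\<dots> = (\<Sum>l<n. qcoord c (quat_unit c' * qcnj (Q $$ (l, j')) * Q $$ (l, j)))"
      using ac by (simp add: sum_qcoord_mult_left_units)
    also have "\<dots> = qcoord c (quat_unit c' * (\<Sum>l<n. qcnj (Q $$ (l, j')) * Q $$ (l, j)))"
      using ac by (simp add: qcoord_sum sum_distrib_left mult.assoc)
    also have "(\<Sum>l<n. qcnj (Q $$ (l, j')) * Q $$ (l, j)) = (ctranspose Q * Q) $$ (j', j)"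
      using ac Q by (subst mat_mult_index_sum[OF ctranspose_carrier[OF Q(1)] Q(1)]) auto
    finally show ?thesis using ac by (auto simp: Q qcoord_quat_unit qcoord_0)
  qed
  show ?thesis
    unfolding coords by (rule distr_PiM_orthonormal) (use ortho in auto)
qed

lemma measurable_schur:
  assumes A: "A \<in> M \<rightarrow>\<^sub>M mat_borel (k + p) (k + p)"
  shows "(\<lambda>x. schur k (A x)) \<in> M \<rightarrow>\<^sub>M mat_borel k k"
proof -
  have sub: "(\<lambda>x. Matrix.mat a b (\<lambda>(i, j). A x $$ (f i, g j))) \<in> M \<rightarrow>\<^sub>M mat_borel a b"
    if "\<And>i. i < a \<Longrightarrow> f i < k + p" "\<And>j. j < b \<Longrightarrow> g j < k + p" for a b f g
  proof (rule measurable_mat_borelI)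
    fix i j assume ij: "i < a" "j < b"
    then have "(\<lambda>x. A x $$ (f i, g j)) \<in> borel_measurable M" by (intro measurable_mat_entry[OF A] that)
    then show "(\<lambda>x. Matrix.mat a b (\<lambda>(i, j). A x $$ (f i, g j)) $$ (i, j)) \<in> borel_measurable M"
      using ij by simp
  qed simp
  let ?A11 = "\<lambda>x. Matrix.mat k k (\<lambda>(i, j). A x $$ (i, j))"
  let ?A12 = "\<lambda>x. Matrix.mat k p (\<lambda>(i, j). A x $$ (i, j + k))"
  let ?A22 = "\<lambda>x. Matrix.mat p p (\<lambda>(i, j). A x $$ (i + k, j + k))"
  have m: "?A11 \<in> M \<rightarrow>\<^sub>M mat_borel k k" "?A12 \<in> M \<rightarrow>\<^sub>M mat_borel k p" "?A22 \<in> M \<rightarrow>\<^sub>M mat_borel p p"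
    by (intro sub; simp)+
  have "(\<lambda>x. ?A11 x - ?A12 x * inv_mat (?A22 x) * ctranspose (?A12 x)) \<in> M \<rightarrow>\<^sub>M mat_borel k k"
    by (intro measurable_mat_diff measurable_mat_mult[where n=p] measurable_inv_mat measurable_ctranspose m)
  also have "?this \<longleftrightarrow> (\<lambda>x. schur k (A x)) \<in> M \<rightarrow>\<^sub>M mat_borel k k"
    by (intro measurable_cong) (simp add: schur_def split_block_def Let_def measurable_mat_dim[OF A])
  finally show ?thesis .
qed

text \<open>Fubini over the lower rows \<open>?J2\<close> (outside) and the upper rows
  \<open>?J1\<close> (inside). For almost every lower block \<open>y\<close> the inner integral is
  computed with a \<open>Q\<close> chosen for that \<open>y\<close>; only its value, the same for
  all such \<open>y\<close>, enters the outer integral over a probability space.\<close>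

lemma distr_schur_normal:
  fixes k p n :: nat
  assumes C: "C \<in> carrier_mat k k" and H: "H \<in> carrier_mat k p"
    and D: "D \<in> carrier_mat p p" "D' \<in> carrier_mat p p" "D * D' = 1\<^sub>m p"
    and p: "0 < p" "p \<le> n"
  defines "B \<equiv> four_block_mat C H (0\<^sub>m p k) D"
  shows "distr (normal_PiM (mat_index (k + p) n)) (mat_borel k k)
      (\<lambda>x. schur k (B * block_of_coords 0 (k + p) n x * ctranspose (B * block_of_coords 0 (k + p) n x))) =
    distr (normal_PiM (mat_index k (n - p))) (mat_borel k k)
      (\<lambda>x. (C * block_of_coords 0 k (n - p) x) * ctranspose (C * block_of_coords 0 k (n - p) x))"
    (is "distr ?M _ ?F = distr ?N _ ?g")
proof (rule measure_eqI)
  let ?J1 = "mat_index k n" and ?J2 = "({k..<k + p} \<times> {..<4::nat}) \<times> {..<n}"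
  let ?L = "mat_index k (n - p)"
  have J: "mat_index (k + p) n = ?J2 \<union> ?J1" "?J2 \<inter> ?J1 = {}" "finite ?J2" "finite ?J1"
    by auto
  have BC: "B \<in> carrier_mat (k + p) (k + p)" using C D by (auto simp: B_def)
  have X: "block_of_coords 0 (k + p) n \<in> borel_PiM (?J2 \<union> ?J1) \<rightarrow>\<^sub>M mat_borel (k + p) n"
    by (rule measurable_block_of_coords) auto
  have BX: "(\<lambda>x. B * block_of_coords 0 (k + p) n x) \<in> borel_PiM (?J2 \<union> ?J1) \<rightarrow>\<^sub>M mat_borel (k + p) n"
    by (rule measurable_mat_mult[OF measurable_mat_const[OF BC] X])
  have F: "?F \<in> borel_PiM (?J2 \<union> ?J1) \<rightarrow>\<^sub>M mat_borel k k"
    by (rule measurable_schur[OF measurable_mat_mult[OF BX measurable_ctranspose[OF BX]]])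
  then have FM: "?F \<in> ?M \<rightarrow>\<^sub>M mat_borel k k" unfolding J by (simp add: measurable_PiM_normal_measure)
  have X': "block_of_coords 0 k (n - p) \<in> borel_PiM ?L \<rightarrow>\<^sub>M mat_borel k (n - p)"
    by (rule measurable_block_of_coords) auto
  have CX: "(\<lambda>x. C * block_of_coords 0 k (n - p) x) \<in> borel_PiM ?L \<rightarrow>\<^sub>M mat_borel k (n - p)"
    by (rule measurable_mat_mult[OF measurable_mat_const[OF C] X'])
  have g: "?g \<in> borel_PiM ?L \<rightarrow>\<^sub>M mat_borel k k"
    by (rule measurable_mat_mult[OF CX measurable_ctranspose[OF CX]])
  then have gN: "?g \<in> ?N \<rightarrow>\<^sub>M mat_borel k k" by (simp add: measurable_PiM_normal_measure)
  fix E assume "E \<in> sets (distr ?M (mat_borel k k) ?F)"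
  then have E [measurable]: "E \<in> sets (mat_borel k k)" by simp
  have ind: "(indicator E :: _ \<Rightarrow> ennreal) \<in> borel_measurable (mat_borel k k)"
    by (rule borel_measurable_indicator[OF E])
  have gE: "(\<lambda>x. indicator E (?g x) :: ennreal) \<in> borel_measurable (borel_PiM ?L)"
    by (rule measurable_compose[OF g ind])
  have inner: "(\<integral>\<^sup>+x. indicator E (?F (merge ?J2 ?J1 (y, x))) \<partial>normal_PiM ?J1) =
      (\<integral>\<^sup>+x. indicator E (?g x) \<partial>?N)" if y: "left_independent (block_of_coords k p n y)" for y
  proof -
    obtain Q where Q: "Q \<in> carrier_mat n (n - p)" "ctranspose Q * Q = 1\<^sub>m (n - p)"
      and schur: "\<And>W. W \<in> carrier_mat (k + p) n \<Longrightarrow> bottom_rows k W = block_of_coords k p n y \<Longrightarrow>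
        schur k (B * W * ctranspose (B * W)) = C * (top_rows k W * Q) * ctranspose (C * (top_rows k W * Q))"
      unfolding B_def by (rule schur_upper_triangular[OF C H D block_of_coords_carrier y p(2)]) blast
    let ?T = "\<lambda>x. mat_coords k (n - p) (block_of_coords 0 k n x * Q)"
    have T: "?T \<in> normal_PiM ?J1 \<rightarrow>\<^sub>M borel_PiM ?L"
    proof -
      have "block_of_coords 0 k n \<in> borel_PiM ?J1 \<rightarrow>\<^sub>M mat_borel k n"
        by (rule measurable_block_of_coords) auto
      then have "?T \<in> borel_PiM ?J1 \<rightarrow>\<^sub>M borel_PiM ?L"
        by (intro measurable_compose[OF _ measurable_mat_coords] measurable_mat_mult[OF _ measurable_mat_const[OF Q(1)]])
      then show ?thesis by (simp add: measurable_PiM_normal_measure)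
    qed
    \<comment> \<open>The merged matrix has \<open>y\<close> as lower and \<open>x\<close> as upper
      rows, so with \<open>y\<close> frozen the Schur complement is a function of the upper block
      times \<open>Q\<close>.\<close>
    have "?F (merge ?J2 ?J1 (y, x)) = ?g (?T x)" for x
    proof -
      let ?W = "block_of_coords 0 (k + p) n (merge ?J2 ?J1 (y, x))"
      have "bottom_rows k ?W = block_of_coords k p n y"
        by (intro eq_matI) (auto simp: bottom_rows_def block_of_coords_def merge_def quat_of_coords_def)
      moreover have "top_rows k ?W = block_of_coords 0 k n x"
        by (intro eq_matI) (auto simp: top_rows_def block_of_coords_def merge_def quat_of_coords_def)
      moreover have "block_of_coords 0 k n x * Q \<in> carrier_mat k (n - p)"
        by (rule mult_carrier_mat[OF block_of_coords_carrier Q(1)])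
      ultimately show ?thesis
        using schur[of ?W] by (simp only: block_of_coords_carrier block_of_coords_mat_coords)
    qed
    then have "(\<integral>\<^sup>+x. indicator E (?F (merge ?J2 ?J1 (y, x))) \<partial>normal_PiM ?J1) =
        (\<integral>\<^sup>+x. indicator E (?g (?T x)) \<partial>normal_PiM ?J1)" by (simp only:)
    also have "\<dots> = (\<integral>\<^sup>+x. indicator E (?g x) \<partial>distr (normal_PiM ?J1) (borel_PiM ?L) ?T)"
      using gE by (intro nn_integral_distr[OF T, symmetric]) simp
    finally show ?thesis unfolding distr_PiM_right_mult[OF Q] .
  qed
  have "emeasure (distr ?M (mat_borel k k) ?F) E = (\<integral>\<^sup>+x. indicator E x \<partial>distr ?M (mat_borel k k) ?F)"
    using E by simp
  also have "\<dots> = (\<integral>\<^sup>+x. indicator E (?F x) \<partial>?M)"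
    using ind by (intro nn_integral_distr[OF FM]) simp
  also have "\<dots> = (\<integral>\<^sup>+y. \<integral>\<^sup>+x. indicator E (?F (merge ?J2 ?J1 (y, x))) \<partial>normal_PiM ?J1 \<partial>normal_PiM ?J2)"
    unfolding J(1)
    by (rule normal_product.product_nn_integral_fold[OF J(2-4)])
      (use measurable_compose[OF F ind] in \<open>simp only: measurable_PiM_normal_measure\<close>)
  also have "\<dots> = (\<integral>\<^sup>+y. (\<integral>\<^sup>+x. indicator E (?g x) \<partial>?N) \<partial>normal_PiM ?J2)"
    using AE_left_independent[OF p, of k] by (intro nn_integral_cong_AE) (auto simp: inner elim!: AE_mp)
  also have "\<dots> = (\<integral>\<^sup>+x. indicator E (?g x) \<partial>?N)"
    by (simp add: prob_space.emeasure_space_1[OF prob_space_PiM_normal_measure])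
  also have "\<dots> = (\<integral>\<^sup>+x. indicator E x \<partial>distr ?N (mat_borel k k) ?g)"
    using ind by (intro nn_integral_distr[OF gN, symmetric]) simp
  also have "\<dots> = emeasure (distr ?N (mat_borel k k) ?g) E"
    using E by simp
  finally show "emeasure (distr ?M (mat_borel k k) ?F) E = emeasure (distr ?N (mat_borel k k) ?g) E" .
qed simp

section \<open>Normal samples and standard normal matrices\<close>

lemma four_smult_cancel:
  fixes X Y :: "quat mat"
  assumes "X \<in> carrier_mat m n" "Y \<in> carrier_mat m n" "4 \<cdot>\<^sub>m X = 4 \<cdot>\<^sub>m Y"
  shows "X = Y"
proof (rule eq_matI)
  fix i j assume ij: "i < dim_row Y" "j < dim_col Y"
  have "(4 \<cdot>\<^sub>m X) $$ (i, j) = (4 \<cdot>\<^sub>m Y) $$ (i, j)" by (simp only: assms(3))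
  then show "X $$ (i, j) = Y $$ (i, j)" using ij assms(1,2) by simp
qed (use assms in auto)

text \<open>Column \<open>j\<close> may be presented with a factor \<open>Bj\<close> other than
  \<open>B\<close>. As \<open>Bj Bj* = B B*\<close>, the matrix \<open>U = B' Bj\<close> satisfies
  \<open>U U* = 1\<close> and maps the standard vector of that column to a standard vector
  again.\<close>

lemma quat_normal_sample_imp_std:
  assumes Z: "quat_normal_sample Q m n (4 \<cdot>\<^sub>m (B * ctranspose B)) Z"
    and B: "B \<in> carrier_mat m m" "B' \<in> carrier_mat m m" "B' * B = 1\<^sub>m m"
  shows "std_quat_normal_mat Q m n (\<lambda>\<omega>. B' * Z \<omega>)"
proof -
  let ?S = "4 \<cdot>\<^sub>m (B * ctranspose B)"
  have Q: "prob_space Q" and Zm: "Z \<in> Q \<rightarrow>\<^sub>M mat_borel m n"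
    and indep: "prob_space.indep_vars Q (\<lambda>_. vec_borel m) (\<lambda>j \<omega>. col (Z \<omega>) j) {..<n}"
    and normal: "\<And>j. j < n \<Longrightarrow> quat_normal Q m ?S (\<lambda>\<omega>. col (Z \<omega>) j)"
    using Z unfolding quat_normal_sample_def by auto
  have BZ: "(\<lambda>\<omega>. B' * Z \<omega>) \<in> Q \<rightarrow>\<^sub>M mat_borel m n"
    by (rule measurable_mat_mult[OF measurable_mat_const[OF B(2)] Zm])
  have "std_quat_normal Q m (\<lambda>\<omega>. col (B' * Z \<omega>) j)" if j: "j < n" for j
  proof -
    from normal[OF j] obtain Bj w where Bj: "Bj \<in> carrier_mat m m"
      and S: "?S = 4 \<cdot>\<^sub>m (Bj * ctranspose Bj)" and w: "std_quat_normal Q m w"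
      and z: "\<And>\<omega>. \<omega> \<in> space Q \<Longrightarrow> col (Z \<omega>) j = Bj *\<^sub>v w \<omega>"
      unfolding quat_normal_def by blast
    have U: "B' * Bj \<in> carrier_mat m m" using B Bj by simp
    \<comment> \<open>Both sides are the common covariance transformed by \<open>B'\<close>; on the
      right \<open>B' B = 1\<close> leaves four times the identity.\<close>
    have "4 \<cdot>\<^sub>m ((B' * Bj) * ctranspose (B' * Bj)) = 4 \<cdot>\<^sub>m ((B' * B) * ctranspose (B' * B))"
      unfolding smult_mult_ctranspose[OF Bj B(2), symmetric] smult_mult_ctranspose[OF B(1,2), symmetric] S ..
    then have "4 \<cdot>\<^sub>m ((B' * Bj) * ctranspose (B' * Bj)) = 4 \<cdot>\<^sub>m 1\<^sub>m m"
      by (simp only: B(3) ctranspose_one left_mult_one_mat[OF one_carrier_mat])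
    then have UU: "(B' * Bj) * ctranspose (B' * Bj) = 1\<^sub>m m"
      by (rule four_smult_cancel[OF mult_carrier_mat[OF U ctranspose_carrier[OF U]] one_carrier_mat])
    show ?thesis
    proof (rule std_quat_normal_cong[OF std_quat_normal_mult[OF w U UU]])
      fix \<omega> assume \<omega>: "\<omega> \<in> space Q"
      have wC: "w \<omega> \<in> carrier_vec m"
        using w \<omega> measurable_vec_carrier[of w Q m] by (simp add: std_quat_normal_def)
      have "col (B' * Z \<omega>) j = B' *\<^sub>v (Bj *\<^sub>v w \<omega>)"
        using col_mult2[OF B(2) measurable_mat_carrier[OF Zm \<omega>] j] z[OF \<omega>] by simp
      then show "B' * Bj *\<^sub>v w \<omega> = col (B' * Z \<omega>) j"
        by (simp only: assoc_mult_mat_vec[OF B(2) Bj wC])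
    qed
  qed
  then show ?thesis
    unfolding std_quat_normal_mat_iff[OF Q BZ] using indep_cols_mult[OF Q Zm B(2) indep] by blast
qed

lemma std_imp_quat_normal_sample:
  assumes W: "std_quat_normal_mat P m n W"
    and C: "C \<in> carrier_mat m m" "C' \<in> carrier_mat m m" "C * C' = 1\<^sub>m m" "C' * C = 1\<^sub>m m"
  shows "quat_normal_sample P m n (4 \<cdot>\<^sub>m (C * ctranspose C)) (\<lambda>\<omega>. C * W \<omega>)"
proof -
  have P: "prob_space P" and Wm: "W \<in> P \<rightarrow>\<^sub>M mat_borel m n"
    using W by (auto simp: std_quat_normal_mat_def)
  note cols = W[unfolded std_quat_normal_mat_iff[OF P Wm]]
  have "quat_normal P m (4 \<cdot>\<^sub>m (C * ctranspose C)) (\<lambda>\<omega>. col (C * W \<omega>) j)" if j: "j < n" for j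
  proof -
    have "col (C * W \<omega>) j = C *\<^sub>v col (W \<omega>) j" if "\<omega> \<in> space P" for \<omega>
      by (rule col_mult2[OF C(1) measurable_mat_carrier[OF Wm that] j])
    then show ?thesis
      unfolding quat_normal_def using C(1) invertible_matI[OF C] cols j by blast
  qed
  then show ?thesis
    unfolding quat_normal_sample_def
    using P measurable_mat_mult[OF measurable_mat_const[OF C(1)] Wm] indep_cols_mult[OF P Wm C(1)] cols by blast
qed

text \<open>Supplies the auxiliary space required by the definition of a Wishart matrix: the
  quaternion matrices themselves under the standard law, with the identity as random matrix.\<close>

lemma std_quat_normal_mat_canonical:
  "std_quat_normal_mat (distr (normal_PiM (mat_index m n)) (mat_borel m n)
    (block_of_coords 0 m n)) m n (\<lambda>A. A)"
proof -
  let ?J = "mat_index m n"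
  let ?M = "normal_PiM ?J"
  have X: "block_of_coords 0 m n \<in> ?M \<rightarrow>\<^sub>M mat_borel m n"
    unfolding measurable_PiM_normal_measure by (rule measurable_block_of_coords) auto
  have "distr (distr ?M (mat_borel m n) (block_of_coords 0 m n)) (borel_PiM ?J) (mat_coords m n) =
      distr ?M (borel_PiM ?J) (mat_coords m n \<circ> block_of_coords 0 m n)"
    by (rule distr_distr[OF measurable_mat_coords X])
  also have "\<dots> = distr ?M (borel_PiM ?J) (\<lambda>x. x)"
    by (intro distr_cong refl) (simp add: mat_coords_block_of_coords space_PiM_normal_measure)
  also have "\<dots> = ?M" by (rule distr_id2) (simp add: sets_PiM_normal_measure)
  finally show ?thesis
    unfolding std_quat_normal_mat_def
    using prob_space.prob_space_distr[OF prob_space_PiM_normal_measure X] by simp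
qed

text \<open>The sample is standardised by the inverse \<open>B'\<close> of the triangular factor, so
  the law of the Schur complement becomes an image of the standard normal law, and
  \<open>distr_schur_normal\<close> rewrites it as the law of a Gram matrix with
  \<open>n - p\<close> columns.\<close>

lemma quat_wishart_schur:
  fixes k p n :: nat
  assumes A: "quat_wishart P (k + p) n S A" and p: "0 < p" "p \<le> n"
    and C: "C \<in> carrier_mat k k" "C' \<in> carrier_mat k k" "C * C' = 1\<^sub>m k"
    and H: "H \<in> carrier_mat k p"
    and D: "D \<in> carrier_mat p p" "D' \<in> carrier_mat p p" "D * D' = 1\<^sub>m p"
    and S: "S = 4 \<cdot>\<^sub>m (four_block_mat C (H * D) (0\<^sub>m p k) D * ctranspose (four_block_mat C (H * D) (0\<^sub>m p k) D))"
  shows "quat_wishart P k (n - p) (4 \<cdot>\<^sub>m (C * ctranspose C)) (\<lambda>\<omega>. schur k (A \<omega>))"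
proof -
  let ?B = "four_block_mat C (H * D) (0\<^sub>m p k) D"
  let ?J = "mat_index (k + p) n" and ?L = "mat_index k (n - p)"
  let ?N = "normal_PiM ?L"
  have HD: "H * D \<in> carrier_mat k p" using H D by simp
  have B: "?B \<in> carrier_mat (k + p) (k + p)" using C D by auto
  \<comment> \<open>The corner of the inverse of a block triangular matrix would be
    \<open>- C' (H D) D'\<close>, and \<open>D D' = 1\<close> shortens it to
    \<open>- C' H\<close>.\<close>
  define B' where "B' = four_block_mat C' (- (C' * H)) (0\<^sub>m p k) D'"
  have B': "B' \<in> carrier_mat (k + p) (k + p)" using C D by (auto simp: B'_def)
  have BB': "?B * B' = 1\<^sub>m (k + p)"
  proof -
    have C'H: "- (C' * H) \<in> carrier_mat k p" using C H by auto
    have "?B * B' = four_block_mat (C * C' + H * D * 0\<^sub>m p k) (C * (- (C' * H)) + H * D * D')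
        (0\<^sub>m p k * C' + D * 0\<^sub>m p k) (0\<^sub>m p k * (- (C' * H)) + D * D')"
      unfolding B'_def by (rule mult_four_block_mat[OF C(1) HD zero_carrier_mat D(1) C(2) C'H zero_carrier_mat D(2)])
    also have "C * C' + H * D * 0\<^sub>m p k = 1\<^sub>m k"
      by (simp only: C(3) right_mult_zero_mat[OF HD] right_add_zero_mat[OF one_carrier_mat])
    also have "0\<^sub>m p k * C' + D * 0\<^sub>m p k = 0\<^sub>m p k" using C D by simp
    also have "0\<^sub>m p k * (- (C' * H)) + D * D' = 1\<^sub>m p"
      by (simp only: D(3) left_mult_zero_mat[OF C'H] left_add_zero_mat[OF one_carrier_mat])
    also have "C * (- (C' * H)) + H * D * D' = 0\<^sub>m k p"
    proof -
      have "C * (- (C' * H)) = - (C * (C' * H))"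
        using C H by (intro uminus_mult_right_mat) auto
      also have "C * (C' * H) = C * C' * H" by (rule assoc_mult_mat[OF C(1,2) H, symmetric])
      also have "\<dots> = H" using H by (simp add: C(3))
      finally have "C * (- (C' * H)) = - H" .
      moreover have "H * D * D' = H" using H by (simp add: assoc_mult_mat[OF H D(1,2)] D(3))
      ultimately show ?thesis using H by (intro eq_matI) (auto simp del: index_mult_mat(1))
    qed
    finally show ?thesis by simp
  qed
  have B'B: "B' * ?B = 1\<^sub>m (k + p)" by (rule quat_mat_left_right_inverse[OF B B' BB'])
  from A obtain Q :: "quat mat measure" and Z where P: "prob_space P" and Am: "A \<in> P \<rightarrow>\<^sub>M mat_borel (k + p) (k + p)"
    and Z: "quat_normal_sample Q (k + p) n S Z"
    and law: "distr P (mat_borel (k + p) (k + p)) A = distr Q (mat_borel (k + p) (k + p)) (\<lambda>\<omega>. Z \<omega> * ctranspose (Z \<omega>))"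
    unfolding quat_wishart_def by blast
  have Zm: "Z \<in> Q \<rightarrow>\<^sub>M mat_borel (k + p) n" using Z by (simp add: quat_normal_sample_def)
  have std: "std_quat_normal_mat Q (k + p) n (\<lambda>\<omega>. B' * Z \<omega>)"
    by (rule quat_normal_sample_imp_std[OF Z[unfolded S] B B' B'B])
  let ?F = "\<lambda>x. schur k (?B * block_of_coords 0 (k + p) n x * ctranspose (?B * block_of_coords 0 (k + p) n x))"
  let ?g = "\<lambda>X. (C * X) * ctranspose (C * X)"
  let ?R = "distr ?N (mat_borel k (n - p)) (block_of_coords 0 k (n - p))"
  have schur: "schur k \<in> mat_borel (k + p) (k + p) \<rightarrow>\<^sub>M mat_borel k k"
    by (rule measurable_schur[OF measurable_ident_sets[OF refl]])
  have ZZ: "(\<lambda>\<omega>. Z \<omega> * ctranspose (Z \<omega>)) \<in> Q \<rightarrow>\<^sub>M mat_borel (k + p) (k + p)"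
    by (rule measurable_mat_mult[OF Zm measurable_ctranspose[OF Zm]])
  have X: "block_of_coords 0 (k + p) n \<in> borel_PiM ?J \<rightarrow>\<^sub>M mat_borel (k + p) n"
    by (rule measurable_block_of_coords) auto
  have BX: "(\<lambda>x. ?B * block_of_coords 0 (k + p) n x) \<in> borel_PiM ?J \<rightarrow>\<^sub>M mat_borel (k + p) n"
    by (rule measurable_mat_mult[OF measurable_mat_const[OF B] X])
  have F: "?F \<in> borel_PiM ?J \<rightarrow>\<^sub>M mat_borel k k"
    by (rule measurable_schur[OF measurable_mat_mult[OF BX measurable_ctranspose[OF BX]]])
  have coords: "(\<lambda>\<omega>. mat_coords (k + p) n (B' * Z \<omega>)) \<in> Q \<rightarrow>\<^sub>M borel_PiM ?J"
    by (rule measurable_compose[OF measurable_mat_mult[OF measurable_mat_const[OF B'] Zm] measurable_mat_coords])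
  have X': "block_of_coords 0 k (n - p) \<in> ?N \<rightarrow>\<^sub>M mat_borel k (n - p)"
    unfolding measurable_PiM_normal_measure by (rule measurable_block_of_coords) auto
  have CX: "(\<lambda>X. C * X) \<in> mat_borel k (n - p) \<rightarrow>\<^sub>M mat_borel k (n - p)"
    by (rule measurable_mat_mult[OF measurable_mat_const[OF C(1)] measurable_ident_sets[OF refl]])
  have g: "?g \<in> mat_borel k (n - p) \<rightarrow>\<^sub>M mat_borel k k"
    by (rule measurable_mat_mult[OF CX measurable_ctranspose[OF CX]])
  have "distr P (mat_borel k k) (\<lambda>\<omega>. schur k (A \<omega>)) = distr (distr P (mat_borel (k + p) (k + p)) A) (mat_borel k k) (schur k)"
    using distr_distr[OF schur Am] by (simp add: o_def)
  also have "\<dots> = distr Q (mat_borel k k) (schur k \<circ> (\<lambda>\<omega>. Z \<omega> * ctranspose (Z \<omega>)))"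
    unfolding law by (rule distr_distr[OF schur ZZ])
  also have "\<dots> = distr Q (mat_borel k k) (?F \<circ> (\<lambda>\<omega>. mat_coords (k + p) n (B' * Z \<omega>)))"
  proof (intro distr_cong refl)
    fix \<omega> assume "\<omega> \<in> space Q"
    then have ZC: "Z \<omega> \<in> carrier_mat (k + p) n" by (rule measurable_mat_carrier[OF Zm])
    have B'Z: "B' * Z \<omega> \<in> carrier_mat (k + p) n" using B' ZC by simp
    have "?B * (B' * Z \<omega>) = Z \<omega>"
      using ZC by (simp only: assoc_mult_mat[OF B B' ZC, symmetric] BB' left_mult_one_mat)
    then show "(schur k \<circ> (\<lambda>\<omega>. Z \<omega> * ctranspose (Z \<omega>))) \<omega> = (?F \<circ> (\<lambda>\<omega>. mat_coords (k + p) n (B' * Z \<omega>))) \<omega>"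
      by (simp only: o_def block_of_coords_mat_coords[OF B'Z])
  qed
  also have "\<dots> = distr (distr Q (borel_PiM ?J) (\<lambda>\<omega>. mat_coords (k + p) n (B' * Z \<omega>))) (mat_borel k k) ?F"
    by (rule distr_distr[OF F coords, symmetric])
  also have "\<dots> = distr (normal_PiM ?J) (mat_borel k k) ?F"
    using std by (simp only: std_quat_normal_mat_def)
  also have "\<dots> = distr ?N (mat_borel k k) (?g \<circ> block_of_coords 0 k (n - p))"
    unfolding o_def by (rule distr_schur_normal[OF C(1) HD D p])
  also have "\<dots> = distr ?R (mat_borel k k) ?g"
    by (rule distr_distr[OF g X', symmetric])
  finally have "distr P (mat_borel k k) (\<lambda>\<omega>. schur k (A \<omega>)) = distr ?R (mat_borel k k) ?g" .
  moreover have "quat_normal_sample ?R k (n - p) (4 \<cdot>\<^sub>m (C * ctranspose C)) (\<lambda>X. C * X)"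
    by (rule std_imp_quat_normal_sample[OF std_quat_normal_mat_canonical C quat_mat_left_right_inverse[OF C]])
  moreover have "(\<lambda>\<omega>. schur k (A \<omega>)) \<in> P \<rightarrow>\<^sub>M mat_borel k k"
    by (rule measurable_schur[OF Am])
  ultimately show ?thesis
    unfolding quat_wishart_def using P by blast
qed

section \<open>Block factorization of the covariance matrix\<close>

text \<open>The block row \<open>[A1 A2]\<close> is written as a four-block matrix with empty lower
  blocks, so that block multiplication applies to it.\<close>

lemma row_block_congruence:
  fixes A1 A2 :: "quat mat"
  assumes A: "A1 \<in> carrier_mat q k" "A2 \<in> carrier_mat q p"
    and S: "S11 \<in> carrier_mat k k" "S12 \<in> carrier_mat k p" "S21 \<in> carrier_mat p k" "S22 \<in> carrier_mat p p"
  defines "T \<equiv> four_block_mat A1 A2 (0\<^sub>m 0 k) (0\<^sub>m 0 p)"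
  shows "T * four_block_mat S11 S12 S21 S22 * ctranspose T =
    (A1 * S11 + A2 * S21) * ctranspose A1 + (A1 * S12 + A2 * S22) * ctranspose A2"
proof -
  note AC = ctranspose_carrier[OF A(1)] ctranspose_carrier[OF A(2)]
  have TC: "ctranspose T = four_block_mat (ctranspose A1) (0\<^sub>m k 0) (ctranspose A2) (0\<^sub>m p 0)"
    using A by (intro eq_matI) (auto simp: T_def)
  have TS: "T * four_block_mat S11 S12 S21 S22 = four_block_mat (A1 * S11 + A2 * S21) (A1 * S12 + A2 * S22)
      (0\<^sub>m 0 k * S11 + 0\<^sub>m 0 p * S21) (0\<^sub>m 0 k * S12 + 0\<^sub>m 0 p * S22)"
    unfolding T_def by (rule mult_four_block_mat[OF A zero_carrier_mat zero_carrier_mat S])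
  have X: "A1 * S11 + A2 * S21 \<in> carrier_mat q k" "A1 * S12 + A2 * S22 \<in> carrier_mat q p"
    using A S by auto
  have "T * four_block_mat S11 S12 S21 S22 * ctranspose T =
    four_block_mat ((A1 * S11 + A2 * S21) * ctranspose A1 + (A1 * S12 + A2 * S22) * ctranspose A2)
      ((A1 * S11 + A2 * S21) * 0\<^sub>m k 0 + (A1 * S12 + A2 * S22) * 0\<^sub>m p 0)
      ((0\<^sub>m 0 k * S11 + 0\<^sub>m 0 p * S21) * ctranspose A1 + (0\<^sub>m 0 k * S12 + 0\<^sub>m 0 p * S22) * ctranspose A2)
      ((0\<^sub>m 0 k * S11 + 0\<^sub>m 0 p * S21) * 0\<^sub>m k 0 + (0\<^sub>m 0 k * S12 + 0\<^sub>m 0 p * S22) * 0\<^sub>m p 0)"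
    unfolding TS TC by (rule mult_four_block_mat[OF X _ _ AC(1) zero_carrier_mat AC(2) zero_carrier_mat]) (use S in auto)
  also have "\<dots> = (A1 * S11 + A2 * S21) * ctranspose A1 + (A1 * S12 + A2 * S22) * ctranspose A2"
    using A S by (intro eq_matI) auto
  finally show ?thesis .
qed

text \<open>\<open>T B = L V\<close> gives \<open>T B B* T* = L L*\<close>. An invertible factor of
  the compressed covariance thus comes from the given \<open>B\<close>, in place of a Cholesky
  decomposition over the quaternions.\<close>

lemma row_block_factor:
  assumes B: "B \<in> carrier_mat m m" "invertible_mat B"
    and T: "T \<in> carrier_mat k m" "left_independent T"
  obtains C C' where "C \<in> carrier_mat k k" "C' \<in> carrier_mat k k" "C * C' = 1\<^sub>m k"
    "T * (4 \<cdot>\<^sub>m (B * ctranspose B)) * ctranspose T = 4 \<cdot>\<^sub>m (C * ctranspose C)"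
proof -
  obtain B' where B': "B' \<in> carrier_mat m m" "B * B' = 1\<^sub>m m" using B(2,1) by (rule invertible_matE)
  have TB: "T * B \<in> carrier_mat k m" using T B by simp
  obtain L L' V where L: "L \<in> carrier_mat k k" "L' \<in> carrier_mat k k" "L * L' = 1\<^sub>m k"
    and V: "V \<in> carrier_mat k m" "V * ctranspose V = 1\<^sub>m k" and TBLV: "T * B = L * V"
    by (rule lq_decomposition[OF TB left_independent_mult[OF T(2,1) B(1) B']])
  have "T * (4 \<cdot>\<^sub>m (B * ctranspose B)) * ctranspose T = 4 \<cdot>\<^sub>m (L * ctranspose L)"
    unfolding smult_mult_ctranspose[OF B(1) T(1)] TBLV mult_orthonormal_ctranspose[OF L(1) V] ..
  with L show ?thesis by (rule that)
qed

text \<open>\<open>H\<close> plays the part of \<open>S12\<close> times the inverse of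
  \<open>S22\<close>. The block rows \<open>[1 -H]\<close> and \<open>[0 1]\<close> compress the
  covariance to the Schur complement \<open>S11 - H S21\<close> and to \<open>S22\<close>; factors
  \<open>C\<close> and \<open>D\<close> of these two assemble into the triangular factor.\<close>

lemma block_upper_factorization:
  fixes k p :: nat and H :: "quat mat"
  assumes B: "B \<in> carrier_mat (k + p) (k + p)" "invertible_mat B"
    and S: "S11 \<in> carrier_mat k k" "S12 \<in> carrier_mat k p" "S21 \<in> carrier_mat p k" "S22 \<in> carrier_mat p p"
    and BS: "four_block_mat S11 S12 S21 S22 = 4 \<cdot>\<^sub>m (B * ctranspose B)"
    and H: "H \<in> carrier_mat k p" "H * S22 = S12" "S22 * ctranspose H = S21"
  obtains C C' D D' where "C \<in> carrier_mat k k" "C' \<in> carrier_mat k k" "C * C' = 1\<^sub>m k"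
    "D \<in> carrier_mat p p" "D' \<in> carrier_mat p p" "D * D' = 1\<^sub>m p"
    "S11 - H * S21 = 4 \<cdot>\<^sub>m (C * ctranspose C)"
    "four_block_mat S11 S12 S21 S22 =
      4 \<cdot>\<^sub>m (four_block_mat C (H * D) (0\<^sub>m p k) D * ctranspose (four_block_mat C (H * D) (0\<^sub>m p k) D))"
proof -
  note HC = ctranspose_carrier[OF H(1)]
  have mH: "- H \<in> carrier_mat k p" using H by auto
  let ?T = "four_block_mat (1\<^sub>m k) (- H) (0\<^sub>m 0 k) (0\<^sub>m 0 p)"
  let ?E = "four_block_mat (0\<^sub>m p k) (1\<^sub>m p) (0\<^sub>m 0 k) (0\<^sub>m 0 p) :: quat mat"
  have T: "?T \<in> carrier_mat k (k + p)" and E: "?E \<in> carrier_mat p (k + p)"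
    using H by (auto intro!: carrier_matI)
  have one: "invertible_mat (1\<^sub>m q :: quat mat)" for q
    by (rule invertible_matI[of _ q "1\<^sub>m q"]) auto
  have subT: "Matrix.mat k k (\<lambda>(i, j). ?T $$ (i, j)) = 1\<^sub>m k" by (intro eq_matI) auto
  have subE: "Matrix.mat p p (\<lambda>(i, j). ?E $$ (i, k + j)) = 1\<^sub>m p" by (intro eq_matI) auto
  have indT: "left_independent ?T"
    by (rule left_independent_columns[OF T, of "\<lambda>j. j"]) (simp, simp only: subT one)
  have indE: "left_independent ?E"
    by (rule left_independent_columns[OF E, of "\<lambda>j. k + j"]) (simp, simp only: subE one)
  obtain C C' where C: "C \<in> carrier_mat k k" "C' \<in> carrier_mat k k" "C * C' = 1\<^sub>m k"
    and TC: "?T * (4 \<cdot>\<^sub>m (B * ctranspose B)) * ctranspose ?T = 4 \<cdot>\<^sub>m (C * ctranspose C)"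
    by (rule row_block_factor[OF B T indT])
  obtain D D' where D: "D \<in> carrier_mat p p" "D' \<in> carrier_mat p p" "D * D' = 1\<^sub>m p"
    and ED: "?E * (4 \<cdot>\<^sub>m (B * ctranspose B)) * ctranspose ?E = 4 \<cdot>\<^sub>m (D * ctranspose D)"
    by (rule row_block_factor[OF B E indE])
  have HS: "H * S21 \<in> carrier_mat k k" using H S by simp
  have S112: "S11 - H * S21 = 4 \<cdot>\<^sub>m (C * ctranspose C)"
  proof -
    have "4 \<cdot>\<^sub>m (C * ctranspose C) = (1\<^sub>m k * S11 + - H * S21) * ctranspose (1\<^sub>m k) + (1\<^sub>m k * S12 + - H * S22) * ctranspose (- H)"
      unfolding TC[symmetric] BS[symmetric] by (rule row_block_congruence[OF one_carrier_mat mH S])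
    \<comment> \<open>\<open>H S22 = S12\<close> empties this entry, so the congruence leaves only
      the Schur complement.\<close>
    also have "1\<^sub>m k * S12 + - H * S22 = 0\<^sub>m k p"
      using S H uminus_mult_left_mat[of H S22] by (intro eq_matI) (auto simp: H(2) simp del: index_mult_mat(1))
    also have "1\<^sub>m k * S11 + - H * S21 = S11 - H * S21"
      using S H uminus_mult_left_mat[of H S21] by (simp add: minus_add_uminus_mat[OF S(1) HS])
    also have "(S11 - H * S21) * ctranspose (1\<^sub>m k) + 0\<^sub>m k p * ctranspose (- H) = S11 - H * S21"
      by (simp only: ctranspose_one left_mult_zero_mat[OF ctranspose_carrier[OF mH]]
          right_mult_one_mat[OF minus_carrier_mat[OF HS]] right_add_zero_mat[OF minus_carrier_mat[OF HS]])
    finally show ?thesis ..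
  qed
  have S22: "S22 = 4 \<cdot>\<^sub>m (D * ctranspose D)"
  proof -
    have "4 \<cdot>\<^sub>m (D * ctranspose D) = (0\<^sub>m p k * S11 + 1\<^sub>m p * S21) * ctranspose (0\<^sub>m p k) + (0\<^sub>m p k * S12 + 1\<^sub>m p * S22) * ctranspose (1\<^sub>m p)"
      unfolding ED[symmetric] BS[symmetric] by (rule row_block_congruence[OF zero_carrier_mat one_carrier_mat S])
    also have "\<dots> = S22" using S by simp
    finally show ?thesis ..
  qed
  let ?U = "four_block_mat C (H * D) (0\<^sub>m p k) D"
  note CC = ctranspose_carrier[OF C(1)] and DC = ctranspose_carrier[OF D(1)]
  have HD: "H * D \<in> carrier_mat k p" using H D by simp
  note HDC = ctranspose_carrier[OF HD]
  have DD: "D * ctranspose D \<in> carrier_mat p p" using D DC by simp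
  have UC: "ctranspose ?U = four_block_mat (ctranspose C) (0\<^sub>m k p) (ctranspose (H * D)) (ctranspose D)"
    using C D H by (intro eq_matI) auto
  have "?U * ctranspose ?U = four_block_mat (C * ctranspose C + H * D * ctranspose (H * D)) (C * 0\<^sub>m k p + H * D * ctranspose D)
      (0\<^sub>m p k * ctranspose C + D * ctranspose (H * D)) (0\<^sub>m p k * 0\<^sub>m k p + D * ctranspose D)"
    unfolding UC by (rule mult_four_block_mat[OF C(1) HD zero_carrier_mat D(1) CC zero_carrier_mat HDC DC])
  also have "C * 0\<^sub>m k p + H * D * ctranspose D = H * (D * ctranspose D)"
    by (simp only: assoc_mult_mat[OF H(1) D(1) DC] right_mult_zero_mat[OF C(1)]
        left_add_zero_mat[OF mult_carrier_mat[OF H(1) DD]])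
  also have "0\<^sub>m p k * ctranspose C + D * ctranspose (H * D) = D * ctranspose D * ctranspose H"
    using left_add_zero_mat[OF mult_carrier_mat[OF DD HC]]
    by (simp only: left_mult_zero_mat[OF CC] ctranspose_mult[OF H(1) D(1)] assoc_mult_mat[OF D(1) DC HC])
  also have "0\<^sub>m p k * 0\<^sub>m k p + D * ctranspose D = D * ctranspose D"
    by (simp only: left_mult_zero_mat[OF zero_carrier_mat] left_add_zero_mat[OF DD])
  also have "H * D * ctranspose (H * D) = H * (D * ctranspose D * ctranspose H)"
    by (simp only: ctranspose_mult[OF H(1) D(1)] assoc_mult_mat[OF D(1) DC HC]
        assoc_mult_mat[OF H(1) D(1) mult_carrier_mat[OF DC HC]])
  finally have UU: "?U * ctranspose ?U = four_block_mat (C * ctranspose C + H * (D * ctranspose D * ctranspose H))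
      (H * (D * ctranspose D)) (D * ctranspose D * ctranspose H) (D * ctranspose D)" .
  have DDH: "D * ctranspose D * ctranspose H \<in> carrier_mat p k" using DD HC by simp
  have f12: "4 \<cdot>\<^sub>m (H * (D * ctranspose D)) = S12"
    using four_smult_mult(1)[OF H(1) DD] H(2) by (simp add: S22)
  have f21: "4 \<cdot>\<^sub>m (D * ctranspose D * ctranspose H) = S21"
    using four_smult_mult(2)[OF DD HC] H(3) by (simp add: S22)
  have f11: "4 \<cdot>\<^sub>m (C * ctranspose C + H * (D * ctranspose D * ctranspose H)) = S11"
  proof -
    have "4 \<cdot>\<^sub>m (C * ctranspose C + H * (D * ctranspose D * ctranspose H)) =
      4 \<cdot>\<^sub>m (C * ctranspose C) + 4 \<cdot>\<^sub>m (H * (D * ctranspose D * ctranspose H))"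
      using C CC H DDH by (intro add_smult_distrib_left_mat[of _ k k]) auto
    also have "4 \<cdot>\<^sub>m (H * (D * ctranspose D * ctranspose H)) = H * S21"
      using four_smult_mult(1)[OF H(1) DDH] by (simp add: f21)
    also have "4 \<cdot>\<^sub>m (C * ctranspose C) = S11 - H * S21" by (rule S112[symmetric])
    also have "S11 - H * S21 + H * S21 = S11"
    proof -
      have "X - Y + Y = X" if "X \<in> carrier_mat k k" "Y \<in> carrier_mat k k" for X Y :: "quat mat"
        using that by (intro eq_matI) auto
      from this[OF S(1) HS] show ?thesis .
    qed
    finally show ?thesis .
  qed
  have "4 \<cdot>\<^sub>m (?U * ctranspose ?U) = four_block_mat S11 S12 S21 S22"
    unfolding UU by (subst smult_four_block_mat[of _ k k _ p _ p])
      (use C CC H DDH DD in \<open>auto simp: f11 f12 f21 S22[symmetric]\<close>)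
  with C D S112 show ?thesis by (intro that[of C C' D D']) auto
qed

section \<open>Real covariance matrices and the final statement\<close>

lemma real_mat_inverse:
  fixes A :: "real mat"
  assumes A: "A \<in> carrier_mat p p" and ker: "\<And>v. v \<in> carrier_vec p \<Longrightarrow> A *\<^sub>v v = 0\<^sub>v p \<Longrightarrow> v = 0\<^sub>v p"
  shows "inv_mat A \<in> carrier_mat p p" "A * inv_mat A = 1\<^sub>m p" "inv_mat A * A = 1\<^sub>m p"
proof -
  have det: "Determinant.det A \<noteq> 0"
    using det_0_iff_vec_prod_zero_field[OF A] ker by auto
  define X where "X = (1 / Determinant.det A) \<cdot>\<^sub>m adj_mat A"
  note adj = adj_mat[OF A]
  have X: "X \<in> carrier_mat p p" using adj by (simp add: X_def)
  have AX: "A * X = 1\<^sub>m p"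
    unfolding X_def using det by (intro eq_matI) (auto simp: mult_smult_distrib[OF A adj(1)] adj(2))
  have XA: "X * A = 1\<^sub>m p" by (rule mat_mult_left_right_inverse[OF A X AX])
  from inv_mat_eqI[OF A X AX XA] X AX XA
  show "inv_mat A \<in> carrier_mat p p" "A * inv_mat A = 1\<^sub>m p" "inv_mat A * A = 1\<^sub>m p" by auto
qed

text \<open>Padding \<open>v\<close> with zeros on top gives a vector \<open>u\<close> whose
  quadratic form is that of \<open>S22\<close> at \<open>v\<close>, namely 0; positive definiteness
  excludes this for nonzero \<open>v\<close>.\<close>

lemma sym_pos_def_lower_block_kernel:
  assumes S: "sym_pos_def (k + p) (four_block_mat S11 S12 S21 S22)"
    and C: "S11 \<in> carrier_mat k k" "S12 \<in> carrier_mat k p" "S21 \<in> carrier_mat p k" "S22 \<in> carrier_mat p p"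
    and v: "v \<in> carrier_vec p" "S22 *\<^sub>v v = 0\<^sub>v p"
  shows "v = 0\<^sub>v p"
proof (rule ccontr)
  assume nz: "v \<noteq> 0\<^sub>v p"
  let ?S = "four_block_mat S11 S12 S21 S22"
  have SC: "?S \<in> carrier_mat (k + p) (k + p)" using C by auto
  define u where "u = Matrix.vec (k + p) (\<lambda>i. if i < k then 0 else v $ (i - k))"
  have u: "u \<in> carrier_vec (k + p)" by (simp add: u_def)
  have "u \<noteq> 0\<^sub>v (k + p)"
  proof
    assume "u = 0\<^sub>v (k + p)"
    then have "u $ (k + i) = 0" if "i < p" for i using that by simp
    then have "v = 0\<^sub>v p" using v(1) by (intro eq_vecI) (auto simp: u_def)
    with nz show False ..
  qed
  then have "0 < u \<bullet> (?S *\<^sub>v u)" using S u by (auto simp: sym_pos_def_def)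
  also have "u \<bullet> (?S *\<^sub>v u) = (\<Sum>i<k + p. u $ i * (?S *\<^sub>v u) $ i)"
    unfolding scalar_prod_def using carrier_matD[OF SC] by (simp only: dim_mult_mat_vec lessThan_atLeast0)
  also have "\<dots> = (\<Sum>i<p. v $ i * (?S *\<^sub>v u) $ (k + i))"
    unfolding sum_lessThan_add by (simp add: u_def)
  also have "\<dots> = 0"
  proof (rule sum.neutral, rule ballI)
    fix i assume "i \<in> {..<p}"
    then have i: "i < p" "k + i < k + p" by auto
    have "(?S *\<^sub>v u) $ (k + i) = (\<Sum>l<p. S22 $$ (i, l) * v $ l)"
      unfolding mat_mult_vec_index_sum[OF SC u i(2)] sum_lessThan_add using i C by (auto simp: u_def)
    also have "\<dots> = (S22 *\<^sub>v v) $ i" by (rule mat_mult_vec_index_sum[OF C(4) v(1) i(1), symmetric])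
    finally show "v $ i * (?S *\<^sub>v u) $ (k + i) = 0" using v i by simp
  qed
  finally show False by simp
qed

lemma quat_wishart_schur_of_real:
  fixes k p n :: nat
  assumes S: "sym_pos_def (k + p) (four_block_mat S11 S12 S21 S22)"
    and SC: "S11 \<in> carrier_mat k k" "S12 \<in> carrier_mat k p" "S21 \<in> carrier_mat p k" "S22 \<in> carrier_mat p p"
    and A: "quat_wishart P (k + p) n (quat_of_real_mat (four_block_mat S11 S12 S21 S22)) A"
    and p: "0 < p" "p \<le> n"
  shows "quat_wishart P k (n - p) (quat_of_real_mat (S11 - S12 * inv_mat S22 * S21)) (\<lambda>\<omega>. schur k (A \<omega>))"
proof -
  let ?S = "four_block_mat S11 S12 S21 S22" and ?q = quat_of_real_mat
  have "transpose_mat ?S = ?S" using S by (simp add: sym_pos_def_def)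
  then have sym: "?S $$ (i, j) = ?S $$ (j, i)" if "i < k + p" "j < k + p" for i j
    using that SC by (metis carrier_matD four_block_carrier_mat index_transpose_mat(1))
  have S21: "S21 = transpose_mat S12"
  proof (rule eq_matI)
    fix i j assume "i < dim_row (transpose_mat S12)" "j < dim_col (transpose_mat S12)"
    with SC have "i < p" "j < k" by auto
    then show "S21 $$ (i, j) = transpose_mat S12 $$ (i, j)" using sym[of "k + i" j] SC by auto
  qed (use SC in auto)
  have S22: "transpose_mat S22 = S22"
  proof (rule eq_matI)
    fix i j assume "i < dim_row S22" "j < dim_col S22"
    with SC have "i < p" "j < p" by auto
    then show "transpose_mat S22 $$ (i, j) = S22 $$ (i, j)" using sym[of "k + i" "k + j"] SC by auto
  qed (use SC in auto)
  let ?X = "inv_mat S22"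
  note X = real_mat_inverse[OF SC(4) sym_pos_def_lower_block_kernel[OF S SC]]
  have XT: "transpose_mat ?X = ?X"
  proof -
    have "S22 * transpose_mat ?X = transpose_mat (?X * S22)"
      by (simp only: transpose_mult[OF X(1) SC(4)] S22)
    moreover have "transpose_mat ?X * S22 = transpose_mat (S22 * ?X)"
      by (simp only: transpose_mult[OF SC(4) X(1)] S22)
    ultimately have "inv_mat S22 = transpose_mat ?X"
      using X by (intro inv_mat_eqI[OF SC(4)]) auto
    then show ?thesis ..
  qed
  define H where "H = S12 * ?X"
  have H: "H \<in> carrier_mat k p" using SC X by (simp add: H_def)
  have HS22: "H * S22 = S12"
    using assoc_mult_mat[OF SC(2) X(1) SC(4)] right_mult_one_mat[OF SC(2)] by (simp only: H_def X(3))
  have S22H: "S22 * transpose_mat H = S21"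
    using transpose_mult[OF H SC(4)] by (simp add: HS22 S22 S21)
  have qSC: "?q S11 \<in> carrier_mat k k" "?q S12 \<in> carrier_mat k p" "?q S21 \<in> carrier_mat p k" "?q S22 \<in> carrier_mat p p"
    and qH: "?q H \<in> carrier_mat k p"
    using SC H by auto
  have qS: "?q ?S = four_block_mat (?q S11) (?q S12) (?q S21) (?q S22)"
    by (rule map_four_block_mat[OF SC])
  from A obtain Q :: "quat mat measure" and Z where "quat_normal_sample Q (k + p) n (?q ?S) Z"
    unfolding quat_wishart_def by blast
  \<comment> \<open>Some factor \<open>B\<close> of the covariance is taken from column 0 of the
    sample, which exists because \<open>0 < p\<close> and \<open>p \<le> n\<close>.\<close>
  then have "quat_normal Q (k + p) (?q ?S) (\<lambda>\<omega>. col (Z \<omega>) 0)"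
    using p unfolding quat_normal_sample_def by auto
  then obtain B where B: "B \<in> carrier_mat (k + p) (k + p)" "invertible_mat B" and BS: "?q ?S = 4 \<cdot>\<^sub>m (B * ctranspose B)"
    unfolding quat_normal_def by blast
  have qHS: "?q H * ?q S22 = ?q S12" "?q S22 * ctranspose (?q H) = ?q S21"
    using quat_of_real_mat_mult[OF H SC(4)] quat_of_real_mat_mult[OF SC(4) transpose_carrier_mat[THEN iffD2, OF H]]
    by (simp_all add: HS22 S22H ctranspose_of_real)
  obtain C C' D D' where C: "C \<in> carrier_mat k k" "C' \<in> carrier_mat k k" "C * C' = 1\<^sub>m k"
    and D: "D \<in> carrier_mat p p" "D' \<in> carrier_mat p p" "D * D' = 1\<^sub>m p"
    and S112: "?q S11 - ?q H * ?q S21 = 4 \<cdot>\<^sub>m (C * ctranspose C)"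
    and fact: "?q ?S = 4 \<cdot>\<^sub>m (four_block_mat C (?q H * D) (0\<^sub>m p k) D * ctranspose (four_block_mat C (?q H * D) (0\<^sub>m p k) D))"
    unfolding qS by (rule block_upper_factorization[OF B qSC BS[unfolded qS] qH qHS])
  have "?q (S11 - S12 * ?X * S21) = 4 \<cdot>\<^sub>m (C * ctranspose C)"
    using SC H unfolding S112[symmetric] H_def[symmetric]
    by (simp add: quat_of_real_mat_minus[of _ k k] quat_of_real_mat_mult[of _ k p _ k])
  then show ?thesis
    using quat_wishart_schur[OF A p C qH D fact] by simp
qed

theorem theorem4:
  fixes P :: "'w measure" and A :: "'w \<Rightarrow> quat mat" and \<Sigma> :: "real mat" and m n :: nat
  assumes "sym_pos_def m \<Sigma>"
    and "quat_wishart P m n (quat_of_real_mat \<Sigma>) A"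
  shows "(\<forall>k. \<forall>M \<in> carrier_mat k m. quat_rank M = k \<longrightarrow>
      quat_wishart P k n (M * quat_of_real_mat \<Sigma> * ctranspose M)
        (\<lambda>\<omega>. M * A \<omega> * ctranspose M))
    \<and> (\<forall>k \<Sigma>\<^sub>1\<^sub>1 \<Sigma>\<^sub>1\<^sub>2 \<Sigma>\<^sub>2\<^sub>1 \<Sigma>\<^sub>2\<^sub>2.
      m \<le> n \<longrightarrow> 1 \<le> k \<longrightarrow> k < m \<longrightarrow>
      split_block \<Sigma> k k = (\<Sigma>\<^sub>1\<^sub>1, \<Sigma>\<^sub>1\<^sub>2, \<Sigma>\<^sub>2\<^sub>1, \<Sigma>\<^sub>2\<^sub>2) \<longrightarrow>
      quat_wishart P k (n - m + k)
        (quat_of_real_mat (\<Sigma>\<^sub>1\<^sub>1 - \<Sigma>\<^sub>1\<^sub>2 * inv_mat \<Sigma>\<^sub>2\<^sub>2 * \<Sigma>\<^sub>2\<^sub>1))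
        (\<lambda>\<omega>. case split_block (A \<omega>) k k of
          (A\<^sub>1\<^sub>1, A\<^sub>1\<^sub>2, A\<^sub>2\<^sub>1, A\<^sub>2\<^sub>2) \<Rightarrow> A\<^sub>1\<^sub>1 - A\<^sub>1\<^sub>2 * inv_mat A\<^sub>2\<^sub>2 * ctranspose A\<^sub>1\<^sub>2))"
proof (intro conjI allI ballI impI)
  fix k and M :: "quat mat"
  assume M: "M \<in> carrier_mat k m" "quat_rank M = k"
  show "quat_wishart P k n (M * quat_of_real_mat \<Sigma> * ctranspose M) (\<lambda>\<omega>. M * A \<omega> * ctranspose M)"
    by (rule quat_wishart_congruence[OF assms(2) M(1) left_independent_of_quat_rank[OF M]])
next
  fix k \<Sigma>\<^sub>1\<^sub>1 \<Sigma>\<^sub>1\<^sub>2 \<Sigma>\<^sub>2\<^sub>1 \<Sigma>\<^sub>2\<^sub>2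
  assume mn: "m \<le> n" and k: "1 \<le> k" "k < m"
    and split: "split_block \<Sigma> k k = (\<Sigma>\<^sub>1\<^sub>1, \<Sigma>\<^sub>1\<^sub>2, \<Sigma>\<^sub>2\<^sub>1, \<Sigma>\<^sub>2\<^sub>2)"
  obtain p where m: "m = k + p" and p: "0 < p" using k(2) by (metis less_imp_add_positive)
  have "dim_row \<Sigma> = k + p" "dim_col \<Sigma> = k + p"
    using assms(1) m by (auto simp: sym_pos_def_def)
  note blocks = split_block[OF split this]
  have "quat_wishart P k (n - p) (quat_of_real_mat (\<Sigma>\<^sub>1\<^sub>1 - \<Sigma>\<^sub>1\<^sub>2 * inv_mat \<Sigma>\<^sub>2\<^sub>2 * \<Sigma>\<^sub>2\<^sub>1)) (\<lambda>\<omega>. schur k (A \<omega>))"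
    by (rule quat_wishart_schur_of_real[OF _ blocks(1-4)])
      (use assms m mn p in \<open>simp_all add: blocks(5)[symmetric]\<close>)
  \<comment> \<open>Subtraction of natural numbers is truncated; \<open>m \<le> n\<close> makes both
    sides exact.\<close>
  moreover have "n - p = n - m + k" using mn m by simp
  ultimately show "quat_wishart P k (n - m + k)
        (quat_of_real_mat (\<Sigma>\<^sub>1\<^sub>1 - \<Sigma>\<^sub>1\<^sub>2 * inv_mat \<Sigma>\<^sub>2\<^sub>2 * \<Sigma>\<^sub>2\<^sub>1))
        (\<lambda>\<omega>. case split_block (A \<omega>) k k of
          (A\<^sub>1\<^sub>1, A\<^sub>1\<^sub>2, A\<^sub>2\<^sub>1, A\<^sub>2\<^sub>2) \<Rightarrow> A\<^sub>1\<^sub>1 - A\<^sub>1\<^sub>2 * inv_mat A\<^sub>2\<^sub>2 * ctranspose A\<^sub>1\<^sub>2)"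
    unfolding schur_def by simp
qed

end
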